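(* Let $G$ be a nilpotent topological group. If $V$ is a continuous weakly almost periodic (wap) Banach $G$-module such that $V^G=\{0\}$, then $\bar H_c^1(G,V)=0$.
   Context: A nilpotent topological group is a topological group that is nilpotent as an abstract group. Banach spaces are over the real or complex numbers. A Banach $G$-module is a Banach space $V$ with a linear representation $\rho\colon G\to GL(V)$ by invertible bounded operators. It is continuous if for every $v\in V$ the map $g\mapsto\rho(g)v$ is continuous from $G$ to $V$ with the norm topology. It is weakly almost periodic (wap) if for every $v\in V$ the orbit $\rho(G)v$ is relatively weakly compact in $V$. $V^G$ is the subspace of vectors fixed by all $\rho(g)$, $g\in G$. Reduced continuous cohomology: for a topological group $G$ and a continuous Banach $G$-module $V$, let $C(G^{n+1},V)$ be the space of continuous maps $G^{n+1}\to V$ (norm topology on $V$), with the compact-open topology, and let $C(G^{n+1},V)^G$ be the subspace of $G$-equivariant maps, i.e. $c(gg_0,\dots,gg_n)=\rho(g)c(g_0,\dots,g_n)$. The differential $\partial\colon C(G^{n},V)^G\to C(G^{n+1},V)^G$ is $(\partial c)(g_0,\dots,g_n)=\sum_{k=0}^n(-1)^k c(g_0,\dots,\widehat{g_k},\dots,g_n)$; the complex $C(G^{*+1},V)^G$ starts in degree $0$ with $C(G,V)^G$. Let $Z^n(G,V)\subset C(G^{n+1},V)^G$ be the kernel of $\partial$ and $B^n(G,V)\subset C(G^{n+1},V)^G$ the image of $\partial$. Then $\bar H_c^n(G,V)=Z^n(G,V)/\overline{B^n(G,V)}$, the closure being in the compact-open topology. *)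

theory Defs
  imports
    "HOL-Analysis.Analysis"
    "HOL-Algebra.Generated_Groups"
    "HOL-Algebra.Elementary_Groups"
begin

section \<open>Nilpotent topological groups\<close>

locale topological_group = group G for G (structure) +
  fixes T :: "'g topology"
  assumes topspace_eq: "topspace T = carrier G"
    and continuous_mult: "continuous_map (prod_topology T T) T (\<lambda>(x, y). x \<otimes> y)"
    and continuous_inv: "continuous_map T T (\<lambda>x. inv x)"

primrec lower_central :: "('g, 'm) monoid_scheme \<Rightarrow> nat \<Rightarrow> 'g set" where
  "lower_central G 0 = carrier G"
| "lower_central G (Suc k) =
     generate G {x \<otimes>\<^bsub>G\<^esub> y \<otimes>\<^bsub>G\<^esub> inv\<^bsub>G\<^esub> x \<otimes>\<^bsub>G\<^esub> inv\<^bsub>G\<^esub> y | x y. x \<in> lower_central G k \<and> y \<in> carrier G}"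

definition nilpotent_group :: "('g, 'm) monoid_scheme \<Rightarrow> bool" where
  "nilpotent_group G \<longleftrightarrow> group G \<and> (\<exists>k. lower_central G k = {\<one>\<^bsub>G\<^esub>})"

section \<open>Banach spaces over the real or complex numbers\<close>

text \<open>
  The scalar fields are exactly the real and the complex numbers: either every scalar is real, or
  the field is generated over the reals by a square root of -1. In the second case
  multiplicativity of the norm forces it to be the usual modulus.
\<close>

class real_or_complex_field = real_normed_field +
  assumes real_or_complex:
    "(\<forall>z. \<exists>a. z = a *\<^sub>R 1) \<or> (\<exists>i. i * i = -1 \<and> (\<forall>z. \<exists>a b. z = a *\<^sub>R 1 + b *\<^sub>R i))"

instance real :: real_or_complex_field
  by standard auto

instance complex :: real_or_complex_field
proof
  have "\<i> * \<i> = -1 \<and> (\<forall>z. \<exists>a b. z = a *\<^sub>R 1 + b *\<^sub>R \<i>)"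
  proof (intro conjI allI)
    fix z :: complex
    have "z = Re z *\<^sub>R 1 + Im z *\<^sub>R \<i>"
      by (simp add: complex_eq_iff)
    then show "\<exists>a b. z = a *\<^sub>R 1 + b *\<^sub>R \<i>"
      by blast
  qed simp
  then show "(\<forall>z::complex. \<exists>a. z = a *\<^sub>R 1) \<or>
      (\<exists>i::complex. i * i = -1 \<and> (\<forall>z. \<exists>a b. z = a *\<^sub>R 1 + b *\<^sub>R i))"
    by blast
qed

text \<open>
  The class \<open>banach\<close> provides the norm, completeness and the underlying real vector space; the
  scalar multiplication by the field has to extend the latter.
\<close>

locale banach_space_over = vector_space sc
  for sc :: "'k::real_or_complex_field \<Rightarrow> 'v::banach \<Rightarrow> 'v" +
  assumes scale_of_real: "sc (of_real r) v = r *\<^sub>R v"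
    and norm_scale: "norm (sc a v) = norm a * norm v"

definition bounded_operator :: "('k::real_or_complex_field \<Rightarrow> 'v::banach \<Rightarrow> 'v) \<Rightarrow> ('v \<Rightarrow> 'v) \<Rightarrow> bool"
  where "bounded_operator sc f \<longleftrightarrow> bounded_linear f \<and> (\<forall>a v. f (sc a v) = sc a (f v))"

definition bounded_functional ::
    "('k::real_or_complex_field \<Rightarrow> 'v::banach \<Rightarrow> 'v) \<Rightarrow> ('v \<Rightarrow> 'k) \<Rightarrow> bool"
  where "bounded_functional sc f \<longleftrightarrow> bounded_linear f \<and> (\<forall>a v. f (sc a v) = a * f v)"

definition weak_topology :: "('k::real_or_complex_field \<Rightarrow> 'v::banach \<Rightarrow> 'v) \<Rightarrow> 'v topology"
  where "weak_topology sc =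
    topology_generated_by {f -` U | f U. bounded_functional sc f \<and> open U}"

definition relatively_weakly_compact ::
    "('k::real_or_complex_field \<Rightarrow> 'v::banach \<Rightarrow> 'v) \<Rightarrow> 'v set \<Rightarrow> bool"
  where "relatively_weakly_compact sc A \<longleftrightarrow>
    compactin (weak_topology sc) (weak_topology sc closure_of A)"

definition GL :: "('k::real_or_complex_field \<Rightarrow> 'v::banach \<Rightarrow> 'v) \<Rightarrow> ('v \<Rightarrow> 'v) monoid" where
  "GL sc =
    \<lparr>carrier = {f. bij f \<and> bounded_operator sc f \<and> bounded_operator sc (inv_into UNIV f)},
     mult = (\<circ>), one = id\<rparr>"

section \<open>Banach modules\<close>

locale banach_module = group G + banach_space_over sc
  for G :: "('g, 'm) monoid_scheme" (structure)
    and sc :: "'k::real_or_complex_field \<Rightarrow> 'v::banach \<Rightarrow> 'v" +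
  fixes \<rho> :: "'g \<Rightarrow> 'v \<Rightarrow> 'v"
  assumes representation: "\<rho> \<in> hom G (GL sc)"

locale continuous_banach_module = topological_group G T + banach_module G sc \<rho>
  for G :: "('g, 'm) monoid_scheme" (structure)
    and T :: "'g topology"
    and sc :: "'k::real_or_complex_field \<Rightarrow> 'v::banach \<Rightarrow> 'v"
    and \<rho> :: "'g \<Rightarrow> 'v \<Rightarrow> 'v" +
  assumes continuous_orbit_map: "continuous_map T euclidean (\<lambda>g. \<rho> g v)"

definition weakly_almost_periodic ::
    "('g, 'm) monoid_scheme \<Rightarrow> ('k::real_or_complex_field \<Rightarrow> 'v::banach \<Rightarrow> 'v) \<Rightarrow>
     ('g \<Rightarrow> 'v \<Rightarrow> 'v) \<Rightarrow> bool"
  where "weakly_almost_periodic G sc \<rho> \<longleftrightarrow>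
    (\<forall>v. relatively_weakly_compact sc ((\<lambda>g. \<rho> g v) ` carrier G))"

definition fixed_vectors :: "('g, 'm) monoid_scheme \<Rightarrow> ('g \<Rightarrow> 'v \<Rightarrow> 'v) \<Rightarrow> 'v set" where
  "fixed_vectors G \<rho> = {v. \<forall>g\<in>carrier G. \<rho> g v = v}"

section \<open>Reduced continuous cohomology\<close>

text \<open>
  Maps on the carrier of a topology are represented by functions vanishing outside of it, so that
  equality and the vector space operations are those of total functions.
\<close>

definition continuous_maps :: "'a topology \<Rightarrow> ('a \<Rightarrow> 'v::real_normed_vector) set" where
  "continuous_maps X = {c. continuous_map X euclidean c \<and> (\<forall>x. x \<notin> topspace X \<longrightarrow> c x = 0)}"

definition compact_open_topology :: "'a topology \<Rightarrow> ('a \<Rightarrow> 'v::real_normed_vector) topology" where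
  "compact_open_topology X =
    topology_generated_by {{c \<in> continuous_maps X. c ` K \<subseteq> U} | K U. compactin X K \<and> open U}"

text \<open>The power \<open>G\<^sup>n\<close> consists of the tuples indexed by \<open>{..<n}\<close>.\<close>

abbreviation power_topology :: "'g topology \<Rightarrow> nat \<Rightarrow> (nat \<Rightarrow> 'g) topology" where
  "power_topology T n \<equiv> product_topology (\<lambda>_. T) {..<n}"

text \<open>Below, \<open>cochains G T \<rho> n\<close> is \<open>C(G\<^sup>n, V)\<^sup>G\<close>, that is, the cochains of degree \<open>n - 1\<close>.\<close>

definition cochains ::
    "('g, 'm) monoid_scheme \<Rightarrow> 'g topology \<Rightarrow> ('g \<Rightarrow> 'v::real_normed_vector \<Rightarrow> 'v) \<Rightarrow> nat \<Rightarrow>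
     ((nat \<Rightarrow> 'g) \<Rightarrow> 'v) set"
  where "cochains G T \<rho> n =
    {c \<in> continuous_maps (power_topology T n).
       \<forall>g\<in>carrier G. \<forall>x\<in>topspace (power_topology T n).
         c (\<lambda>i\<in>{..<n}. g \<otimes>\<^bsub>G\<^esub> x i) = \<rho> g (c x)}"

definition omit :: "nat \<Rightarrow> nat \<Rightarrow> (nat \<Rightarrow> 'g) \<Rightarrow> (nat \<Rightarrow> 'g)" where
  "omit n k x = (\<lambda>i\<in>{..<n}. if i < k then x i else x (Suc i))"

definition differential ::
    "'g topology \<Rightarrow> nat \<Rightarrow> ((nat \<Rightarrow> 'g) \<Rightarrow> 'v::real_normed_vector) \<Rightarrow> (nat \<Rightarrow> 'g) \<Rightarrow> 'v"
  where "differential T n c =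
    (\<lambda>x. if x \<in> topspace (power_topology T (Suc n))
         then (\<Sum>k\<le>n. (-1) ^ k *\<^sub>R c (omit n k x)) else 0)"

definition cocycles ::
    "('g, 'm) monoid_scheme \<Rightarrow> 'g topology \<Rightarrow> ('g \<Rightarrow> 'v::real_normed_vector \<Rightarrow> 'v) \<Rightarrow> nat \<Rightarrow>
     ((nat \<Rightarrow> 'g) \<Rightarrow> 'v) set"
  where "cocycles G T \<rho> n = {c \<in> cochains G T \<rho> (Suc n). differential T (Suc n) c = (\<lambda>_. 0)}"

text \<open>The complex starts with \<open>C(G, V)\<^sup>G\<close> in degree 0, so there are no nonzero coboundaries there.\<close>

definition coboundaries ::
    "('g, 'm) monoid_scheme \<Rightarrow> 'g topology \<Rightarrow> ('g \<Rightarrow> 'v::real_normed_vector \<Rightarrow> 'v) \<Rightarrow> nat \<Rightarrow>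
     ((nat \<Rightarrow> 'g) \<Rightarrow> 'v) set"
  where "coboundaries G T \<rho> n =
    (if n = 0 then {\<lambda>_. 0} else differential T n ` cochains G T \<rho> n)"

definition closed_coboundaries ::
    "('g, 'm) monoid_scheme \<Rightarrow> 'g topology \<Rightarrow> ('g \<Rightarrow> 'v::real_normed_vector \<Rightarrow> 'v) \<Rightarrow> nat \<Rightarrow>
     ((nat \<Rightarrow> 'g) \<Rightarrow> 'v) set"
  where "closed_coboundaries G T \<rho> n =
    subtopology (compact_open_topology (power_topology T (Suc n))) (cochains G T \<rho> (Suc n))
      closure_of coboundaries G T \<rho> n"

definition cocycle_group ::
    "('g, 'm) monoid_scheme \<Rightarrow> 'g topology \<Rightarrow> ('g \<Rightarrow> 'v::real_normed_vector \<Rightarrow> 'v) \<Rightarrow> nat \<Rightarrow>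
     ((nat \<Rightarrow> 'g) \<Rightarrow> 'v) monoid"
  where "cocycle_group G T \<rho> n =
    \<lparr>carrier = cocycles G T \<rho> n, mult = (\<lambda>c d x. c x + d x), one = (\<lambda>_. 0)\<rparr>"

text \<open>The quotient of vector spaces is recorded through its underlying additive group.\<close>

definition reduced_cohomology ::
    "('g, 'm) monoid_scheme \<Rightarrow> 'g topology \<Rightarrow> ('g \<Rightarrow> 'v::real_normed_vector \<Rightarrow> 'v) \<Rightarrow> nat \<Rightarrow>
     ((nat \<Rightarrow> 'g) \<Rightarrow> 'v) set monoid"
  where "reduced_cohomology G T \<rho> n = cocycle_group G T \<rho> n Mod closed_coboundaries G T \<rho> n"

end

theory Submission
  imports Defs "HOL-Library.Diagonal_Subsequence"
begin

text \<open>
  A 1-cocycle amounts to a map \<open>b\<close> with \<open>b (g h) = b g + \<rho> g (b h)\<close>, and the claim is that on compact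
  sets \<open>b\<close> is uniformly approximated by maps \<open>g \<mapsto> u - \<rho> g u\<close>. One descends along the lower central
  series. Suppose that \<open>b\<close> vanishes on the term \<open>H\<close>, has \<open>H\<close>-fixed values, and let \<open>Z\<close> be the term
  preceding \<open>H\<close>. On the \<open>H\<close>-fixed vectors the operators of \<open>Z\<close> commute with those of \<open>G\<close>, and for
  \<open>z \<in> Z\<close> the difference \<open>b - \<rho> z b\<close> is the coboundary of \<open>b z\<close>. So convex combinations \<open>M\<close> of
  \<open>\<rho> Z\<close> change \<open>b\<close> by coboundaries, and by the mean ergodic theorem suitable \<open>M b\<close> converge to \<open>P b\<close>,
  with \<open>P\<close> the projection onto the \<open>Z\<close>-fixed vectors. On \<open>Z\<close> the cocycle \<open>P b\<close> has \<open>G\<close>-fixed values,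
  hence vanishes there, and the induction continues.

  The mean ergodic theorem for an orbit that is merely relatively weakly compact usually rests on
  Krein's theorem. Here, if it failed, Hahn-Banach separation would give functionals \<open>f n\<close> and finite
  sets \<open>S n\<close> in the orbit such that \<open>f n\<close> separates \<open>S n\<close> uniformly from all later averages. This
  contradicts Simons' inequality on the weak closure of \<open>\<Union>n. S n\<close>.
\<close>

section \<open>Hahn-Banach and uniform boundedness\<close>

text \<open>Operators of one step commute only on the \<open>H\<close>-fixed vectors, which is why
  the induction carries the condition that \<open>b\<close> takes its values there. On that subspace
  averages commute, so finitely many requirements can be met by one composite average. All averages
  share the Lipschitz constant \<open>C\<close> that uniform boundedness provides; this turns
  convergence at single vectors into uniform convergence on compact sets of vectors. The ergodic
  theorem rests on a dichotomy. Either for each \<open>d > 0\<close> some point is approached within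
  \<open>d\<close> by further averages of every average \<open>M v\<close>, and then completeness
  yields the limit. Or for some \<open>d\<close> every point, and hence every convex hull of
  finitely many orbit points, can be avoided for good by a suitable average. Weak compactness enters
  only through maxima of real functionals, so the analysis takes place in a real Banach space; the
  scalar field matters only when the weak topology is compared with real functionals.\<close>

definition sublinear :: "('a::real_vector \<Rightarrow> real) \<Rightarrow> bool" where
  "sublinear p \<longleftrightarrow> (\<forall>x y. p (x + y) \<le> p x + p y) \<and> (\<forall>t>0. \<forall>x. p (t *\<^sub>R x) = t * p x)"

lemma sublinear_add: "sublinear p \<Longrightarrow> p (x + y) \<le> p x + p y"
  and sublinear_scale: "sublinear p \<Longrightarrow> 0 < t \<Longrightarrow> p (t *\<^sub>R x) = t * p x"
  by (auto simp: sublinear_def)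

lemma sublinear_zero: "sublinear p \<Longrightarrow> p 0 = 0"
  using sublinear_scale[of p 2 0] by simp

lemma sublinear_minus: "sublinear p \<Longrightarrow> - p (- x) \<le> p x"
  using sublinear_add[of p x "- x"] sublinear_zero[of p] by simp

text \<open>Half of homogeneity suffices, since the other inequality follows by scaling back with
  \<open>1/t\<close>. The index \<open>k\<close> may depend on the arguments; this lets one lemma
  serve infima of chains, of shifts along a ray, of distances to a cone, and upper limits.\<close>

lemma sublinear_Inf:
  fixes q :: "'i \<Rightarrow> 'a::real_vector \<Rightarrow> real"
  assumes ne: "I \<noteq> {}" and bdd: "\<And>x. bdd_below ((\<lambda>i. q i x) ` I)"
    and add: "\<And>i j x y. i \<in> I \<Longrightarrow> j \<in> I \<Longrightarrow> \<exists>k\<in>I. q k (x + y) \<le> q i x + q j y"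
    and scale: "\<And>i t x. i \<in> I \<Longrightarrow> 0 < t \<Longrightarrow> \<exists>k\<in>I. q k (t *\<^sub>R x) \<le> t * q i x"
  shows "sublinear (\<lambda>x. INF i\<in>I. q i x)"
proof -
  define p where "p x = (INF i\<in>I. q i x)" for x
  have low: "p x \<le> q i x" if "i \<in> I" for i x
    unfolding p_def using bdd that by (rule cINF_lower)
  have p_add: "p (x + y) \<le> p x + p y" for x y
  proof -
    have 1: "p (x + y) - q j y \<le> p x" if j: "j \<in> I" for j
      unfolding p_def[of x] using ne
    proof (rule cINF_greatest)
      fix i assume i: "i \<in> I"
      obtain k where k: "k \<in> I" "q k (x + y) \<le> q i x + q j y" using add[OF i j] by blast
      show "p (x + y) - q j y \<le> q i x" using low[OF k(1), of "x + y"] k(2) by linarith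
    qed
    have "p (x + y) - p x \<le> p y"
      unfolding p_def[of y] using ne
    proof (rule cINF_greatest)
      fix j assume "j \<in> I"
      then show "p (x + y) - p x \<le> q j y" using 1[of j] by linarith
    qed
    then show ?thesis by linarith
  qed
  have p_le: "p (t *\<^sub>R x) \<le> t * p x" if t: "0 < t" for t x
  proof -
    have "p (t *\<^sub>R x) / t \<le> p x"
      unfolding p_def[of x] using ne
    proof (rule cINF_greatest)
      fix i assume i: "i \<in> I"
      obtain k where k: "k \<in> I" "q k (t *\<^sub>R x) \<le> t * q i x" using scale[OF i t] by blast
      have "p (t *\<^sub>R x) \<le> t * q i x" using low[OF k(1), of "t *\<^sub>R x"] k(2) by linarith
      then show "p (t *\<^sub>R x) / t \<le> q i x" using t by (simp add: divide_le_eq mult.commute)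
    qed
    then show ?thesis using t by (simp add: divide_le_eq mult.commute)
  qed
  have "p (t *\<^sub>R x) = t * p x" if t: "0 < t" for t x
  proof -
    have "p ((1/t) *\<^sub>R t *\<^sub>R x) \<le> (1/t) * p (t *\<^sub>R x)" using t by (intro p_le) simp
    then have "t * p x \<le> p (t *\<^sub>R x)" using t by (simp add: field_simps)
    then show ?thesis using p_le[OF t, of x] by linarith
  qed
  then show ?thesis using p_add unfolding sublinear_def p_def by blast
qed

text \<open>Shifting along the ray of \<open>y\<close> and taking the infimum lowers
  \<open>q\<close> to a sublinear function. Minimality forbids any lowering, and
  \<open>t = 1\<close> then reads as superadditivity.\<close>

lemma minimal_sublinear_linear:
  assumes q: "sublinear q" and min: "\<And>r. sublinear r \<Longrightarrow> (\<And>x. r x \<le> q x) \<Longrightarrow> r = q"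
  shows "linear q"
proof -
  have super: "q x + q y \<le> q (x + y)" for x y
  proof -
    define s where "s = (\<lambda>t z. q (z + t *\<^sub>R y) - t * q y)"
    define r where "r = (\<lambda>z. INF t\<in>{0..}. s t z)"
    \<comment> \<open>A lower bound independent of \<open>t\<close>, so that the infimum over the
      ray is finite.\<close>
    have low: "- q (- z) \<le> s t z" if "t \<in> {0..}" for t z
    proof -
      have "q (t *\<^sub>R y) = t * q y"
        using that sublinear_scale[OF q, of t y] sublinear_zero[OF q] by (cases "t = 0") auto
      moreover have "q (t *\<^sub>R y) \<le> q (z + t *\<^sub>R y) + q (- z)"
        using sublinear_add[OF q, of "z + t *\<^sub>R y" "- z"] by simp
      ultimately show ?thesis unfolding s_def by linarith
    qed
    have bdd: "bdd_below ((\<lambda>t. s t z) ` {0..})" for z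
      using low by (intro bdd_belowI2[where m = "- q (- z)"]) auto
    have "sublinear r"
      unfolding r_def
    proof (rule sublinear_Inf)
      show "{0::real..} \<noteq> {}" by auto
      show "bdd_below ((\<lambda>t. s t z) ` {0..})" for z by (rule bdd)
      fix t u :: real and z w assume tu: "t \<in> {0..}" "u \<in> {0..}"
      have "s (t + u) (z + w) \<le> s t z + s u w"
        using sublinear_add[OF q, of "z + t *\<^sub>R y" "w + u *\<^sub>R y"]
        unfolding s_def by (simp add: algebra_simps)
      then show "\<exists>k\<in>{0..}. s k (z + w) \<le> s t z + s u w" using tu by (intro bexI[of _ "t + u"]) auto
    next
      fix t u :: real and z assume tu: "t \<in> {0..}" "0 < u"
      have "s (u * t) (u *\<^sub>R z) = u * s t z"
        using sublinear_scale[OF q \<open>0 < u\<close>, of "z + t *\<^sub>R y"]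
        unfolding s_def by (simp add: algebra_simps)
      then show "\<exists>k\<in>{0..}. s k (u *\<^sub>R z) \<le> u * s t z" using tu by (intro bexI[of _ "u * t"]) auto
    qed
    moreover have r_low: "r z \<le> s t z" if "t \<ge> 0" for t z
      unfolding r_def using bdd that by (intro cINF_lower) auto
    moreover have "r z \<le> q z" for z using r_low[of 0 z] unfolding s_def by simp
    ultimately have "r = q" using min by blast
    then show ?thesis using r_low[of 1 x] unfolding s_def by simp
  qed
  have add: "q (x + y) = q x + q y" for x y using super[of x y] sublinear_add[OF q, of x y] by linarith
  have neg: "q (- x) = - q x" for x using add[of x "- x"] sublinear_zero[OF q] by simp
  have "q (t *\<^sub>R x) = t * q x" for t x
  proof (cases "t > 0")
    case False
    then show ?thesis
      using sublinear_scale[OF q, of "- t" x] sublinear_zero[OF q] neg[of "t *\<^sub>R x"]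
      by (cases "t = 0") auto
  qed (rule sublinear_scale[OF q])
  then show ?thesis using add by (intro linearI) auto
qed

text \<open>Hahn-Banach without a subspace to extend from: Zorn's lemma for the reversed pointwise
  order gives a minimal sublinear function below \<open>p\<close>, and minimal ones are linear.
  Chains have infima because \<open>- p (- x)\<close> bounds all their members from below.\<close>

theorem linear_below_sublinear:
  assumes p: "sublinear p"
  shows "\<exists>f. linear f \<and> (\<forall>x. f x \<le> p x)"
proof -
  define A where "A = {q. sublinear q \<and> (\<forall>x. q x \<le> p x)}"
  have "\<exists>m\<in>A. \<forall>a\<in>A. a \<le> m \<longrightarrow> a = m"
  proof (rule predicate_Zorn[of A "\<lambda>a b. b \<le> a"])
    show "partial_order_on A (relation_of (\<lambda>a b. b \<le> a) A)"
      by (rule partial_order_on_relation_ofI) auto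
  next
    fix C assume C: "C \<in> Chains (relation_of (\<lambda>a b. b \<le> a) A)"
    have CA: "C \<subseteq> A" using Chains_relation_of[OF C] .
    have chain: "a \<le> b \<or> b \<le> a" if "a \<in> C" "b \<in> C" for a b
      using C that unfolding Chains_def relation_of_def by auto
    show "\<exists>u\<in>A. \<forall>a\<in>C. u \<le> a"
    proof (cases "C = {}")
      case True
      then show ?thesis using p unfolding A_def by auto
    next
      case False
      define u where "u = (\<lambda>x. INF a\<in>C. a x)"
      have bdd: "bdd_below ((\<lambda>a. a x) ` C)" for x
      proof (rule bdd_belowI2[where m = "- p (- x)"])
        fix a assume "a \<in> C"
        then have a: "sublinear a" "a (- x) \<le> p (- x)" using CA unfolding A_def by auto
        then show "- p (- x) \<le> a x" using sublinear_minus[OF a(1), of x] by linarith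
      qed
      have low: "u x \<le> a x" if "a \<in> C" for a x
        unfolding u_def using bdd that by (rule cINF_lower)
      have "sublinear u"
        unfolding u_def
      proof (rule sublinear_Inf[OF False bdd])
        fix a b x y assume ab: "a \<in> C" "b \<in> C"
        have sl: "sublinear a" "sublinear b" using ab CA unfolding A_def by auto
        from chain[OF ab] show "\<exists>k\<in>C. k (x + y) \<le> a x + b y"
        proof
          assume "a \<le> b"
          then show ?thesis using ab(1) sublinear_add[OF sl(1), of x y] by (intro bexI[of _ a]) (auto simp: le_fun_def intro: order_trans add_left_mono)
        next
          assume "b \<le> a"
          then show ?thesis using ab(2) sublinear_add[OF sl(2), of x y] by (intro bexI[of _ b]) (auto simp: le_fun_def intro: order_trans add_right_mono)
        qed
      next
        fix a x and t :: real assume "a \<in> C" "0 < t"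
        then show "\<exists>k\<in>C. k (t *\<^sub>R x) \<le> t * a x"
          using CA sublinear_scale[of a t x] unfolding A_def by (intro bexI[of _ a]) auto
      qed
      moreover have "u x \<le> p x" for x
      proof -
        obtain a where a: "a \<in> C" using False by blast
        then have "a x \<le> p x" using CA unfolding A_def by auto
        then show ?thesis using low[OF a, of x] by linarith
      qed
      ultimately show ?thesis using low unfolding A_def by (intro bexI[of _ u]) (auto simp: le_fun_def)
    qed
  qed
  then obtain m where m: "m \<in> A" and min: "\<And>a. a \<in> A \<Longrightarrow> a \<le> m \<Longrightarrow> a = m" by blast
  have "linear m"
  proof (rule minimal_sublinear_linear)
    show "sublinear m" using m unfolding A_def by auto
    fix r assume r: "sublinear r" "\<And>x. r x \<le> m x"
    then have "r \<in> A" using m unfolding A_def by (auto intro: order_trans)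
    then show "r = m" using r(2) by (intro min) (auto simp: le_fun_def)
  qed
  then show ?thesis using m unfolding A_def by auto
qed

text \<open>The infimum of \<open>norm (x + t q) - t d\<close> over \<open>t \<ge> 0\<close> and \<open>q \<in> Q\<close> is sublinear
  in \<open>x\<close>, at most the norm, and at most \<open>- d\<close> on \<open>- Q\<close>.\<close>

lemma separation_from_ball:
  fixes Q :: "'a::real_normed_vector set"
  assumes Q: "convex Q" "Q \<noteq> {}" and d: "0 \<le> d" "\<And>x. x \<in> Q \<Longrightarrow> d \<le> norm x"
  shows "\<exists>f. linear f \<and> (\<forall>x. \<bar>f x\<bar> \<le> norm x) \<and> (\<forall>x\<in>Q. d \<le> f x)"
proof -
  define I where "I = {0::real..} \<times> Q"
  define s where "s = (\<lambda>(t, q) (x::'a). norm (x + t *\<^sub>R q) - t * d)"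
  define p where "p x = (INF i\<in>I. s i x)" for x
  have bdd: "bdd_below ((\<lambda>i. s i x) ` I)" for x
  proof (rule bdd_belowI2[where m = "- norm x"])
    fix i assume "i \<in> I"
    then obtain t q where i: "i = (t, q)" "t \<ge> 0" "q \<in> Q" unfolding I_def by auto
    have "t * d \<le> norm (t *\<^sub>R q)" using i d(2)[of q] by (simp add: mult_left_mono)
    also have "\<dots> \<le> norm (x + t *\<^sub>R q) + norm x"
      using norm_triangle_ineq4[of "x + t *\<^sub>R q" x] by simp
    finally show "- norm x \<le> s i x" unfolding i(1) s_def by simp
  qed
  have low: "p x \<le> norm (x + t *\<^sub>R q) - t * d" if "t \<ge> 0" "q \<in> Q" for x t q
    using cINF_lower[OF bdd[of x], of "(t, q)"] that unfolding p_def s_def I_def by simp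
  have "sublinear (\<lambda>x. INF i\<in>I. s i x)"
  proof (rule sublinear_Inf[OF _ bdd])
    show "I \<noteq> {}" using Q(2) unfolding I_def by auto
    fix i j :: "real \<times> 'a" and x y assume ij: "i \<in> I" "j \<in> I"
    obtain t q u r where i: "i = (t, q)" "t \<ge> 0" "q \<in> Q" and j: "j = (u, r)" "u \<ge> 0" "r \<in> Q"
      using ij unfolding I_def by auto
    show "\<exists>k\<in>I. s k (x + y) \<le> s i x + s j y"
    proof (cases "t + u = 0")
      case True
      then have "t = 0" "u = 0" using i j by auto
      then have "s i (x + y) \<le> s i x + s j y"
        unfolding i j s_def using norm_triangle_ineq[of x y] by simp
      then show ?thesis using ij by blast
    next
      case False
      then have pos: "t + u > 0" using i j by auto
      \<comment> \<open>Convexity enters here: \<open>t q + u r\<close> is \<open>t + u\<close>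
        times a point of \<open>Q\<close>. The weights are meaningless for \<open>t = u = 0\<close>,
        which was treated apart.\<close>
      define w where "w = (t / (t + u)) *\<^sub>R q + (u / (t + u)) *\<^sub>R r"
      have "w \<in> Q" unfolding w_def using Q(1) i j pos
        by (intro convexD) (auto simp: add_divide_distrib[symmetric])
      moreover have "(t + u) *\<^sub>R w = t *\<^sub>R q + u *\<^sub>R r"
        unfolding w_def using pos by (simp add: scaleR_add_right)
      then have "s (t + u, w) (x + y) \<le> s i x + s j y"
        unfolding i j s_def using norm_triangle_ineq[of "x + t *\<^sub>R q" "y + u *\<^sub>R r"]
        by (simp add: algebra_simps)
      ultimately show ?thesis using pos unfolding I_def by (intro bexI[of _ "(t + u, w)"]) auto
    qed
  next
    fix i :: "real \<times> 'a" and c :: real and x assume ic: "i \<in> I" "0 < c"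
    obtain t q where i: "i = (t, q)" "t \<ge> 0" "q \<in> Q" using ic unfolding I_def by auto
    have "norm (c *\<^sub>R x + (c * t) *\<^sub>R q) = c * norm (x + t *\<^sub>R q)"
      using ic(2) norm_scaleR[of c "x + t *\<^sub>R q"] by (simp add: scaleR_add_right)
    then have "s (c * t, q) (c *\<^sub>R x) \<le> c * s i x"
      unfolding i s_def by (simp add: algebra_simps)
    then show "\<exists>k\<in>I. s k (c *\<^sub>R x) \<le> c * s i x"
      using ic i unfolding I_def by (intro bexI[of _ "(c * t, q)"]) auto
  qed
  then obtain f where f: "linear f" and fp: "\<And>x. f x \<le> p x"
    using linear_below_sublinear unfolding p_def by blast
  obtain q0 where "q0 \<in> Q" using Q(2) by blast
  then have le: "f x \<le> norm x" for x using low[of 0 q0 x] fp[of x] by simp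
  have "\<bar>f x\<bar> \<le> norm x" for x
    using le[of x] le[of "- x"] linear_neg[OF f, of x] by simp
  moreover have "d \<le> f x" if "x \<in> Q" for x
    using low[of 1 x "- x"] that fp[of "- x"] linear_neg[OF f, of x] by simp
  ultimately show ?thesis using f by blast
qed

lemma bounded_linear_of_norm_bound:
  fixes f :: "'a::real_normed_vector \<Rightarrow> 'b::real_normed_vector"
  assumes "linear f" "\<And>x. norm (f x) \<le> norm x * K"
  shows "bounded_linear f"
  using assms by (intro bounded_linear_intro[where K = K]) (auto simp: linear_add linear_scale)

lemma norming_functional:
  fixes x :: "'a::real_normed_vector"
  shows "\<exists>f. linear f \<and> (\<forall>y. \<bar>f y\<bar> \<le> norm y) \<and> f x = norm x"
proof -
  obtain f where f: "linear f" "\<And>y. \<bar>f y\<bar> \<le> norm y" "norm x \<le> f x"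
    using separation_from_ball[of "{x}" "norm x"] by auto
  moreover have "f x = norm x" using f(2)[of x] f(3) by simp
  ultimately show ?thesis by blast
qed

text \<open>By Baire's theorem one of the closed sets \<open>E n\<close> contains a ball, and
  differences of values on that ball control every operator.\<close>

theorem uniform_boundedness:
  fixes T :: "'i \<Rightarrow> 'a::banach \<Rightarrow> 'b::real_normed_vector"
  assumes lin: "\<And>i. i \<in> I \<Longrightarrow> bounded_linear (T i)"
    and bdd: "\<And>x. \<exists>c. \<forall>i\<in>I. norm (T i x) \<le> c"
  shows "\<exists>C>0. \<forall>i\<in>I. \<forall>x. norm (T i x) \<le> C * norm x"
proof -
  define E where "E n = (\<Inter>i\<in>I. {x. norm (T i x) \<le> real n})" for n :: nat
  have closed: "closed (E n)" for n
    unfolding E_def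
  proof (intro closed_INT ballI)
    fix i assume "i \<in> I"
    then have "continuous_on UNIV (T i)" using lin linear_continuous_on by blast
    then show "closed {x. norm (T i x) \<le> real n}"
      by (intro closed_Collect_le continuous_intros) auto
  qed
  have cover: "\<exists>n. x \<in> E n" for x
  proof -
    obtain c where c: "\<forall>i\<in>I. norm (T i x) \<le> c" using bdd by blast
    obtain n where "c \<le> real n" using real_arch_simple by blast
    then show ?thesis using c unfolding E_def by (intro exI[of _ n]) force
  qed
  have "\<exists>n. interior (E n) \<noteq> {}"
  proof (rule ccontr)
    assume *: "\<not> ?thesis"
    have "Met_TC.mtopology interior_of \<Union>(range E) = {}"
    proof (rule Met_TC.metric_Baire_category_alt)
      show "Met_TC.mcomplete TYPE('a)" by (simp add: complete_UNIV)
      fix U assume "U \<in> range E"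
      then show "closedin Met_TC.mtopology U \<and> Met_TC.mtopology interior_of U = {}"
        using closed * by auto
    qed simp
    moreover have "\<Union>(range E) = UNIV" using cover by auto
    ultimately show False by simp
  qed
  then obtain n x0 where "x0 \<in> interior (E n)" by blast
  then obtain e where e: "e > 0" "cball x0 e \<subseteq> E n" by (meson mem_interior_cball)
  have nb: "norm (T i (x0 + y)) \<le> n" if "i \<in> I" "norm y \<le> e" for i y
  proof -
    have "x0 + y \<in> E n" using e(2) that(2) by (auto simp: dist_norm)
    then show ?thesis using that(1) unfolding E_def by auto
  qed
  \<comment> \<open>Two points of the ball give the factor \<open>2 n / e\<close>; the added 1 keeps
    the constant positive for \<open>n = 0\<close>.\<close>
  have "norm (T i x) \<le> (2 * real n / e + 1) * norm x" if i: "i \<in> I" for i x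
  proof (cases "x = 0")
    case True
    then show ?thesis using linear_0[OF bounded_linear.linear[OF lin[OF i]]] by simp
  next
    case False
    interpret bounded_linear "T i" using lin i .
    define y where "y = (e / norm x) *\<^sub>R x"
    have "norm y = e" using False e(1) unfolding y_def by simp
    then have "norm (T i (x0 + y)) \<le> n" "norm (T i (x0 + 0)) \<le> n"
      using nb[OF i, of y] nb[OF i, of 0] e(1) by auto
    moreover have "T i y = T i (x0 + y) - T i (x0 + 0)" by (simp add: add)
    ultimately have "norm (T i y) \<le> 2 * real n" by (smt (verit) norm_triangle_ineq4)
    then have "(e / norm x) * norm (T i x) \<le> 2 * real n" unfolding y_def scaleR using False e(1) by simp
    then have "norm (T i x) \<le> (2 * real n / e) * norm x" using e(1) False by (simp add: field_simps)
    then show ?thesis using norm_ge_zero[of x] unfolding distrib_right by linarith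
  qed
  moreover have "2 * real n / e + 1 > 0" using e(1) by (simp add: add_nonneg_pos)
  ultimately show ?thesis by (intro exI[of _ "2 * real n / e + 1"]) blast
qed

text \<open>Points act as functionals on the dual, which is complete whatever the space, so uniform
  boundedness applies there. A norming functional of \<open>x\<close> then recovers
  \<open>norm x\<close>.\<close>

lemma bounded_of_weakly_bounded:
  fixes A :: "'a::real_normed_vector set"
  assumes wb: "\<And>f :: 'a \<Rightarrow> real. bounded_linear f \<Longrightarrow> \<exists>c. \<forall>x\<in>A. \<bar>f x\<bar> \<le> c"
  shows "\<exists>c. \<forall>x\<in>A. norm x \<le> c"
proof -
  have "\<exists>C>0. \<forall>x\<in>A. \<forall>F :: 'a \<Rightarrow>\<^sub>L real. norm (blinfun_apply F x) \<le> C * norm F"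
    by (rule uniform_boundedness) (auto intro: bounded_linear_intros wb blinfun.bounded_linear_right)
  then obtain C where C: "C > 0" "\<And>x F. x \<in> A \<Longrightarrow> norm (blinfun_apply (F :: 'a \<Rightarrow>\<^sub>L real) x) \<le> C * norm F"
    by blast
  have "norm x \<le> C" if x: "x \<in> A" for x
  proof -
    obtain f where f: "linear f" "\<And>y. \<bar>f y\<bar> \<le> norm y" "f x = norm x"
      using norming_functional[of x] by blast
    have bl: "bounded_linear f" using f by (intro bounded_linear_of_norm_bound[where K = 1]) auto
    have "norm (Blinfun f) \<le> 1"
      using bl f(2) by (intro norm_blinfun_bound) (auto simp: bounded_linear_Blinfun_apply)
    then have "C * norm (Blinfun f) \<le> C" using C(1) by simp
    then show ?thesis using C(2)[OF x, of "Blinfun f"] bl f(3) by (simp add: bounded_linear_Blinfun_apply)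
  qed
  then show ?thesis by blast
qed

section \<open>Simons' inequality\<close>

lemma halves_summable:
  fixes a :: "nat \<Rightarrow> real"
  assumes "\<And>k. \<bar>a k\<bar> \<le> M"
  shows "summable (\<lambda>k. (1/2) ^ Suc k * a k)"
proof (rule summable_comparison_test')
  show "summable (\<lambda>k. (1/2) ^ Suc k * M)"
    using sums_mult2[OF power_half_series, of M] by (auto simp: sums_iff)
  show "norm ((1/2) ^ Suc k * a k) \<le> (1/2) ^ Suc k * M" if "k \<ge> 0" for k
    using assms[of k] by (simp add: abs_mult)
qed

definition halves :: "(nat \<Rightarrow> real) \<Rightarrow> real" where
  "halves a = (\<Sum>k. (1/2) ^ Suc k * a k)"

lemma halves_mono:
  assumes "\<And>k. \<bar>a k\<bar> \<le> M" "\<And>k. \<bar>b k\<bar> \<le> M" "\<And>k. a k \<le> b k"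
  shows "halves a \<le> halves b"
  unfolding halves_def
  using assms by (intro suminf_le halves_summable[of _ M] mult_left_mono) auto

lemma halves_const: "halves (\<lambda>k. c) = c"
  using sums_mult2[OF power_half_series, of c] unfolding halves_def by (simp add: sums_iff)

lemma halves_le:
  assumes "\<And>k. \<bar>a k\<bar> \<le> M" "\<And>k. a k \<le> c"
  shows "halves a \<le> c"
  using halves_mono[of a "max M \<bar>c\<bar>" "\<lambda>_. c"] assms
  by (force simp: halves_const le_max_iff_disj)

lemma halves_abs_le:
  assumes "\<And>k. \<bar>a k\<bar> \<le> M"
  shows "\<bar>halves a\<bar> \<le> M"
proof -
  have "halves a \<le> M" by (rule halves_le[OF assms]) (use assms abs_le_D1 in blast)
  moreover have "halves (\<lambda>k. - M) \<le> halves a"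
    using assms order_trans[OF abs_ge_zero assms]
    by (intro halves_mono[of _ M]) (auto simp: abs_le_iff minus_le_iff)
  ultimately show ?thesis by (simp add: halves_const)
qed

lemma halves_add:
  assumes "\<And>k. \<bar>a k\<bar> \<le> M" "\<And>k. \<bar>b k\<bar> \<le> N"
  shows "halves (\<lambda>k. a k + b k) = halves a + halves b"
  unfolding halves_def
  using suminf_add[OF halves_summable[of a, OF assms(1)] halves_summable[of b, OF assms(2)]]
  by (simp add: distrib_left del: power_Suc)

lemma halves_mult:
  assumes "\<And>k. \<bar>a k\<bar> \<le> M"
  shows "halves (\<lambda>k. c * a k) = c * halves a"
  unfolding halves_def
  using suminf_mult[OF halves_summable[of a, OF assms], of c] by (simp add: ac_simps)

text \<open>The dyadic weights are self-similar: what follows the first term is again such a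
  combination, with weight one half. Simons' recursion and the induction in
  \<open>halves_liminf\<close> both run on this.\<close>

lemma halves_Suc:
  assumes "\<And>k. \<bar>a k\<bar> \<le> M"
  shows "halves a = (a 0 + halves (\<lambda>k. a (Suc k))) / 2"
proof -
  have "(\<Sum>k. (1/2) ^ Suc (Suc k) * a (Suc k)) = halves a - (1/2) * a 0"
    unfolding halves_def using suminf_split_head[OF halves_summable[of a, OF assms]] by simp
  moreover have "(\<Sum>k. (1/2) ^ Suc (Suc k) * a (Suc k)) = (1/2) * halves (\<lambda>k. a (Suc k))"
    unfolding halves_def
    using suminf_mult[OF halves_summable[of "\<lambda>k. a (Suc k)"], of M "1/2"] assms by (simp add: ac_simps)
  ultimately show ?thesis by simp
qed

text \<open>A Fatou lemma: the lower bounds hold for the first \<open>n\<close> terms simultaneously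
  from some \<open>j\<close> on, and the remaining terms have total weight
  \<open>(1/2) ^ n\<close>.\<close>

lemma halves_liminf:
  assumes bd: "\<And>k j. \<bar>a k j\<bar> \<le> M"
    and ev: "\<And>k e. e > 0 \<Longrightarrow> eventually (\<lambda>j. a k j \<ge> d - e) sequentially" and e: "e > 0"
  shows "eventually (\<lambda>j. halves (\<lambda>k. a k j) \<ge> d - e) sequentially"
proof -
  \<comment> \<open>The last term is the cost of the uncontrolled tail, at most
    \<open>M + |d|\<close> per unit of weight. The quantifier over \<open>a\<close> is needed since
    the induction step passes to \<open>\<lambda>k. a (Suc k)\<close>.\<close>
  have "\<forall>a :: nat \<Rightarrow> nat \<Rightarrow> real. (\<forall>k j. \<bar>a k j\<bar> \<le> M) \<longrightarrow>
      (\<forall>k. \<forall>e>0. eventually (\<lambda>j. a k j \<ge> d - e) sequentially) \<longrightarrow>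
      (\<forall>e>0. eventually (\<lambda>j. halves (\<lambda>k. a k j) \<ge> d - e - (1/2) ^ n * (M + \<bar>d\<bar>)) sequentially)" for n
  proof (induction n)
    case 0
    show ?case
    proof (intro allI impI always_eventually)
      fix a :: "nat \<Rightarrow> nat \<Rightarrow> real" and e :: real and j assume *: "\<forall>k j. \<bar>a k j\<bar> \<le> M" "0 < e"
      then have "\<bar>halves (\<lambda>k. a k j)\<bar> \<le> M" by (intro halves_abs_le) auto
      then show "d - e - (1/2) ^ 0 * (M + \<bar>d\<bar>) \<le> halves (\<lambda>k. a k j)" using *(2) by simp
    qed
  next
    case (Suc n)
    show ?case
    proof (intro allI impI)
      fix a :: "nat \<Rightarrow> nat \<Rightarrow> real" and e :: real
      assume *: "\<forall>k j. \<bar>a k j\<bar> \<le> M" "\<forall>k. \<forall>e>0. eventually (\<lambda>j. a k j \<ge> d - e) sequentially" "0 < e"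
      have "eventually (\<lambda>j. halves (\<lambda>k. a (Suc k) j) \<ge> d - e - (1/2) ^ n * (M + \<bar>d\<bar>)) sequentially"
        using Suc.IH[rule_format, of "\<lambda>k. a (Suc k)" e] * by blast
      moreover have "eventually (\<lambda>j. a 0 j \<ge> d - e) sequentially" using *(2,3) by blast
      ultimately show "eventually (\<lambda>j. halves (\<lambda>k. a k j) \<ge> d - e - (1/2) ^ Suc n * (M + \<bar>d\<bar>)) sequentially"
      proof eventually_elim
        case (elim j)
        have "halves (\<lambda>k. a k j) = (a 0 j + halves (\<lambda>k. a (Suc k) j)) / 2"
          using * by (intro halves_Suc[of _ M]) auto
        moreover obtain t where "(1/2) ^ n * (M + \<bar>d\<bar>) = t" "(1/2) ^ Suc n * (M + \<bar>d\<bar>) = t / 2"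
          by simp
        ultimately show ?case using elim by (simp only:) argo
      qed
    qed
  qed
  note * = this
  have "(\<lambda>n. (1/2) ^ n * (M + \<bar>d\<bar>)) \<longlonglongrightarrow> 0 * (M + \<bar>d\<bar>)"
    by (intro tendsto_mult tendsto_const LIMSEQ_power_zero) auto
  then have "eventually (\<lambda>n. (1/2) ^ n * (M + \<bar>d\<bar>) < e / 2) sequentially"
    using e by (intro order_tendstoD) auto
  then obtain n where n: "(1/2) ^ n * (M + \<bar>d\<bar>) < e / 2" by (auto simp: eventually_sequentially)
  have "eventually (\<lambda>j. halves (\<lambda>k. a k j) \<ge> d - e / 2 - (1/2) ^ n * (M + \<bar>d\<bar>)) sequentially"
    using *[rule_format, of a "e / 2" n] bd ev e by auto
  then show ?thesis by eventually_elim (use n in linarith)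
qed

text \<open>Simons' argument: \<open>g\<close> is chosen greedily so that each partial sum \<open>p n\<close> of
  \<open>p = (\<Sum>k. (1/2) ^ Suc k * g k)\<close> almost minimises the supremum; at a point \<open>y\<close> where \<open>p\<close> attains its
  supremum the rescaled tails \<open>r n = 2 ^ n * (p - p n)\<close> then hardly decrease.\<close>

theorem simons_inequality:
  fixes C :: "nat \<Rightarrow> ('a \<Rightarrow> real) set"
  assumes ne: "\<And>n. C n \<noteq> {}" and dec: "\<And>n. C (Suc n) \<subseteq> C n"
    and bd: "\<And>g x. g \<in> C 0 \<Longrightarrow> x \<in> K \<Longrightarrow> \<bar>g x\<bar> \<le> M"
    and closed: "\<And>n g. (\<And>k. g k \<in> C n) \<Longrightarrow> (\<lambda>x. halves (\<lambda>k. g k x)) \<in> C n"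
    and attains: "\<And>g. g \<in> C 0 \<Longrightarrow> \<exists>y\<in>K. d \<le> g y \<and> (\<forall>x\<in>K. g x \<le> g y)"
    and small: "\<And>y e. y \<in> K \<Longrightarrow> e > 0 \<Longrightarrow> \<exists>n. \<forall>q\<in>C n. q y \<le> e"
  shows "d \<le> 0"
proof (rule ccontr)
  assume "\<not> d \<le> 0"
  then have d: "d > 0" by simp
  have mono: "C n \<subseteq> C m" if "m \<le> n" for m n
    using that dec by (metis lift_Suc_antimono_le)
  obtain g0 where "g0 \<in> C 0" using ne by blast
  then have Kne: "K \<noteq> {}" using attains by blast
  define S where "S f = (SUP x\<in>K. f x)" for f :: "'a \<Rightarrow> real"
  \<comment> \<open>Dividing by the remaining weight \<open>(1/2) ^ n\<close> leaves
    \<open>d / 4 * (1/2) ^ n\<close>. These errors sum to \<open>d / 2\<close>, so half of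
    \<open>d\<close> survives.\<close>
  define eps where "eps n = d / 4 * (1/4) ^ n" for n :: nat
  have eps_pos: "eps n > 0" for n using d unfolding eps_def by simp
  have S_upper: "f x \<le> S f" if "x \<in> K" "\<And>x. x \<in> K \<Longrightarrow> f x \<le> B" for f x B
    unfolding S_def using that by (intro cSUP_upper bdd_aboveI2[of _ _ B]) auto
  have choose: "\<exists>g\<in>C (Suc n). \<forall>q\<in>C (Suc n).
      S (\<lambda>x. p x + (1/2) ^ n * g x) \<le> S (\<lambda>x. p x + (1/2) ^ n * q x) + eps n"
    if p: "\<And>x. x \<in> K \<Longrightarrow> \<bar>p x\<bar> \<le> B" for p n B
  proof -
    define J where "J = (\<lambda>q. S (\<lambda>x. p x + (1/2) ^ n * q x))"
    have low: "- B - (1/2) ^ n * M \<le> J q" if q: "q \<in> C (Suc n)" for q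
    proof -
      obtain x where x: "x \<in> K" using Kne by blast
      have qb: "\<bar>q x\<bar> \<le> M" if "x \<in> K" for x using q mono[of 0 "Suc n"] bd that by blast
      have b: "\<bar>(1/2) ^ n * q x\<bar> \<le> (1/2) ^ n * M" if "x \<in> K" for x
        using qb[OF that] by (simp add: abs_mult)
      have "p x + (1/2) ^ n * q x \<le> J q"
        unfolding J_def
      proof (rule S_upper[OF x])
        fix y assume "y \<in> K"
        then show "p y + (1/2) ^ n * q y \<le> B + (1/2) ^ n * M" using p[of y] b[of y] by linarith
      qed
      then show ?thesis using p[OF x] b[OF x] by linarith
    qed
    have bb: "bdd_below (J ` C (Suc n))" using low by (rule bdd_belowI2)
    have "\<exists>g\<in>C (Suc n). J g < (INF q\<in>C (Suc n). J q) + eps n"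
    proof (rule ccontr)
      assume "\<not> ?thesis"
      then have "(INF q\<in>C (Suc n). J q) + eps n \<le> (INF q\<in>C (Suc n). J q)"
        using ne by (intro cINF_greatest) (auto simp: not_less)
      then show False using eps_pos[of n] by simp
    qed
    then obtain g where g: "g \<in> C (Suc n)" "J g < (INF q\<in>C (Suc n). J q) + eps n" by blast
    have "J g \<le> J q + eps n" if "q \<in> C (Suc n)" for q
      using cINF_lower[OF bb that] g(2) by linarith
    then show ?thesis using g(1) unfolding J_def by blast
  qed
  \<comment> \<open>Competitors enter with weight \<open>(1/2) ^ n\<close>, the whole weight still
    to be distributed, although the choice afterwards receives only half of it,
    \<open>(1/2) ^ Suc n\<close>. In this way the true remainder \<open>r n\<close> is itself a
    competitor.\<close>
  define pick where "pick p n = (SOME g. g \<in> C (Suc n) \<and> (\<forall>q\<in>C (Suc n).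
      S (\<lambda>x. p x + (1/2) ^ n * g x) \<le> S (\<lambda>x. p x + (1/2) ^ n * q x) + eps n))" for p n
  define p where "p = rec_nat (\<lambda>_. 0) (\<lambda>n p x. p x + (1/2) ^ Suc n * pick p n x)"
  define g where "g n = pick (p n) n" for n
  have p0: "p 0 = (\<lambda>_. 0)" and pS: "p (Suc n) = (\<lambda>x. p n x + (1/2) ^ Suc n * g n x)" for n
    by (auto simp: p_def g_def)
  have pick: "pick p n \<in> C (Suc n) \<and> (\<forall>q\<in>C (Suc n).
      S (\<lambda>x. p x + (1/2) ^ n * pick p n x) \<le> S (\<lambda>x. p x + (1/2) ^ n * q x) + eps n)"
    if p: "\<exists>B. \<forall>x\<in>K. \<bar>p x\<bar> \<le> B" for p :: "'a \<Rightarrow> real" and n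
  proof -
    obtain B where "\<And>x. x \<in> K \<Longrightarrow> \<bar>p x\<bar> \<le> B" using p by blast
    from choose[where p = p and n = n, OF this] show ?thesis
      unfolding pick_def Bex_def by (rule someI_ex)
  qed
  have p_bd: "\<exists>B. \<forall>x\<in>K. \<bar>p n x\<bar> \<le> B" for n
  proof (induction n)
    case 0
    then show ?case unfolding p0 by auto
  next
    case (Suc n)
    then obtain B where B: "\<And>x. x \<in> K \<Longrightarrow> \<bar>p n x\<bar> \<le> B" by blast
    have "g n \<in> C 0" using pick[OF Suc, of n] mono[of 0 "Suc n"] unfolding g_def by blast
    then have gb: "\<bar>g n x\<bar> \<le> M" if "x \<in> K" for x using bd that by blast
    have "\<bar>p (Suc n) x\<bar> \<le> B + (1/2) ^ Suc n * M" if x: "x \<in> K" for x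
    proof -
      have "\<bar>(1/2) ^ Suc n * g n x\<bar> \<le> (1/2) ^ Suc n * M" using gb[OF x] by (simp add: abs_mult)
      then show ?thesis unfolding pS using B[OF x] by linarith
    qed
    then show ?case by blast
  qed
  have gC: "g n \<in> C (Suc n)" for n using pick[OF p_bd, of n] unfolding g_def by blast
  have g_min: "S (\<lambda>x. p n x + (1/2) ^ n * g n x) \<le> S (\<lambda>x. p n x + (1/2) ^ n * q x) + eps n"
    if "q \<in> C (Suc n)" for n q using pick[OF p_bd, of n] that unfolding g_def by blast
  define r where "r n x = halves (\<lambda>k. g (n + k) x)" for n x
  have gb: "\<bar>g n x\<bar> \<le> M" if "x \<in> K" for n x using gC[of n] mono[of 0 "Suc n"] bd that by blast
  have rC: "r n \<in> C (Suc n)" for n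
    unfolding r_def
  proof (rule closed)
    show "g (n + k) \<in> C (Suc n)" for k using gC[of "n + k"] mono[of "Suc n" "Suc (n + k)"] by auto
  qed
  have rS: "r n x = (g n x + r (Suc n) x) / 2" if "x \<in> K" for n x
    unfolding r_def using halves_Suc[of "\<lambda>k. g (n + k) x", OF gb[OF that]] by simp
  have total: "p n x + (1/2) ^ n * r n x = r 0 x" if x: "x \<in> K" for n x
  proof (induction n)
    case (Suc n)
    have "p (Suc n) x + (1/2) ^ Suc n * r (Suc n) x = p n x + (1/2) ^ n * r n x"
      unfolding pS rS[OF x, of n] by (simp add: field_simps)
    then show ?case using Suc by simp
  qed (simp add: p0)
  obtain y where y: "y \<in> K" "d \<le> r 0 y" "\<And>x. x \<in> K \<Longrightarrow> r 0 x \<le> r 0 y"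
    using attains[of "r 0"] rC[of 0] dec by blast
  \<comment> \<open>As \<open>r n\<close> competes with \<open>g n\<close> and completes the partial
    sum to \<open>r 0\<close>, whose supremum is attained at \<open>y\<close>, the value
    \<open>g n y\<close> exceeds \<open>r n y\<close> only slightly. Since \<open>r n\<close> is the
    mean of \<open>g n\<close> and \<open>r (Suc n)\<close>, the latter cannot drop much.\<close>
  have step: "r (Suc n) y \<ge> r n y - d / 4 * (1/2) ^ n" for n
  proof -
    have "S (\<lambda>x. p n x + (1/2) ^ n * r n x) = S (r 0)"
      unfolding S_def using total by (intro SUP_cong) auto
    moreover have "S (r 0) \<le> r 0 y" unfolding S_def using Kne y(3) by (intro cSUP_least) auto
    moreover obtain B where B: "\<And>x. x \<in> K \<Longrightarrow> \<bar>p n x\<bar> \<le> B" using p_bd by blast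
    have "p n y + (1/2) ^ n * g n y \<le> S (\<lambda>x. p n x + (1/2) ^ n * g n x)"
    proof (rule S_upper[OF y(1)])
      fix x assume x: "x \<in> K"
      have "\<bar>(1/2) ^ n * g n x\<bar> \<le> (1/2) ^ n * M" using gb[OF x] by (simp add: abs_mult)
      then show "p n x + (1/2) ^ n * g n x \<le> B + (1/2) ^ n * M" using B[OF x] by linarith
    qed
    ultimately have "p n y + (1/2) ^ n * g n y \<le> r 0 y + eps n"
      using g_min[OF rC[of n]] by linarith
    then have "(1/2) ^ n * (g n y - r n y) \<le> eps n"
      using total[OF y(1), of n] by (simp add: algebra_simps)
    then have "g n y - r n y \<le> d / 4 * (1/2) ^ n"
    proof -
      have "eps n = (1/2) ^ n * (d / 4 * (1/2) ^ n)"
        unfolding eps_def using power_mult_distrib[of "1/2 :: real" "1/2" n] by simp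
      with \<open>(1/2) ^ n * (g n y - r n y) \<le> eps n\<close>
      have "(1/2) ^ n * (g n y - r n y) \<le> (1/2) ^ n * (d / 4 * (1/2) ^ n)" by (simp only:)
      then show ?thesis by (rule mult_left_le_imp_le) simp
    qed
    moreover have "2 * r n y = g n y + r (Suc n) y" using rS[OF y(1), of n] by simp
    ultimately show ?thesis by linarith
  qed
  have "r n y \<ge> d - d / 2 * (1 - (1/2) ^ n)" for n
  proof (induction n)
    case (Suc n)
    then show ?case using step[of n] by (simp add: algebra_simps)
  qed (use y in simp)
  moreover have "d / 2 * (1 - (1/2) ^ n) \<le> d / 2" for n :: nat using d by simp
  ultimately have big: "r n y \<ge> d / 2" for n using order_trans[of "d / 2"] by (smt (verit) field_sum_of_halves)
  obtain n where "\<forall>q\<in>C n. q y \<le> d / 4" using small[OF y(1), of "d / 4"] d by auto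
  then have "r n y \<le> d / 4" using rC dec by blast
  then show False using big[of n] d by simp
qed

section \<open>Limits of sequences of functionals, and the impossibility of uniform
  separation\<close>

lemma halves_diff:
  assumes "\<And>k. \<bar>a k\<bar> \<le> M" "\<And>k. \<bar>b k\<bar> \<le> N"
  shows "halves (\<lambda>k. a k - b k) = halves a - halves b"
  using halves_add[of a M "\<lambda>k. (- 1) * b k" N] halves_mult[of b N "- 1"] assms by simp

lemma pointwise_convergent_subsequence:
  fixes g :: "nat \<Rightarrow> nat \<Rightarrow> real"
  assumes "\<And>n k. \<bar>g n k\<bar> \<le> M k"
  shows "\<exists>r. strict_mono r \<and> (\<forall>k. convergent (\<lambda>n. g (r n) k))"
proof -
  define P where "P k s = convergent (\<lambda>n. g (s n) k)" for k and s :: "nat \<Rightarrow> nat"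
  interpret subseqs P
  proof
    fix k and s :: "nat \<Rightarrow> nat"
    have "seq_compact {- M k..M k}" by (simp add: compact_imp_seq_compact)
    moreover have "\<forall>n. g (s n) k \<in> {- M k..M k}" using assms by (auto simp: abs_le_iff minus_le_iff)
    ultimately obtain l r' where "strict_mono r'" "((\<lambda>n. g (s n) k) \<circ> r') \<longlonglongrightarrow> l"
      unfolding seq_compact_def by metis
    then show "\<exists>r'. strict_mono r' \<and> P k (s \<circ> r')"
      unfolding P_def o_def convergent_def by blast
  qed
  have "convergent (\<lambda>n. g (diagseq n) k)" for k
  proof -
    have "P k (diagseq \<circ> ((+) (Suc k)))"
    proof (rule diagseq_holds)
      fix r s :: "nat \<Rightarrow> nat" and n assume "strict_mono r" "P n s"
      then show "P n (s \<circ> r)"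
        unfolding P_def using convergent_subseq_convergent[of "\<lambda>i. g (s i) n" r] by (simp add: o_def)
    qed
    then have "convergent (\<lambda>n. g (diagseq (n + Suc k)) k)"
      unfolding P_def by (simp add: o_def add.commute)
    then show ?thesis using convergent_ignore_initial_segment[of "\<lambda>n. g (diagseq n) k" "Suc k"] by simp
  qed
  then show ?thesis using subseq_diagseq by blast
qed

text \<open>The only consequence of relative weak compactness that is needed; \<open>K\<close> stands for the weak
  closure of \<open>S\<close>.\<close>

definition functionals_attain :: "'a::real_normed_vector set \<Rightarrow> bool" where
  "functionals_attain X \<longleftrightarrow> (\<forall>S\<subseteq>X. S \<noteq> {} \<longrightarrow> (\<exists>K. S \<subseteq> K \<and> (\<forall>f :: 'a \<Rightarrow> real. bounded_linear f \<longrightarrow>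
     (\<exists>y\<in>K. \<forall>x\<in>K. f x \<le> f y) \<and> (\<forall>c. (\<forall>x\<in>S. f x \<le> c) \<longrightarrow> (\<forall>x\<in>K. f x \<le> c)))))"

definition contraction_functional :: "('a::real_normed_vector \<Rightarrow> real) \<Rightarrow> bool" where
  "contraction_functional f \<longleftrightarrow> linear f \<and> (\<forall>x. \<bar>f x\<bar> \<le> norm x)"

lemma contraction_functional_bounded_linear: "contraction_functional f \<Longrightarrow> bounded_linear f"
  unfolding contraction_functional_def
  by (intro bounded_linear_of_norm_bound[where K = 1]) auto

text \<open>The set of convergence is a subspace, and the common Lipschitz constant 1 makes it norm
  closed.\<close>

lemma convergent_on_closed_span:
  fixes F :: "nat \<Rightarrow> 'a::real_normed_vector \<Rightarrow> real"
  assumes F: "\<And>n. contraction_functional (F n)" and conv: "\<And>x. x \<in> U \<Longrightarrow> convergent (\<lambda>n. F n x)"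
    and x: "x \<in> closure (span U)"
  shows "convergent (\<lambda>n. F n x)"
proof -
  have lin: "linear (F n)" and le: "\<bar>F n y\<bar> \<le> norm y" for n y
    using F unfolding contraction_functional_def by auto
  have "subspace {x. convergent (\<lambda>n. F n x)}"
    by (rule subspaceI)
      (auto simp: linear_0[OF lin] linear_add[OF lin] linear_scale[OF lin] convergent_const
        intro: convergent_add convergent_mult)
  then have span: "convergent (\<lambda>n. F n y)" if "y \<in> span U" for y
    using span_minimal[of U "{x. convergent (\<lambda>n. F n x)}"] conv that by blast
  have "Cauchy (\<lambda>n. F n x)"
    unfolding Cauchy_def
  proof (intro allI impI)
    fix e :: real assume e: "e > 0"
    obtain y where y: "y \<in> span U" "dist y x < e / 3"
      using x e unfolding closure_approachable by (meson zero_less_divide_iff zero_less_numeral)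
    have "Cauchy (\<lambda>n. F n y)" using span[OF y(1)] by (rule convergent_Cauchy)
    then obtain N where N: "\<And>m n. m \<ge> N \<Longrightarrow> n \<ge> N \<Longrightarrow> dist (F m y) (F n y) < e / 3"
      unfolding Cauchy_def using e by (meson zero_less_divide_iff zero_less_numeral)
    have Fxy: "\<bar>F n x - F n y\<bar> < e / 3" for n
      using le[of n "x - y"] y(2) by (simp add: linear_diff[OF lin] dist_norm norm_minus_commute)
    then have "dist (F m x) (F n x) < e" if "m \<ge> N" "n \<ge> N" for m n
      using N[OF that] Fxy[of m] Fxy[of n] unfolding dist_real_def by linarith
    then show "\<exists>N. \<forall>m\<ge>N. \<forall>n\<ge>N. dist (F m x) (F n x) < e" by blast
  qed
  then show ?thesis by (rule real_Cauchy_convergent)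
qed

text \<open>A linear functional below the upper limit, which is sublinear.\<close>

lemma extended_limit_functional:
  fixes F :: "nat \<Rightarrow> 'a::real_normed_vector \<Rightarrow> real"
  assumes F: "\<And>n. contraction_functional (F n)"
  shows "\<exists>f. contraction_functional f \<and> (\<forall>x l. (\<lambda>n. F n x) \<longlonglongrightarrow> l \<longrightarrow> f x = l)"
proof -
  have lin: "linear (F n)" and le: "\<bar>F n y\<bar> \<le> norm y" for n y
    using F unfolding contraction_functional_def by auto
  define q where "q n x = (SUP k\<in>{n..}. F k x)" for n x
  define p where "p x = (INF n\<in>UNIV. q n x)" for x
  have bd: "bdd_above ((\<lambda>k. F k x) ` {n..})" for n x
    using le by (intro bdd_aboveI2[where M = "norm x"]) (auto simp: abs_le_iff)
  have q_upper: "F k x \<le> q n x" if "k \<ge> n" for k n x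
    unfolding q_def using bd that by (intro cSUP_upper) auto
  have q_least: "q n x \<le> c" if "\<And>k. k \<ge> n \<Longrightarrow> F k x \<le> c" for n x c
    unfolding q_def using that by (intro cSUP_least) auto
  have low: "- norm x \<le> q n x" for n x
    using q_upper[of n n x] le[of n x] by linarith
  have bb: "bdd_below (range (\<lambda>n. q n x))" for x using low by (intro bdd_belowI2)
  have p_le: "p x \<le> q n x" for n x unfolding p_def using bb by (intro cINF_lower) auto
  have "sublinear (\<lambda>x. INF n\<in>UNIV. q n x)"
  proof (rule sublinear_Inf[OF _ bb])
    fix i j x y
    have "q (max i j) (x + y) \<le> q i x + q j y"
      by (rule q_least) (auto simp: linear_add[OF lin] intro!: add_mono q_upper)
    then show "\<exists>k\<in>UNIV. q k (x + y) \<le> q i x + q j y" by blast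
  next
    fix i x and t :: real assume "0 < t"
    then have "q i (t *\<^sub>R x) \<le> t * q i x"
      by (intro q_least) (auto simp: linear_scale[OF lin] intro!: q_upper)
    then show "\<exists>k\<in>UNIV. q k (t *\<^sub>R x) \<le> t * q i x" by blast
  qed simp
  then obtain f where f: "linear f" and fp: "\<And>x. f x \<le> p x"
    using linear_below_sublinear unfolding p_def by blast
  have f_le: "f x \<le> l" if l: "(\<lambda>n. F n x) \<longlonglongrightarrow> l" for x l
  proof (rule field_le_epsilon)
    fix e :: real assume "0 < e"
    then have "eventually (\<lambda>n. F n x < l + e) sequentially" using l by (intro order_tendstoD) auto
    then obtain n where "\<And>k. k \<ge> n \<Longrightarrow> F k x < l + e" by (auto simp: eventually_sequentially)
    then have "q n x \<le> l + e" by (intro q_least) (auto intro: less_imp_le)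
    then show "f x \<le> l + e" using fp[of x] p_le[of x n] by linarith
  qed
  have "f x = l" if l: "(\<lambda>n. F n x) \<longlonglongrightarrow> l" for x l
    using f_le[OF l] f_le[of "- x" "- l"] tendsto_minus[OF l] by (simp add: linear_neg[OF lin] linear_neg[OF f])
  moreover have f_norm: "f x \<le> norm x" for x
    using fp[of x] p_le[of x 0] q_least[of 0 x "norm x"] le by (smt (verit))
  have "\<bar>f x\<bar> \<le> norm x" for x
    using f_norm[of x] f_norm[of "- x"] by (simp add: linear_neg[OF f])
  ultimately show ?thesis using f unfolding contraction_functional_def by blast
qed

text \<open>A functional separating \<open>y\<close> from the span is bounded below on a translate
  of a subspace, hence zero on the subspace, yet positive at \<open>y\<close>. The lemma puts the
  points of a weak closure into a separable space, so that convergence on countably many vectors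
  reaches them.\<close>

lemma in_closed_span_if_functionals_below:
  fixes U :: "'a::real_normed_vector set"
  assumes "\<And>f :: 'a \<Rightarrow> real. bounded_linear f \<Longrightarrow> (\<And>x. x \<in> U \<Longrightarrow> f x \<le> 0) \<Longrightarrow> f y \<le> 0"
  shows "y \<in> closure (span U)"
proof (rule ccontr)
  assume "y \<notin> closure (span U)"
  then obtain e where e: "e > 0" "\<And>w. w \<in> span U \<Longrightarrow> e \<le> dist w y"
    unfolding closure_approachable by (meson not_less)
  have "convex (span U)" by (intro subspace_imp_convex subspace_span)
  then have "convex ((\<lambda>w. y + w) ` span U)" by (rule convex_translation)
  moreover have "e \<le> norm q" if "q \<in> (\<lambda>w. y + w) ` span U" for q
    using that e(2)[OF span_neg] by (auto simp: dist_norm norm_minus_commute[of _ y])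
  ultimately obtain f where f: "linear f" "\<And>x. \<bar>f x\<bar> \<le> norm x" "\<And>w. w \<in> span U \<Longrightarrow> e \<le> f (y + w)"
    using separation_from_ball[of "(\<lambda>w. y + w) ` span U" e] e(1) span_zero by fastforce
  have zero: "f w = 0" if w: "w \<in> span U" for w
  proof (rule ccontr)
    assume "f w \<noteq> 0"
    then have "f (y + (- f y / f w) *\<^sub>R w) = 0"
      unfolding linear_add[OF f(1)] linear_scale[OF f(1)] by simp
    then show False using f(3)[OF span_scale[OF w]] e(1) by (metis not_less)
  qed
  have "bounded_linear f" using f by (intro bounded_linear_of_norm_bound[where K = 1]) auto
  then have "f y \<le> 0" using assms[of f] zero span_base by force
  then show False using f(3)[OF span_zero] e(1) by simp
qed

text \<open>Along a subsequence the affine functions \<open>f n - c n\<close> converge on all of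
  \<open>K\<close> to something nonpositive, while their infinite convex combinations still nearly
  reach \<open>d\<close> at all late \<open>z j\<close>. Simons' inequality permits this only for
  \<open>d \<le> 0\<close>.\<close>

lemma functionals_attain_no_separation:
  fixes S :: "nat \<Rightarrow> 'a::real_normed_vector set"
  assumes X: "functionals_attain X" "\<And>x. x \<in> X \<Longrightarrow> norm x \<le> B"
    and S: "\<And>n. finite (S n)" "\<And>n. S n \<noteq> {}" "\<And>n. S n \<subseteq> S (Suc n)" "\<And>n. S n \<subseteq> X"
    and z: "\<And>j. z j \<in> convex hull (\<Union>n. S n)"
    and f: "\<And>n. contraction_functional (f n)" "\<And>n s. s \<in> S n \<Longrightarrow> f n s \<le> c n"
      "\<And>n j. n \<le> j \<Longrightarrow> c n + d \<le> f n (z j)"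
  shows "d \<le> 0"
proof -
  define U where "U = (\<Union>n. S n)"
  have UX: "U \<subseteq> X" unfolding U_def using S(4) by blast
  have Une: "U \<noteq> {}" unfolding U_def using S(2) by blast
  have Uc: "countable U" unfolding U_def using S(1) by (simp add: countable_finite)
  obtain K where UK: "U \<subseteq> K" and KU: "\<forall>f :: 'a \<Rightarrow> real. bounded_linear f \<longrightarrow>
      (\<exists>y\<in>K. \<forall>x\<in>K. f x \<le> f y) \<and> (\<forall>c. (\<forall>x\<in>U. f x \<le> c) \<longrightarrow> (\<forall>x\<in>K. f x \<le> c))"
    using X(1)[unfolded functionals_attain_def, THEN spec, THEN mp, THEN mp, OF UX Une]
    by (elim exE conjE) (rule that)
  have K_max: "\<exists>y\<in>K. \<forall>x\<in>K. f x \<le> f y" if "bounded_linear f" for f :: "'a \<Rightarrow> real"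
    using KU that by blast
  have K_le: "f x \<le> c" if "bounded_linear f" "\<And>x. x \<in> U \<Longrightarrow> f x \<le> c" "x \<in> K" for f :: "'a \<Rightarrow> real" and c x
    using KU that by blast
  have S_mono: "S m \<subseteq> S n" if "m \<le> n" for m n using S(3) that by (metis lift_Suc_mono_le)
  have UB: "norm x \<le> B" if "x \<in> U" for x using X(2) UX that by blast
  then have "U \<subseteq> cball 0 B" by auto
  then have "convex hull U \<subseteq> cball 0 B" by (intro hull_minimal) auto
  then have zB: "norm (z j) \<le> B" for j using z[of j] unfolding U_def by auto
  have KB: "norm y \<le> B" if y: "y \<in> K" for y
  proof -
    obtain g where g: "linear g" "\<And>x. \<bar>g x\<bar> \<le> norm x" "g y = norm y" using norming_functional by blast
    have "bounded_linear g" using g by (intro bounded_linear_of_norm_bound[where K = 1]) auto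
    moreover have "g x \<le> B" if "x \<in> U" for x using g(2)[of x] UB[OF that] by linarith
    ultimately have "g y \<le> B" using y by (rule K_le)
    then show ?thesis using g(3) by simp
  qed
  define B' where "B' = B + \<bar>d\<bar>"
  have f_le: "\<bar>f n x\<bar> \<le> norm x" for n x using f(1) unfolding contraction_functional_def by auto
  have cB: "\<bar>c n\<bar> \<le> B'" for n
  proof -
    obtain s where s: "s \<in> S n" using S(2) by blast
    then have "norm s \<le> B" using UB unfolding U_def by blast
    then have "- B \<le> c n" using f(2)[OF s] f_le[of n s] by linarith
    moreover have "c n \<le> B - d" using f(3)[of n n] f_le[of n "z n"] zB[of n] by simp
    ultimately show ?thesis unfolding B'_def by linarith
  qed
  \<comment> \<open>The constants \<open>c n\<close> are stored at index 0, before the values on the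
    enumerated \<open>U\<close>, so one diagonal subsequence makes both converge.\<close>
  define g where "g n k = (case k of 0 \<Rightarrow> c n | Suc i \<Rightarrow> f n (from_nat_into U i))" for n k
  have "\<bar>g n k\<bar> \<le> max B' B" for n k
  proof (cases k)
    case (Suc i)
    have "norm (from_nat_into U i) \<le> B" using from_nat_into[OF Une] UB by blast
    then show ?thesis using f_le[of n "from_nat_into U i"] Suc unfolding g_def by simp
  qed (use cB[of n] in \<open>simp add: g_def\<close>)
  then obtain r where r: "strict_mono r" and conv: "\<And>k. convergent (\<lambda>n. g (r n) k)"
    using pointwise_convergent_subsequence[of g "\<lambda>_. max B' B"] by blast
  obtain c' where c': "(\<lambda>n. c (r n)) \<longlonglongrightarrow> c'" using conv[of 0] by (auto simp: g_def convergent_def)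
  have convU: "convergent (\<lambda>n. f (r n) x)" if x: "x \<in> U" for x
  proof -
    obtain i where "x = from_nat_into U i" using from_nat_into_surj[OF Uc x] by metis
    then show ?thesis using conv[of "Suc i"] by (simp add: g_def)
  qed
  \<comment> \<open>The pointwise limit is extended to the whole space, because the bound by
    \<open>c'\<close> on \<open>U\<close> passes to \<open>K\<close> only for a bounded linear
    functional.\<close>
  obtain \<phi> where \<phi>: "contraction_functional \<phi>" "\<forall>x l. (\<lambda>n. f (r n) x) \<longlonglongrightarrow> l \<longrightarrow> \<phi> x = l"
    using extended_limit_functional[of "\<lambda>n. f (r n)", OF f(1)] by (elim exE conjE) (rule that)
  have lim: "(\<lambda>n. f (r n) y) \<longlonglongrightarrow> \<phi> y" if "y \<in> K" for y
  proof -
    have "y \<in> closure (span U)"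
    proof (rule in_closed_span_if_functionals_below)
      show "g y \<le> 0" if "bounded_linear g" "\<And>x. x \<in> U \<Longrightarrow> g x \<le> 0" for g :: "'a \<Rightarrow> real"
        using that \<open>y \<in> K\<close> by (rule K_le)
    qed
    with f(1) convU have "convergent (\<lambda>n. f (r n) y)" by (rule convergent_on_closed_span)
    then obtain l where l: "(\<lambda>n. f (r n) y) \<longlonglongrightarrow> l" unfolding convergent_def ..
    with \<phi>(2) show ?thesis by simp
  qed
  have "\<phi> x \<le> c'" if x: "x \<in> U" for x
  proof (rule LIMSEQ_le[OF lim c'])
    show "x \<in> K" using x UK by blast
    obtain m where m: "x \<in> S m" using x unfolding U_def by blast
    have "f (r n) x \<le> c (r n)" if "n \<ge> m" for n
      using f(2) m S_mono[of m "r n"] that seq_suble[OF r, of n] by force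
    then show "\<exists>N. \<forall>n\<ge>N. f (r n) x \<le> c (r n)" by blast
  qed
  then have \<phi>K: "\<phi> y \<le> c'" if "y \<in> K" for y
    using K_le[OF contraction_functional_bounded_linear[OF \<phi>(1)]] that by blast
  define h where "h n x = f (r n) x - c (r n)" for n x
  \<comment> \<open>Unlike convex hulls of the \<open>h k\<close> with \<open>k \<ge> n\<close>,
    these affine functions are closed under infinite convex combinations. The lower bound along
    \<open>z\<close> provides the value \<open>d\<close> at a maximum; domination by the later
    \<open>h k\<close> makes members small at each point of \<open>K\<close>.\<close>
  define D where "D n q \<psi> a \<longleftrightarrow> contraction_functional \<psi> \<and> \<bar>a\<bar> \<le> B' \<and> q = (\<lambda>x. \<psi> x - a) \<and>
      (\<forall>e>0. eventually (\<lambda>j. d - e \<le> q (z j)) sequentially) \<and>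
      (\<forall>x t. (\<forall>k\<ge>n. h k x \<le> t) \<longrightarrow> q x \<le> t)" for n q \<psi> a
  have D_functional: "contraction_functional \<psi>" and D_const: "\<bar>a\<bar> \<le> B'" and D_eq: "q = (\<lambda>x. \<psi> x - a)"
    if "D n q \<psi> a" for n q \<psi> a
    using that unfolding D_def by iprover+
  have D_ev: "eventually (\<lambda>j. d - e \<le> q (z j)) sequentially" if "D n q \<psi> a" "e > 0" for n q \<psi> a e
    using that unfolding D_def by iprover
  have D_dom: "q x \<le> t" if "D n q \<psi> a" "\<forall>k\<ge>n. h k x \<le> t" for n q \<psi> a x t
    using that unfolding D_def by iprover
  define C where "C n = {q. \<exists>\<psi> a. D n q \<psi> a}" for n
  have CD: "\<exists>\<psi> a. D n q \<psi> a" if "q \<in> C n" for n q using that unfolding C_def by simp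
  have C_bd: "\<bar>q x\<bar> \<le> B + B'" if q: "q \<in> C n" and x: "norm x \<le> B" for q n x
  proof -
    obtain \<psi> a where "D n q \<psi> a" using CD[OF q] by blast
    note D_functional[OF this] D_const[OF this] D_eq[OF this]
    then have "\<bar>\<psi> x\<bar> \<le> norm x" "\<bar>a\<bar> \<le> B'" "q x = \<psi> x - a"
      unfolding contraction_functional_def by simp_all
    then show ?thesis using x by linarith
  qed
  show ?thesis
  proof (rule simons_inequality[of C K "B + B'" d])
    fix n
    have "d - e \<le> h n (z j)" if "e > 0" "r n \<le> j" for e j
      using f(3)[of "r n" j] that unfolding h_def by simp
    then have "\<forall>e>0. eventually (\<lambda>j. d - e \<le> h n (z j)) sequentially"
      unfolding eventually_sequentially by blast
    then have "D n (h n) (f (r n)) (c (r n))" using f(1) cB unfolding D_def h_def by simp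
    then show "C n \<noteq> {}" unfolding C_def by blast
    have "D n q \<psi> a" if "D (Suc n) q \<psi> a" for q \<psi> a
      using that unfolding D_def by (elim conjE, intro conjI) (assumption | meson Suc_leD)+
    then show "C (Suc n) \<subseteq> C n" unfolding C_def by blast
  next
    fix g x assume "g \<in> C 0" "x \<in> K"
    then show "\<bar>g x\<bar> \<le> B + B'" using C_bd KB by blast
  next
    fix n and g :: "nat \<Rightarrow> 'a \<Rightarrow> real" assume g: "\<And>k. g k \<in> C n"
    obtain \<psi> a where D: "\<And>k. D n (g k) (\<psi> k) (a k)" using CD[OF g] by metis
    note \<psi> = D_functional[OF D] and a = D_const[OF D] and g_eq = D_eq[OF D]
    have lin: "linear (\<psi> k)" and le: "\<bar>\<psi> k x\<bar> \<le> norm x" for k x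
      using \<psi> unfolding contraction_functional_def by auto
    have gx: "\<bar>g k x\<bar> \<le> norm x + B'" for k x using le[of k x] a[of k] unfolding g_eq by linarith
    define \<Psi> where "\<Psi> x = halves (\<lambda>k. \<psi> k x)" for x
    have "linear \<Psi>"
      unfolding \<Psi>_def
      by (rule linearI)
        (simp_all add: linear_add[OF lin] linear_scale[OF lin] halves_add[OF le le] halves_mult[OF le])
    moreover have "\<bar>\<Psi> x\<bar> \<le> norm x" for x unfolding \<Psi>_def using le by (rule halves_abs_le)
    ultimately have "contraction_functional \<Psi>" unfolding contraction_functional_def by blast
    moreover have "\<bar>halves a\<bar> \<le> B'" using a by (rule halves_abs_le)
    moreover have "(\<lambda>x. halves (\<lambda>k. g k x)) = (\<lambda>x. \<Psi> x - halves a)"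
      unfolding g_eq \<Psi>_def by (intro ext halves_diff[OF le a])
    moreover have "\<forall>e>0. eventually (\<lambda>j. d - e \<le> halves (\<lambda>k. g k (z j))) sequentially"
      by (intro allI impI halves_liminf[OF C_bd[OF g zB]] D_ev[OF D])
    moreover have "\<forall>x t. (\<forall>k\<ge>n. h k x \<le> t) \<longrightarrow> halves (\<lambda>k. g k x) \<le> t"
    proof (intro allI impI)
      fix x t assume "\<forall>k\<ge>n. h k x \<le> t"
      then show "halves (\<lambda>k. g k x) \<le> t" by (intro halves_le[OF gx] D_dom[OF D])
    qed
    ultimately have "D n (\<lambda>x. halves (\<lambda>k. g k x)) \<Psi> (halves a)" unfolding D_def by iprover
    then show "(\<lambda>x. halves (\<lambda>k. g k x)) \<in> C n" unfolding C_def by blast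
  next
    fix q assume "q \<in> C 0"
    then obtain \<psi> a where D: "D 0 q \<psi> a" using CD by blast
    note \<psi> = D_functional[OF D] and q = D_eq[OF D]
    obtain y where y: "y \<in> K" "\<And>x. x \<in> K \<Longrightarrow> \<psi> x \<le> \<psi> y"
      using K_max contraction_functional_bounded_linear[OF \<psi>] by blast
    \<comment> \<open>A maximum over \<open>K\<close> also bounds \<open>\<psi>\<close> on the
      convex hull, where the \<open>z j\<close> lie; their lower bound thereby transfers to the
      maximal point.\<close>
    have "convex {x. \<psi> x \<le> \<psi> y}"
      using convex_linear_vimage[of \<psi> "{..\<psi> y}"] \<psi> unfolding contraction_functional_def vimage_def by auto
    then have "convex hull U \<subseteq> {x. \<psi> x \<le> \<psi> y}" using y UK by (intro hull_minimal) auto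
    then have zq: "q (z j) \<le> q y" for j using z[of j] unfolding q U_def by auto
    have "d \<le> q y"
    proof (rule field_le_epsilon)
      fix e :: real assume "0 < e"
      from D_ev[OF D this] obtain j where "d - e \<le> q (z j)" by (auto simp: eventually_sequentially)
      then show "d \<le> q y + e" using zq[of j] by linarith
    qed
    then show "\<exists>y\<in>K. d \<le> q y \<and> (\<forall>x\<in>K. q x \<le> q y)" using y unfolding q by auto
  next
    fix y and e :: real assume y: "y \<in> K" and e: "e > 0"
    have "(\<lambda>n. h n y) \<longlonglongrightarrow> \<phi> y - c'" unfolding h_def using lim[OF y] c' by (rule tendsto_diff)
    moreover have "\<phi> y - c' < e" using \<phi>K[OF y] e by linarith
    ultimately have "eventually (\<lambda>n. h n y < e) sequentially" by (rule order_tendstoD)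
    then obtain n where "\<And>k. k \<ge> n \<Longrightarrow> h k y < e" by (auto simp: eventually_sequentially)
    then have "\<forall>k\<ge>n. h k y \<le> e" by (simp add: less_imp_le)
    then have "q y \<le> e" if "D n q \<psi> a" for q \<psi> a
      using D_dom[OF that] \<open>\<forall>k\<ge>n. h k y \<le> e\<close> by blast
    then have "\<forall>q\<in>C n. q y \<le> e" using CD by blast
    then show "\<exists>n. \<forall>q\<in>C n. q y \<le> e" by blast
  qed
qed

section \<open>A mean ergodic theorem\<close>

text \<open>The convex hull of \<open>A\<close>, generated by binary mixtures instead of finite
  weighted sums, so that properties of averages follow by induction.\<close>

inductive_set averages :: "('a::real_vector \<Rightarrow> 'a) set \<Rightarrow> ('a \<Rightarrow> 'a) set" for A where
  base: "a \<in> A \<Longrightarrow> a \<in> averages A"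
| mix: "M \<in> averages A \<Longrightarrow> N \<in> averages A \<Longrightarrow> 0 \<le> t \<Longrightarrow> t \<le> 1 \<Longrightarrow>
    (\<lambda>x. (1 - t) *\<^sub>R M x + t *\<^sub>R N x) \<in> averages A"

text \<open>The operators need not commute on the whole space, only on the invariant subspace \<open>W\<close>.\<close>

locale commuting_operators =
  fixes A :: "('a::banach \<Rightarrow> 'a) set" and W :: "'a set" and C :: real
  assumes id_in: "id \<in> A"
    and comp_in: "\<And>a b. a \<in> A \<Longrightarrow> b \<in> A \<Longrightarrow> a \<circ> b \<in> A"
    and lin: "\<And>a. a \<in> A \<Longrightarrow> linear a"
    and bound: "\<And>a x. a \<in> A \<Longrightarrow> norm (a x) \<le> C * norm x"
    and C_nonneg: "0 \<le> C"
    and W: "subspace W"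
    and inv: "\<And>a x. a \<in> A \<Longrightarrow> x \<in> W \<Longrightarrow> a x \<in> W"
    and commute: "\<And>a b x. a \<in> A \<Longrightarrow> b \<in> A \<Longrightarrow> x \<in> W \<Longrightarrow> a (b x) = b (a x)"
begin

lemma averages_linear: "M \<in> averages A \<Longrightarrow> linear M"
proof (induction rule: averages.induct)
  case (mix M N t)
  then interpret M: linear M + N: linear N by auto
  show ?case by (rule linearI) (auto simp: M.add N.add M.scale N.scale algebra_simps)
qed (rule lin)

lemma averages_bound: "M \<in> averages A \<Longrightarrow> norm (M x) \<le> C * norm x"
proof (induction rule: averages.induct)
  case (mix M N t)
  have "norm ((1 - t) *\<^sub>R M x + t *\<^sub>R N x) \<le> (1 - t) * norm (M x) + t * norm (N x)"
    using mix norm_triangle_ineq[of "(1 - t) *\<^sub>R M x" "t *\<^sub>R N x"] by simp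
  also have "\<dots> \<le> (1 - t) * (C * norm x) + t * (C * norm x)"
    using mix by (intro add_mono mult_left_mono) auto
  finally show ?case by (simp add: algebra_simps)
qed (rule bound)

lemma averages_W: "M \<in> averages A \<Longrightarrow> x \<in> W \<Longrightarrow> M x \<in> W"
  by (induction rule: averages.induct) (auto intro: inv subspace_add[OF W] subspace_scale[OF W])

lemma averages_commute_base:
  assumes "M \<in> averages A" and L: "linear b" "\<And>a x. a \<in> A \<Longrightarrow> x \<in> W \<Longrightarrow> b (a x) = a (b x)" and x: "x \<in> W"
  shows "b (M x) = M (b x)"
  using assms(1)
  by (induction rule: averages.induct) (auto simp: L x linear_add[OF L(1)] linear_scale[OF L(1)])

lemma averages_commute:
  assumes "M \<in> averages A" "N \<in> averages A" "x \<in> W"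
  shows "M (N x) = N (M x)"
  using assms(2) averages_linear[OF assms(1)] _ assms(3)
proof (rule averages_commute_base)
  fix a y assume "a \<in> A" "y \<in> W"
  then show "M (a y) = a (M y)"
    using averages_commute_base[OF assms(1) lin[of a], of y] commute[of a] by simp
qed

lemma averages_comp:
  assumes "M \<in> averages A" "N \<in> averages A"
  shows "(\<lambda>x. M (N x)) \<in> averages A"
  using assms(1)
proof (induction rule: averages.induct)
  case (base a)
  show ?case using assms(2)
  proof (induction rule: averages.induct)
    case (base b)
    then show ?case using comp_in[OF \<open>a \<in> A\<close> base] averages.base[of "a \<circ> b" A] by (simp add: o_def)
  next
    case (mix N1 N2 t)
    have "(\<lambda>x. a ((1 - t) *\<^sub>R N1 x + t *\<^sub>R N2 x)) = (\<lambda>x. (1 - t) *\<^sub>R a (N1 x) + t *\<^sub>R a (N2 x))"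
      using lin[OF \<open>a \<in> A\<close>] by (simp add: linear_add linear_scale)
    then show ?case using averages.mix[OF mix.IH mix.hyps(3,4)] by simp
  qed
next
  case (mix M1 M2 t)
  then show ?case using averages.mix[of "\<lambda>x. M1 (N x)" A "\<lambda>x. M2 (N x)" t] by simp
qed

lemma averages_id: "id \<in> averages A" using id_in by (rule averages.base)

lemma averages_convex:
  assumes "M \<in> averages A" "N \<in> averages A" "0 \<le> s" "0 \<le> t" "s + t = 1"
  shows "(\<lambda>x. s *\<^sub>R M x + t *\<^sub>R N x) \<in> averages A"
proof -
  have "1 - t = s" using assms by simp
  then show ?thesis using averages.mix[OF assms(1,2,4)] assms(3) by simp
qed

lemma averages_in_hull:
  assumes "M \<in> averages A"
  shows "\<exists>S. finite S \<and> S \<noteq> {} \<and> S \<subseteq> (\<lambda>a. a v) ` A \<and> M v \<in> convex hull S"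
  using assms
proof (induction rule: averages.induct)
  case (base a)
  then show ?case by (intro exI[of _ "{a v}"]) auto
next
  case (mix M N t)
  then obtain S T where "finite S" "S \<noteq> {}" "S \<subseteq> (\<lambda>a. a v) ` A" "M v \<in> convex hull S"
    "finite T" "T \<subseteq> (\<lambda>a. a v) ` A" "N v \<in> convex hull T" by blast
  moreover from this have "M v \<in> convex hull (S \<union> T)" "N v \<in> convex hull (S \<union> T)"
    using hull_mono[of S "S \<union> T" convex] hull_mono[of T "S \<union> T" convex] by auto
  then have "(1 - t) *\<^sub>R M v + t *\<^sub>R N v \<in> convex hull (S \<union> T)"
    using mix by (intro convexD) (auto simp: convex_convex_hull)
  ultimately show ?case by (intro exI[of _ "S \<union> T"]) auto
qed

text \<open>The witness is the mean of the powers of \<open>a\<close> from \<open>id\<close> to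
  \<open>a ^^ n\<close>: applying \<open>a\<close> and subtracting telescopes to the difference of
  \<open>a ^^ Suc n\<close> and \<open>id\<close>, divided by \<open>Suc n\<close>.\<close>

lemma cesaro:
  assumes a: "a \<in> A"
  shows "\<exists>M\<in>averages A. \<forall>x. norm (a (M x) - M x) \<le> (C + 1) * norm x / real (Suc n)"
proof -
  interpret a: linear a using lin[OF a] .
  have pow: "(a ^^ n) \<in> A" for n
  proof (induction n)
    case (Suc n)
    then show ?case using comp_in[OF a Suc] by (simp add: o_def)
  qed (use id_in in \<open>simp add: id_def\<close>)
  have "\<exists>M\<in>averages A. \<forall>x. real (Suc n) *\<^sub>R a (M x) - real (Suc n) *\<^sub>R M x = (a ^^ Suc n) x - x"
  proof (induction n)
    case 0
    then show ?case using averages_id by (intro bexI[of _ id]) auto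
  next
    case (Suc n)
    then obtain M where M: "M \<in> averages A"
      "\<And>x. real (Suc n) *\<^sub>R a (M x) - real (Suc n) *\<^sub>R M x = (a ^^ Suc n) x - x" by blast
    \<comment> \<open>This weight turns the mean of \<open>n + 1\<close> powers into the mean of
      \<open>n + 2\<close>.\<close>
    define t where "t = 1 / real (Suc (Suc n))"
    define M' where "M' x = (1 - t) *\<^sub>R M x + t *\<^sub>R (a ^^ Suc n) x" for x
    have M': "M' \<in> averages A"
      unfolding M'_def using M(1) averages.base[OF pow] by (rule averages.mix) (auto simp: t_def)
    have nt: "real (Suc (Suc n)) * t = 1" "real (Suc (Suc n)) * (1 - t) = real (Suc n)"
      unfolding t_def by (simp_all add: field_simps)
    have eq: "real (Suc (Suc n)) *\<^sub>R M' x = real (Suc n) *\<^sub>R M x + (a ^^ Suc n) x" for x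
      unfolding M'_def scaleR_add_right scaleR_scaleR nt by simp
    have "real (Suc (Suc n)) *\<^sub>R a (M' x) - real (Suc (Suc n)) *\<^sub>R M' x = (a ^^ Suc (Suc n)) x - x" for x
    proof -
      have "real (Suc (Suc n)) *\<^sub>R a (M' x) = a (real (Suc n) *\<^sub>R M x + (a ^^ Suc n) x)"
        unfolding eq[symmetric] by (simp only: a.scale)
      also have "\<dots> = real (Suc n) *\<^sub>R a (M x) + (a ^^ Suc (Suc n)) x"
        unfolding a.add a.scale by simp
      finally show ?thesis unfolding eq using M(2)[of x] by (simp add: algebra_simps)
    qed
    then show ?case using M' by blast
  qed
  then obtain M where M: "M \<in> averages A"
    "\<And>x. real (Suc n) *\<^sub>R a (M x) - real (Suc n) *\<^sub>R M x = (a ^^ Suc n) x - x" by blast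
  have "norm (a (M x) - M x) \<le> (C + 1) * norm x / real (Suc n)" for x
  proof -
    have "real (Suc n) * norm (a (M x) - M x) = norm (real (Suc n) *\<^sub>R a (M x) - real (Suc n) *\<^sub>R M x)"
      by (simp add: scaleR_diff_right[symmetric])
    also have "\<dots> \<le> norm ((a ^^ Suc n) x) + norm x" unfolding M(2) by (rule norm_triangle_ineq4)
    also have "\<dots> \<le> (C + 1) * norm x" using bound[OF pow[of "Suc n"], of x] by (simp add: algebra_simps)
    finally show ?thesis by (simp add: pos_le_divide_eq mult.commute)
  qed
  then show ?thesis using M(1) by blast
qed

text \<open>For a long Cesaro mean \<open>M\<close> of \<open>a\<close>, the vector
  \<open>N (M v)\<close> is nearly fixed by \<open>a\<close>, because \<open>a\<close> commutes past
  \<open>N\<close> on \<open>W\<close>, and it lies within \<open>d\<close> of \<open>x\<close>.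
  Applying \<open>a\<close> to that distance costs \<open>C * d\<close>, comparing back another
  \<open>d\<close>; mixtures inherit the estimate.\<close>

lemma approximate_limit_almost_fixed:
  assumes v: "v \<in> W" and x: "\<And>M. M \<in> averages A \<Longrightarrow> \<exists>N\<in>averages A. norm (N (M v) - x) < d"
    and N: "N \<in> averages A"
  shows "norm (N x - x) \<le> (C + 1) * d"
  using N
proof (induction rule: averages.induct)
  case (base a)
  interpret a: linear a using lin[OF base] .
  show ?case
  proof (rule field_le_epsilon)
    fix e :: real assume e: "e > 0"
    obtain n where n: "C * ((C + 1) * norm v) / e < real (Suc n)"
      using reals_Archimedean2 less_Suc_eq of_nat_less_iff by (metis less_trans lessI)
    obtain M where M: "M \<in> averages A" "\<And>x. norm (a (M x) - M x) \<le> (C + 1) * norm x / real (Suc n)"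
      using cesaro[OF base, of n] by blast
    obtain N where N: "N \<in> averages A" "norm (N (M v) - x) < d" using x[OF M(1)] by blast
    interpret N: linear N using averages_linear[OF N(1)] .
    have "a (N (M v)) = N (a (M v))"
      using averages_commute[OF N(1) averages.base[OF base]] averages_W[OF M(1) v] by simp
    then have "norm (a (N (M v)) - N (M v)) = norm (N (a (M v) - M v))" by (simp add: N.diff)
    also have "\<dots> \<le> C * norm (a (M v) - M v)" by (rule averages_bound[OF N(1)])
    also have "\<dots> \<le> C * ((C + 1) * norm v / real (Suc n))"
      using C_nonneg M(2) by (intro mult_left_mono) auto
    also have "\<dots> = C * ((C + 1) * norm v) / real (Suc n)" by (rule times_divide_eq_right)
    also have "\<dots> \<le> e"
    proof -
      have "C * ((C + 1) * norm v) < real (Suc n) * e" using n e by (simp only: pos_divide_less_eq)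
      then show ?thesis by (simp only: pos_divide_le_eq of_nat_0_less_iff zero_less_Suc mult.commute[of e] less_imp_le)
    qed
    finally have 1: "norm (a (N (M v)) - N (M v)) \<le> e" .
    have "norm (a x - a (N (M v))) \<le> C * norm (x - N (M v))" using bound[OF base] by (simp add: a.diff[symmetric])
    also have "\<dots> \<le> C * d"
      using N(2) C_nonneg by (intro mult_left_mono) (auto simp: norm_minus_commute)
    finally have 2: "norm (a x - a (N (M v))) \<le> C * d" .
    have "a x - x = (a x - a (N (M v))) + (a (N (M v)) - N (M v)) + (N (M v) - x)" by simp
    then have "norm (a x - x) \<le> norm (a x - a (N (M v))) + norm (a (N (M v)) - N (M v)) + norm (N (M v) - x)"
      by (metis norm_triangle_ineq norm_triangle_mono order_refl)
    then show "norm (a x - x) \<le> (C + 1) * d + e" using 1 2 N(2) by (simp add: algebra_simps)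
  qed
next
  case (mix M N t)
  have "(1 - t) *\<^sub>R M x + t *\<^sub>R N x - x = (1 - t) *\<^sub>R (M x - x) + t *\<^sub>R (N x - x)"
    by (simp add: algebra_simps)
  then have "norm ((1 - t) *\<^sub>R M x + t *\<^sub>R N x - x) \<le> (1 - t) * norm (M x - x) + t * norm (N x - x)"
    using norm_triangle_ineq[of "(1 - t) *\<^sub>R (M x - x)" "t *\<^sub>R (N x - x)"] mix by simp
  also have "\<dots> \<le> (1 - t) * ((C + 1) * d) + t * ((C + 1) * d)"
    using mix by (intro add_mono mult_left_mono) auto
  finally show ?case by (simp add: algebra_simps)
qed

text \<open>An average of \<open>v\<close> that comes near the almost fixed point \<open>x n\<close>
  stays near it under further averaging. One average can therefore be brought near both
  \<open>x n\<close> and \<open>x m\<close>, which makes \<open>x\<close> a Cauchy sequence.\<close>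

lemma ergodic_limit_of_approximate_limits:
  assumes v: "v \<in> W"
    and approx: "\<And>d. d > 0 \<Longrightarrow> \<exists>x. \<forall>M\<in>averages A. \<exists>N\<in>averages A. norm (N (M v) - x) < d"
  shows "\<exists>w. (\<forall>a\<in>A. a w = w) \<and>
    (\<forall>e>0. \<exists>M\<in>averages A. \<forall>N\<in>averages A. norm (N (M v) - w) \<le> e)"
proof -
  define d where "d n = 1 / real (Suc n)" for n
  have d_pos: "d n > 0" for n unfolding d_def by simp
  have d_lim: "d \<longlonglongrightarrow> 0" unfolding d_def using LIMSEQ_inverse_real_of_nat by (simp add: inverse_eq_divide)
  obtain x where x: "\<And>n M. M \<in> averages A \<Longrightarrow> \<exists>N\<in>averages A. norm (N (M v) - x n) < d n"
    using approx[OF d_pos] by metis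
  have almost: "norm (N (x n) - x n) \<le> (C + 1) * d n" if "N \<in> averages A" for N n
    using v x that by (rule approximate_limit_almost_fixed)
  \<comment> \<open>\<open>C * d n\<close> because \<open>N\<close> acts on the distance, plus
    \<open>(C + 1) * d n\<close> because \<open>x n\<close> is almost fixed.\<close>
  have moved: "norm (N (M v) - x n) \<le> (2 * C + 1) * d n"
    if M: "norm (M v - x n) < d n" and N: "N \<in> averages A" for M N n
  proof -
    have "norm (N (M v) - N (x n)) \<le> C * norm (M v - x n)"
      using averages_bound[OF N, of "M v - x n"] by (simp add: linear_diff[OF averages_linear[OF N]])
    also have "\<dots> \<le> C * d n" using M C_nonneg by (intro mult_left_mono) auto
    finally have "norm (N (M v) - N (x n)) \<le> C * d n" .
    moreover have "norm (N (M v) - x n) \<le> norm (N (M v) - N (x n)) + norm (N (x n) - x n)"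
      using norm_triangle_ineq[of "N (M v) - N (x n)" "N (x n) - x n"] by simp
    ultimately show ?thesis using almost[OF N, of n] by (simp add: algebra_simps)
  qed
  have near: "norm (x n - x m) \<le> (2 * C + 1) * d n + d m" for n m
  proof -
    obtain M where M: "M \<in> averages A" "norm (M v - x n) < d n" using x[OF averages_id, of n] by auto
    obtain N where N: "N \<in> averages A" "norm (N (M v) - x m) < d m" using x[OF M(1), of m] by blast
    have "norm (x n - x m) \<le> norm (N (M v) - x n) + norm (N (M v) - x m)"
      using norm_triangle_ineq4[of "N (M v) - x m" "N (M v) - x n"] by simp
    then show ?thesis using moved[where M = M and n = n, OF M(2) N(1)] N(2) by linarith
  qed
  have "Cauchy x"
    unfolding Cauchy_def
  proof (intro allI impI)
    fix e :: real assume e: "e > 0"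
    have "(\<lambda>n. (2 * C + 2) * d n) \<longlonglongrightarrow> (2 * C + 2) * 0" using d_lim by (intro tendsto_intros)
    then have "eventually (\<lambda>n. (2 * C + 2) * d n < e) sequentially"
      using e by (intro order_tendstoD(2)[of _ 0]) auto
    then obtain n0 where n0: "\<And>n. n \<ge> n0 \<Longrightarrow> (2 * C + 2) * d n < e" by (auto simp: eventually_sequentially)
    have "dist (x n) (x m) < e" if "n \<ge> n0" "m \<ge> n0" for n m
    proof -
      define k where "k = (if d n \<le> d m then m else n)"
      have "(2 * C + 1) * d n + d m \<le> (2 * C + 1) * d k + d k"
        using C_nonneg by (intro add_mono mult_left_mono) (auto simp: k_def)
      moreover have "(2 * C + 2) * d k < e" using that n0 unfolding k_def by auto
      ultimately show ?thesis using near[of n m] by (simp add: dist_norm algebra_simps)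
    qed
    then show "\<exists>n0. \<forall>m\<ge>n0. \<forall>n\<ge>n0. dist (x m) (x n) < e" by blast
  qed
  then obtain w where w: "x \<longlonglongrightarrow> w" using Cauchy_convergent convergent_def by blast
  have "a w = w" if a: "a \<in> A" for a
  proof -
    have "bounded_linear a"
      using lin[OF a] bound[OF a] by (intro bounded_linear_of_norm_bound[where K = C]) (auto simp: mult.commute)
    from tendsto_diff[OF bounded_linear.tendsto[OF this w] w]
    have "(\<lambda>n. a (x n) - x n) \<longlonglongrightarrow> a w - w" .
    moreover have "(\<lambda>n. a (x n) - x n) \<longlonglongrightarrow> 0"
    proof (rule Lim_null_comparison)
      show "eventually (\<lambda>n. norm (a (x n) - x n) \<le> (C + 1) * d n) sequentially"
        using almost[OF averages.base[OF a]] by (intro always_eventually) blast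
      have "(\<lambda>n. (C + 1) * d n) \<longlonglongrightarrow> (C + 1) * 0" using d_lim by (intro tendsto_intros)
      then show "(\<lambda>n. (C + 1) * d n) \<longlonglongrightarrow> 0" by simp
    qed
    ultimately have "a w - w = 0" by (rule LIMSEQ_unique)
    then show ?thesis by simp
  qed
  moreover have "\<exists>M\<in>averages A. \<forall>N\<in>averages A. norm (N (M v) - w) \<le> e" if e: "e > 0" for e
  proof -
    have "(\<lambda>n. (2 * C + 1) * d n + norm (x n - w)) \<longlonglongrightarrow> (2 * C + 1) * 0 + norm (w - w)"
      using d_lim w by (intro tendsto_intros)
    then have "eventually (\<lambda>n. (2 * C + 1) * d n + norm (x n - w) < e) sequentially"
      using e by (intro order_tendstoD(2)[of _ 0]) auto
    then obtain n where n: "(2 * C + 1) * d n + norm (x n - w) < e" by (auto simp: eventually_sequentially)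
    obtain M where M: "M \<in> averages A" "norm (M v - x n) < d n" using x[OF averages_id, of n] by auto
    have "norm (N (M v) - w) \<le> e" if "N \<in> averages A" for N
      using moved[where M = M and n = n, OF M(2) that] n norm_triangle_ineq[of "N (M v) - x n" "x n - w"] by simp
    then show ?thesis using M(1) by blast
  qed
  ultimately show ?thesis by blast
qed

text \<open>Commutation lets either factor of a composite act first on \<open>v\<close>, so the
  composite of averages avoiding two points avoids both, and so do its further averages.\<close>

lemma escape_finite_set:
  assumes v: "v \<in> W" and T: "finite T"
    and escape: "\<And>x. \<exists>M\<in>averages A. \<forall>N\<in>averages A. d \<le> norm (N (M v) - x)"
  shows "\<exists>M\<in>averages A. \<forall>x\<in>T. \<forall>N\<in>averages A. d \<le> norm (N (M v) - x)"
  using T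
proof (induction T rule: finite_induct)
  case empty
  then show ?case using averages_id by blast
next
  case (insert y T)
  then obtain M where M: "M \<in> averages A" "\<And>x N. x \<in> T \<Longrightarrow> N \<in> averages A \<Longrightarrow> d \<le> norm (N (M v) - x)"
    by blast
  obtain M' where M': "M' \<in> averages A" "\<And>N. N \<in> averages A \<Longrightarrow> d \<le> norm (N (M' v) - y)"
    using escape by blast
  have "d \<le> norm (N (M (M' v)) - x)" if x: "x \<in> insert y T" and N: "N \<in> averages A" for x N
  proof (cases "x = y")
    case True
    then show ?thesis using M'(2)[OF averages_comp[OF N M(1)]] by simp
  next
    case False
    have "M (M' v) = M' (M v)" using averages_commute[OF M(1) M'(1) v] .
    then show ?thesis using M(2)[OF _ averages_comp[OF N M'(1)], of x] x False by simp
  qed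
  then show ?case using averages_comp[OF M(1) M'(1)] by (intro bexI[of _ "\<lambda>x. M (M' x)"]) auto
qed

text \<open>The hull of \<open>S\<close> is compact, so staying \<open>d\<close> away from a finite
  \<open>d / 2\<close>-net keeps all further averages at distance \<open>d / 2\<close> from the
  whole hull. Separating the convex set of differences from the ball of that radius gives
  \<open>f\<close>, and \<open>c\<close> is the maximum of \<open>f\<close> on
  \<open>S\<close>.\<close>

lemma escape_separation:
  assumes v: "v \<in> W" and S: "finite S" "S \<noteq> {}" and d: "d > 0"
    and escape: "\<And>x. \<exists>M\<in>averages A. \<forall>N\<in>averages A. d \<le> norm (N (M v) - x)"
  shows "\<exists>M\<in>averages A. \<exists>f c. contraction_functional f \<and> (\<forall>s\<in>S. f s \<le> c) \<and>
    (\<forall>N\<in>averages A. c + d / 2 \<le> f (N (M v)))"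
proof -
  have "compact (convex hull S)" using S(1) by (rule finite_imp_compact_convex_hull)
  then obtain T where T: "finite T" "convex hull S \<subseteq> (\<Union>x\<in>T. ball x (d / 2))"
    unfolding compact_eq_totally_bounded using half_gt_zero[OF d] by blast
  obtain M where M: "M \<in> averages A" "\<And>x N. x \<in> T \<Longrightarrow> N \<in> averages A \<Longrightarrow> d \<le> norm (N (M v) - x)"
    using escape_finite_set[OF v T(1) escape] by blast
  define Q where "Q = {N (M v) - x | N x. N \<in> averages A \<and> x \<in> convex hull S}"
  have QI: "N (M v) - x \<in> Q" if "N \<in> averages A" "x \<in> convex hull S" for N x
    unfolding Q_def using that by blast
  have "convex Q"
  proof (rule convexI)
    fix p q and s t :: real assume "p \<in> Q" "q \<in> Q" and st: "0 \<le> s" "0 \<le> t" "s + t = 1"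
    then obtain N x N' y where p: "p = N (M v) - x" "N \<in> averages A" "x \<in> convex hull S"
      and q: "q = N' (M v) - y" "N' \<in> averages A" "y \<in> convex hull S" unfolding Q_def by blast
    have "s *\<^sub>R p + t *\<^sub>R q = (\<lambda>x. s *\<^sub>R N x + t *\<^sub>R N' x) (M v) - (s *\<^sub>R x + t *\<^sub>R y)"
      unfolding p q by (simp add: algebra_simps)
    moreover have "(\<lambda>x. s *\<^sub>R N x + t *\<^sub>R N' x) \<in> averages A" using p(2) q(2) st by (rule averages_convex)
    moreover have "s *\<^sub>R x + t *\<^sub>R y \<in> convex hull S"
      using p(3) q(3) st by (intro convexD[OF convex_convex_hull])
    ultimately show "s *\<^sub>R p + t *\<^sub>R q \<in> Q"
      unfolding Q_def mem_Collect_eq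
      by (intro exI[of _ "\<lambda>x. s *\<^sub>R N x + t *\<^sub>R N' x"] exI[of _ "s *\<^sub>R x + t *\<^sub>R y"] conjI)
  qed
  moreover obtain s0 where s0: "s0 \<in> S" using S(2) by blast
  then have "M v - s0 \<in> Q" using QI[OF averages_id hull_inc] by simp
  then have "Q \<noteq> {}" by blast
  moreover have "d / 2 \<le> norm q" if qQ: "q \<in> Q" for q
  proof -
    obtain N x where q: "q = N (M v) - x" "N \<in> averages A" "x \<in> convex hull S"
      using qQ unfolding Q_def by blast
    then obtain y where y: "y \<in> T" "dist y x < d / 2" using T(2) by auto
    have "norm (N (M v) - y) \<le> norm (N (M v) - x) + norm (x - y)"
      using norm_triangle_ineq[of "N (M v) - x" "x - y"] by simp
    then show ?thesis using M(2)[OF y(1) q(2)] y(2) unfolding q(1) dist_norm norm_minus_commute[of y] by simp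
  qed
  ultimately obtain f where f: "linear f" "\<And>x. \<bar>f x\<bar> \<le> norm x" "\<And>q. q \<in> Q \<Longrightarrow> d / 2 \<le> f q"
    using separation_from_ball[of Q "d / 2"] d by auto
  have "Max (f ` S) \<in> f ` S" using S by (intro Max_in) auto
  then obtain s where s: "s \<in> S" "f s = Max (f ` S)" by auto
  have "f s' \<le> f s" if "s' \<in> S" for s' using that S(1) unfolding s(2) by auto
  moreover have "f s + d / 2 \<le> f (N (M v))" if "N \<in> averages A" for N
  proof -
    have "N (M v) - s \<in> Q" using that hull_inc[OF s(1)] by (rule QI)
    from f(3)[OF this] show ?thesis unfolding linear_diff[OF f(1)] by linarith
  qed
  ultimately show ?thesis using M(1) f(1,2) unfolding contraction_functional_def by blast
qed

theorem mean_ergodic: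
  assumes v: "v \<in> W" and orbit: "functionals_attain ((\<lambda>a. a v) ` A)"
  shows "\<exists>w. (\<forall>a\<in>A. a w = w) \<and>
    (\<forall>e>0. \<exists>M\<in>averages A. \<forall>N\<in>averages A. norm (N (M v) - w) \<le> e)"
proof (rule ergodic_limit_of_approximate_limits[OF v], rule ccontr)
  fix d :: real assume d: "d > 0"
    and "\<not> (\<exists>x. \<forall>M\<in>averages A. \<exists>N\<in>averages A. norm (N (M v) - x) < d)"
  then have escape: "\<exists>M\<in>averages A. \<forall>N\<in>averages A. d \<le> norm (N (M v) - x)" for x
    by (metis not_less)
  define X where "X = (\<lambda>a. a v) ` A"
  define good where "good = (\<lambda>(S, u). finite S \<and> S \<noteq> {} \<and> S \<subseteq> X \<and> (\<exists>P\<in>averages A. u = P v))"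
  define sep where "sep S u f c \<longleftrightarrow> contraction_functional f \<and> (\<forall>s\<in>S. f s \<le> c) \<and>
      (\<forall>N\<in>averages A. c + d / 2 \<le> f (N u))" for S u f and c :: real
  \<comment> \<open>\<open>S\<close> collects orbit points, enough to hold each new average in their
    convex hull. The functional separates the old \<open>S\<close> from every further average of the
    new \<open>u'\<close>, hence from all later stages.\<close>
  define step where "step = (\<lambda>(S, u) (S', u'). S \<subseteq> S' \<and> u' \<in> convex hull S' \<and>
      (\<exists>N\<in>averages A. u' = N u) \<and> (\<exists>f c. sep S u' f c))"
  have "\<exists>\<sigma>. \<forall>n. good (\<sigma> n) \<and> step (\<sigma> n) (\<sigma> (Suc n))"
  proof (rule dependent_nat_choice)
    have "good ({v}, v)"
      unfolding good_def X_def using id_in averages_id by (auto intro!: image_eqI[of _ _ id] bexI[of _ id])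
    then show "\<exists>\<sigma>. good \<sigma>" by blast
    fix \<sigma> and n :: nat assume "good \<sigma>"
    then obtain S P where \<sigma>: "\<sigma> = (S, P v)" and S: "finite S" "S \<noteq> {}" "S \<subseteq> X" and P: "P \<in> averages A"
      unfolding good_def by (cases \<sigma>) auto
    obtain M f c where M: "M \<in> averages A" and f: "contraction_functional f" "\<And>s. s \<in> S \<Longrightarrow> f s \<le> c"
      "\<And>N. N \<in> averages A \<Longrightarrow> c + d / 2 \<le> f (N (M v))"
      using escape_separation[OF v S(1,2) d escape] by blast
    have MP: "(\<lambda>x. M (P x)) \<in> averages A" using M P by (rule averages_comp)
    \<comment> \<open>\<open>M\<close> was found for \<open>v\<close> but is applied to the current
      average \<open>P v\<close>; commutation turns averages of \<open>M (P v)\<close> into averages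
      of \<open>M v\<close>.\<close>
    have "M (P v) = P (M v)" using averages_commute[OF M P v] .
    then have "c + d / 2 \<le> f (N (M (P v)))" if "N \<in> averages A" for N
      using f(3)[OF averages_comp[OF that P]] by simp
    then have sep: "sep S (M (P v)) f c" unfolding sep_def using f(1,2) by blast
    obtain S' where S': "finite S'" "S' \<subseteq> X" "M (P v) \<in> convex hull S'"
      using averages_in_hull[OF MP, of v] unfolding X_def by blast
    have "M (P v) \<in> convex hull (S \<union> S')" using S'(3) hull_mono[of S' "S \<union> S'" convex] by auto
    then have "step \<sigma> (S \<union> S', M (P v))" unfolding step_def \<sigma> using M sep by auto
    moreover have "good (S \<union> S', M (P v))" unfolding good_def using S S' MP by auto
    ultimately show "\<exists>\<tau>. good \<tau> \<and> step \<sigma> \<tau>" by blast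
  qed
  then obtain \<sigma> where \<sigma>: "\<And>n. good (\<sigma> n)" "\<And>n. step (\<sigma> n) (\<sigma> (Suc n))" by blast
  define S where "S n = fst (\<sigma> n)" for n
  define u where "u n = snd (\<sigma> n)" for n
  have S: "finite (S n)" "S n \<noteq> {}" "S n \<subseteq> X" for n
    using \<sigma>(1)[of n] unfolding good_def S_def by (auto simp: case_prod_beta)
  have step: "S n \<subseteq> S (Suc n)" "u (Suc n) \<in> convex hull S (Suc n)" "\<exists>N\<in>averages A. u (Suc n) = N (u n)"
    "\<exists>f c. sep (S n) (u (Suc n)) f c" for n
    using \<sigma>(2)[of n] unfolding step_def S_def u_def by (auto simp: case_prod_beta)
  obtain f c where fc: "\<And>n. sep (S n) (u (Suc n)) (f n) (c n)" using step(4) by metis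
  have later: "\<exists>N\<in>averages A. u (n + k) = N (u n)" for n k
  proof (induction k)
    case 0
    then show ?case using averages_id by (intro bexI[of _ id]) auto
  next
    case (Suc k)
    then obtain N N' where "N \<in> averages A" "u (n + k) = N (u n)"
      "N' \<in> averages A" "u (Suc (n + k)) = N' (u (n + k))" using step(3)[of "n + k"] by blast
    then show ?case using averages_comp[of N' N] by (intro bexI[of _ "\<lambda>x. N' (N x)"]) auto
  qed
  have "d / 2 \<le> 0"
  \<comment> \<open>The shift by one arises because \<open>f n\<close> separates \<open>S n\<close>
    from the averages of stage \<open>Suc n\<close> on.\<close>
  proof (rule functionals_attain_no_separation[of X "C * norm v" S "\<lambda>j. u (Suc j)" f c])
    show "functionals_attain X" using orbit unfolding X_def .
    show "norm x \<le> C * norm v" if "x \<in> X" for x using that bound unfolding X_def by auto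
    show "u (Suc j) \<in> convex hull (\<Union>n. S n)" for j
      using step(2)[of j] hull_mono[of "S (Suc j)" "\<Union>n. S n" convex] by auto
    show "c n + d / 2 \<le> f n (u (Suc j))" if "n \<le> j" for n j
    proof -
      obtain N where "N \<in> averages A" "u (Suc n + (j - n)) = N (u (Suc n))" using later by blast
      then show ?thesis using fc[of n] that unfolding sep_def by auto
    qed
  qed (use S step(1) fc in \<open>auto simp: sep_def\<close>)
  then show False using d by simp
qed

end

section \<open>Ergodic limits as a projection onto the fixed vectors\<close>

context commuting_operators begin

text \<open>Convergence along the averages directed by composition. The universal \<open>N\<close>
  makes an approximation persist under further averaging, so several vectors can share one
  average.\<close>

definition ergodic_limit :: "'a \<Rightarrow> 'a \<Rightarrow> bool" where
  "ergodic_limit x p \<longleftrightarrow> x \<in> W \<and> (\<forall>a\<in>A. a p = p) \<and>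
    (\<forall>e>0. \<exists>M\<in>averages A. \<forall>N\<in>averages A. norm (N (M x) - p) \<le> e)"

lemma ergodic_limit_W: "ergodic_limit x p \<Longrightarrow> x \<in> W"
  and ergodic_limit_fixed: "ergodic_limit x p \<Longrightarrow> a \<in> A \<Longrightarrow> a p = p"
  and ergodic_limit_approx:
    "ergodic_limit x p \<Longrightarrow> e > 0 \<Longrightarrow> \<exists>M\<in>averages A. \<forall>N\<in>averages A. norm (N (M x) - p) \<le> e"
  unfolding ergodic_limit_def by blast+

text \<open>A common composite average brings both vectors near their limits and expands their
  distance at most by \<open>C\<close>. With \<open>x = y\<close> this gives uniqueness.\<close>

lemma ergodic_limit_Lipschitz:
  assumes x: "ergodic_limit x p" and y: "ergodic_limit y q"
  shows "norm (p - q) \<le> C * norm (x - y)"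
proof (rule field_le_epsilon)
  fix e :: real assume e: "e > 0"
  obtain M where M: "M \<in> averages A" "\<And>N. N \<in> averages A \<Longrightarrow> norm (N (M x) - p) \<le> e / 2"
    using ergodic_limit_approx[OF x half_gt_zero[OF e]] by blast
  obtain M' where M': "M' \<in> averages A" "\<And>N. N \<in> averages A \<Longrightarrow> norm (N (M' y) - q) \<le> e / 2"
    using ergodic_limit_approx[OF y half_gt_zero[OF e]] by blast
  have MM: "(\<lambda>z. M' (M z)) \<in> averages A" using M'(1) M(1) by (rule averages_comp)
  have "norm (M' (M x) - M' (M y)) \<le> C * norm (x - y)"
    using averages_bound[OF MM, of "x - y"] by (simp add: linear_diff[OF averages_linear[OF MM]])
  moreover have "norm (M' (M x) - p) \<le> e / 2" using M(2)[OF M'(1)] .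
  moreover have "norm (M' (M y) - q) \<le> e / 2"
    using M'(2)[OF M(1)] averages_commute[OF M(1) M'(1) ergodic_limit_W[OF y]] by simp
  moreover have "norm (p - q) \<le> norm (M' (M x) - M' (M y)) + norm (M' (M x) - p) + norm (M' (M y) - q)"
    using norm_triangle_ineq4[of "M' (M x) - M' (M y)" "M' (M x) - p"]
      norm_triangle_ineq[of "(M' (M x) - M' (M y)) - (M' (M x) - p)" "M' (M y) - q"] by simp
  ultimately show "norm (p - q) \<le> C * norm (x - y) + e" by linarith
qed

lemma ergodic_limit_unique: "ergodic_limit x p \<Longrightarrow> ergodic_limit x q \<Longrightarrow> p = q"
  using ergodic_limit_Lipschitz[of x p x q] by simp

lemma ergodic_limit_add:
  assumes x: "ergodic_limit x p" and y: "ergodic_limit y q"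
  shows "ergodic_limit (x + y) (p + q)"
  unfolding ergodic_limit_def
proof (intro conjI ballI allI impI)
  show "x + y \<in> W" using x y by (intro subspace_add[OF W] ergodic_limit_W)
  show "a (p + q) = p + q" if "a \<in> A" for a
    using ergodic_limit_fixed[OF x that] ergodic_limit_fixed[OF y that] lin[OF that] by (simp add: linear_add)
next
  fix e :: real assume e: "e > 0"
  obtain M where M: "M \<in> averages A" "\<And>N. N \<in> averages A \<Longrightarrow> norm (N (M x) - p) \<le> e / 2"
    using ergodic_limit_approx[OF x half_gt_zero[OF e]] by blast
  obtain M' where M': "M' \<in> averages A" "\<And>N. N \<in> averages A \<Longrightarrow> norm (N (M' y) - q) \<le> e / 2"
    using ergodic_limit_approx[OF y half_gt_zero[OF e]] by blast
  have MM: "(\<lambda>z. M' (M z)) \<in> averages A" using M'(1) M(1) by (rule averages_comp)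
  have "norm (N (M' (M (x + y))) - (p + q)) \<le> e" if N: "N \<in> averages A" for N
  proof -
    have NMM: "(\<lambda>z. N (M' (M z))) \<in> averages A" using averages_comp[OF N MM] .
    have "N (M' (M (x + y))) = N (M' (M x)) + N (M (M' y))"
      using linear_add[OF averages_linear[OF NMM]] averages_commute[OF M(1) M'(1) ergodic_limit_W[OF y]] by simp
    moreover have "norm (N (M' (M x)) - p) \<le> e / 2" using M(2)[OF averages_comp[OF N M'(1)]] .
    moreover have "norm (N (M (M' y)) - q) \<le> e / 2" using M'(2)[OF averages_comp[OF N M(1)]] .
    ultimately show ?thesis
      using norm_triangle_ineq[of "N (M' (M x)) - p" "N (M (M' y)) - q"] by (simp add: algebra_simps)
  qed
  then show "\<exists>M\<in>averages A. \<forall>N\<in>averages A. norm (N (M (x + y)) - (p + q)) \<le> e"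
    using MM by (intro bexI[of _ "\<lambda>z. M' (M z)"]) auto
qed

text \<open>For \<open>R = \<rho> g\<close> this is the equivariance of the projection. The
  condition \<open>p \<in> W\<close> is there because \<open>R\<close> is known to commute with
  \<open>A\<close> on \<open>W\<close> only.\<close>

lemma ergodic_limit_image:
  assumes x: "ergodic_limit x p" and p: "p \<in> W"
    and R: "linear R" "\<And>y. norm (R y) \<le> c * norm y" "\<And>y. y \<in> W \<Longrightarrow> R y \<in> W"
    and comm: "\<And>a y. a \<in> A \<Longrightarrow> y \<in> W \<Longrightarrow> R (a y) = a (R y)"
  shows "ergodic_limit (R x) (R p)"
  unfolding ergodic_limit_def
proof (intro conjI ballI allI impI)
  show "R x \<in> W" using R(3) ergodic_limit_W[OF x] .
  show "a (R p) = R p" if "a \<in> A" for a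
    using comm[OF that p] ergodic_limit_fixed[OF x that] by simp
next
  fix e :: real assume e: "e > 0"
  define c' where "c' = max 1 c"
  have c': "c' > 0" unfolding c'_def by simp
  have Rc': "norm (R y) \<le> c' * norm y" for y
  proof -
    have "c * norm y \<le> c' * norm y" unfolding c'_def by (intro mult_right_mono) auto
    then show ?thesis using R(2)[of y] by linarith
  qed
  have "e / c' > 0" using e c' by simp
  then obtain M where M: "M \<in> averages A" "\<And>N. N \<in> averages A \<Longrightarrow> norm (N (M x) - p) \<le> e / c'"
    using ergodic_limit_approx[OF x] by blast
  have "norm (N (M (R x)) - R p) \<le> e" if N: "N \<in> averages A" for N
  proof -
    have "N (M (R x)) = R (N (M x))"
      using averages_commute_base[OF averages_comp[OF N M(1)] R(1) comm ergodic_limit_W[OF x]] by simp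
    then have "norm (N (M (R x)) - R p) = norm (R (N (M x) - p))" by (simp add: linear_diff[OF R(1)])
    also have "\<dots> \<le> c' * norm (N (M x) - p)" by (rule Rc')
    also have "\<dots> \<le> c' * (e / c')" using M(2)[OF N] c' by (intro mult_left_mono) auto
    finally show ?thesis using c' by simp
  qed
  then show "\<exists>M\<in>averages A. \<forall>N\<in>averages A. norm (N (M (R x)) - R p) \<le> e" using M(1) by blast
qed

lemma ergodic_limit_finite:
  assumes T: "finite T" and P: "\<And>x. x \<in> T \<Longrightarrow> ergodic_limit x (P x)" and e: "e > 0"
  shows "\<exists>M\<in>averages A. \<forall>x\<in>T. \<forall>N\<in>averages A. norm (N (M x) - P x) \<le> e"
  using T P
proof (induction T rule: finite_induct)
  case empty
  then show ?case using averages_id by blast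
next
  case (insert y T)
  have y: "ergodic_limit y (P y)" using insert.prems by simp
  obtain M where M: "M \<in> averages A" "\<And>x N. x \<in> T \<Longrightarrow> N \<in> averages A \<Longrightarrow> norm (N (M x) - P x) \<le> e"
    using insert.IH insert.prems by auto
  obtain M' where M': "M' \<in> averages A" "\<And>N. N \<in> averages A \<Longrightarrow> norm (N (M' y) - P y) \<le> e"
    using ergodic_limit_approx[OF y e] by blast
  have "norm (N (M (M' x)) - P x) \<le> e" if x: "x \<in> insert y T" and N: "N \<in> averages A" for x N
  proof (cases "x = y")
    case True
    then show ?thesis using M'(2)[OF averages_comp[OF N M(1)]] by simp
  next
    case False
    then have xT: "x \<in> T" using x by simp
    have "M (M' x) = M' (M x)"
      using averages_commute[OF M(1) M'(1) ergodic_limit_W[OF insert.prems[OF x]]] .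
    then show ?thesis using M(2)[OF xT averages_comp[OF N M'(1)]] by simp
  qed
  then show ?case using averages_comp[OF M(1) M'(1)] by (intro bexI[of _ "\<lambda>x. M (M' x)"]) auto
qed

lemma ergodic_limit_compact:
  assumes Y: "compact Y" and P: "\<And>x. x \<in> Y \<Longrightarrow> ergodic_limit x (P x)" and e: "e > 0"
  shows "\<exists>M\<in>averages A. \<forall>x\<in>Y. norm (M x - P x) \<le> e"
proof -
  \<comment> \<open>On a net of mesh \<open>r\<close> the average and the limit each contribute an
    error \<open>C * r\<close>, together at most \<open>e / 2\<close>; the other half is the error
    at net points. The summand 1 avoids division by 0.\<close>
  define r where "r = e / (2 * (2 * C + 1))"
  have r: "r > 0" "2 * C * r \<le> e / 2"
    using e C_nonneg unfolding r_def by (simp_all add: field_simps)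
  obtain T where T: "finite T" "T \<subseteq> Y" "Y \<subseteq> (\<Union>x\<in>T. ball x r)"
    using seq_compact_imp_totally_bounded[OF compact_imp_seq_compact[OF Y], rule_format, OF r(1)]
    by (elim exE conjE) (rule that)
  obtain M where M: "M \<in> averages A" "\<And>x N. x \<in> T \<Longrightarrow> N \<in> averages A \<Longrightarrow> norm (N (M x) - P x) \<le> e / 2"
    using ergodic_limit_finite[OF T(1) P half_gt_zero[OF e]] T(2) by blast
  have "norm (M x - P x) \<le> e" if x: "x \<in> Y" for x
  proof -
    obtain y where y: "y \<in> T" "dist y x < r" using T(3) x by auto
    have "norm (M y - P y) \<le> e / 2" using M(2)[OF y(1) averages_id] by simp
    moreover have "norm (M x - M y) \<le> C * norm (x - y)"
      using averages_bound[OF M(1), of "x - y"] by (simp add: linear_diff[OF averages_linear[OF M(1)]])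
    moreover have "norm (P y - P x) \<le> C * norm (x - y)"
      using ergodic_limit_Lipschitz[OF P P, of y x] y(1) T(2) x by (auto simp: norm_minus_commute)
    moreover have "C * norm (x - y) \<le> C * r"
      using y(2) C_nonneg by (intro mult_left_mono) (auto simp: dist_norm norm_minus_commute)
    moreover have "norm (M x - P x) \<le> norm (M x - M y) + norm (M y - P y) + norm (P y - P x)"
      using norm_triangle_ineq[of "M x - M y" "M y - P y"] norm_triangle_ineq[of "(M x - M y) + (M y - P y)" "P y - P x"]
      by simp
    ultimately show ?thesis using r(2) by linarith
  qed
  then show ?thesis using M(1) by blast
qed

lemma ergodic_limit_exists:
  "v \<in> W \<Longrightarrow> functionals_attain ((\<lambda>a. a v) ` A) \<Longrightarrow> \<exists>w. ergodic_limit v w"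
  using mean_ergodic unfolding ergodic_limit_def by blast

lemma ergodic_limit_compact_image:
  assumes Y: "compact Y" and P: "\<And>x. x \<in> Y \<Longrightarrow> ergodic_limit x (P x)"
  shows "compact (P ` Y)"
proof (rule compact_continuous_image[OF _ Y])
  have "C-lipschitz_on Y P"
    using ergodic_limit_Lipschitz[OF P P] C_nonneg by (intro lipschitz_onI) (auto simp: dist_norm)
  then show "continuous_on Y P" by (rule lipschitz_on_continuous_on)
qed

end

section \<open>Cocycles along the lower central series\<close>

lemma functionals_attain_subset:
  assumes X: "functionals_attain X" and Y: "Y \<subseteq> X"
  shows "functionals_attain Y"
  unfolding functionals_attain_def
proof (intro allI impI)
  fix S assume "S \<subseteq> Y" "S \<noteq> {}"
  then show "\<exists>K. S \<subseteq> K \<and> (\<forall>f :: 'a \<Rightarrow> real. bounded_linear f \<longrightarrow>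
      (\<exists>y\<in>K. \<forall>x\<in>K. f x \<le> f y) \<and> (\<forall>c. (\<forall>x\<in>S. f x \<le> c) \<longrightarrow> (\<forall>x\<in>K. f x \<le> c)))"
    using X[unfolded functionals_attain_def, THEN spec, THEN mp, THEN mp, OF subset_trans[OF _ Y]] by simp
qed

section \<open>Normality and commutators in the lower central series\<close>

context group begin

lemma lower_central_normal: "lower_central G k \<lhd> G"
proof (induction k)
  case 0
  then show ?case by (simp add: normal_inv_iff subgroup_self)
next
  case (Suc k)
  interpret N: normal "lower_central G k" G by (rule Suc)
  have cancel: "inv g \<otimes> (g \<otimes> z) = z" if "g \<in> carrier G" "z \<in> carrier G" for g z
    using that by (simp add: m_assoc[symmetric])
  have "generate G {x \<otimes> y \<otimes> inv x \<otimes> inv y | x y. x \<in> lower_central G k \<and> y \<in> carrier G} \<lhd> G"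
  proof (rule normal_generateI)
    show "{x \<otimes> y \<otimes> inv x \<otimes> inv y | x y. x \<in> lower_central G k \<and> y \<in> carrier G} \<subseteq> carrier G"
      by auto
    fix h g assume "h \<in> {x \<otimes> y \<otimes> inv x \<otimes> inv y | x y. x \<in> lower_central G k \<and> y \<in> carrier G}"
      and g: "g \<in> carrier G"
    then obtain x y where h: "h = x \<otimes> y \<otimes> inv x \<otimes> inv y" and x: "x \<in> lower_central G k" and y: "y \<in> carrier G"
      by blast
    have xG: "x \<in> carrier G" using x by auto
    have "g \<otimes> h \<otimes> inv g = (g \<otimes> x \<otimes> inv g) \<otimes> (g \<otimes> y \<otimes> inv g) \<otimes> inv (g \<otimes> x \<otimes> inv g) \<otimes> inv (g \<otimes> y \<otimes> inv g)"
      unfolding h using xG y g by (simp add: m_assoc inv_mult_group cancel)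
    moreover have "g \<otimes> x \<otimes> inv g \<in> lower_central G k" using N.inv_op_closed2[OF g x] .
    ultimately show "g \<otimes> h \<otimes> inv g \<in> {x \<otimes> y \<otimes> inv x \<otimes> inv y | x y. x \<in> lower_central G k \<and> y \<in> carrier G}"
      using y g by (intro CollectI exI[of _ "g \<otimes> x \<otimes> inv g"] exI[of _ "g \<otimes> y \<otimes> inv g"]) simp
  qed
  then show ?case by simp
qed

lemma lower_central_Suc_subset: "lower_central G (Suc k) \<subseteq> lower_central G k"
proof -
  interpret N: normal "lower_central G k" G by (rule lower_central_normal)
  have "x \<otimes> y \<otimes> inv x \<otimes> inv y \<in> lower_central G k"
    if x: "x \<in> lower_central G k" and y: "y \<in> carrier G" for x y
  proof -
    have "x \<otimes> (y \<otimes> inv x \<otimes> inv y) \<in> lower_central G k"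
      using N.m_closed[OF x N.inv_op_closed2[OF y N.m_inv_closed[OF x]]] .
    then show ?thesis using x y N.mem_carrier by (simp add: m_assoc)
  qed
  then have "{x \<otimes> y \<otimes> inv x \<otimes> inv y | x y. x \<in> lower_central G k \<and> y \<in> carrier G} \<subseteq> lower_central G k"
    by blast
  from generate_subgroup_incl[OF this N.subgroup_axioms] show ?thesis by simp
qed

lemma lower_central_commute:
  assumes z: "z \<in> lower_central G k" and g: "g \<in> carrier G"
  shows "\<exists>c\<in>lower_central G (Suc k). z \<otimes> g = c \<otimes> (g \<otimes> z)"
proof (rule bexI)
  have zG: "z \<in> carrier G" using normal_imp_subgroup[OF lower_central_normal] z by (meson subgroup.mem_carrier)
  show "z \<otimes> g \<otimes> inv z \<otimes> inv g \<in> lower_central G (Suc k)"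
    using z g by (auto intro!: generate.incl)
  have "z \<otimes> g \<otimes> inv z \<otimes> inv g \<otimes> (g \<otimes> z) = z \<otimes> g \<otimes> (inv z \<otimes> (inv g \<otimes> g) \<otimes> z)"
    using zG g by (simp only: m_assoc inv_closed m_closed)
  then show "z \<otimes> g = z \<otimes> g \<otimes> inv z \<otimes> inv g \<otimes> (g \<otimes> z)" using zG g by simp
qed

end

text \<open>Topology and scalar field are forgotten here. Continuity returns as compactness of the
  image of \<open>b\<close>, weak almost periodicity as attainment of functionals on orbits, and
  \<open>C\<close> will come from uniform boundedness.\<close>

locale bounded_representation = group G for G (structure) +
  fixes \<rho> :: "'g \<Rightarrow> 'v::banach \<Rightarrow> 'v" and C :: real
  assumes C_nonneg: "0 \<le> C"
    and rep_linear: "g \<in> carrier G \<Longrightarrow> linear (\<rho> g)"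
    and rep_mult: "g \<in> carrier G \<Longrightarrow> h \<in> carrier G \<Longrightarrow> \<rho> (g \<otimes> h) v = \<rho> g (\<rho> h v)"
    and rep_one: "\<rho> \<one> v = v"
    and rep_bound: "g \<in> carrier G \<Longrightarrow> norm (\<rho> g v) \<le> C * norm v"
    and orbit: "functionals_attain ((\<lambda>g. \<rho> g v) ` carrier G)"
begin

definition cocycle :: "('g \<Rightarrow> 'v) \<Rightarrow> bool" where
  "cocycle b \<longleftrightarrow> (\<forall>g\<in>carrier G. \<forall>h\<in>carrier G. b (g \<otimes> h) = b g + \<rho> g (b h))"

lemma cocycleD: "cocycle b \<Longrightarrow> g \<in> carrier G \<Longrightarrow> h \<in> carrier G \<Longrightarrow> b (g \<otimes> h) = b g + \<rho> g (b h)"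
  unfolding cocycle_def by blast

definition almost_coboundary :: "'g set \<Rightarrow> ('g \<Rightarrow> 'v) \<Rightarrow> bool" where
  "almost_coboundary K b \<longleftrightarrow> (\<forall>e>0. \<exists>u. \<forall>g\<in>K. norm (b g - (u - \<rho> g u)) \<le> e)"

definition fixed_by :: "'g set \<Rightarrow> 'v set" where
  "fixed_by H = {v. \<forall>h\<in>H. \<rho> h v = v}"

lemma fixed_byD: "v \<in> fixed_by H \<Longrightarrow> h \<in> H \<Longrightarrow> \<rho> h v = v"
  unfolding fixed_by_def by blast

lemma fixed_by_invariant:
  assumes H: "H \<lhd> G" and g: "g \<in> carrier G" and v: "v \<in> fixed_by H"
  shows "\<rho> g v \<in> fixed_by H"
  unfolding fixed_by_def
proof (intro CollectI ballI)
  interpret normal H G by (rule H)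
  fix h assume h: "h \<in> H"
  have hG: "h \<in> carrier G" using h by auto
  have c: "inv g \<otimes> h \<otimes> g \<in> H" using inv_op_closed1[OF g h] .
  have "h \<otimes> g = g \<otimes> (inv g \<otimes> h \<otimes> g)" using g hG by (simp add: m_assoc[symmetric])
  then have "\<rho> h (\<rho> g v) = \<rho> g (\<rho> (inv g \<otimes> h \<otimes> g) v)"
    using rep_mult[OF hG g] rep_mult[OF g, of "inv g \<otimes> h \<otimes> g"] c by simp
  then show "\<rho> h (\<rho> g v) = \<rho> g v" using fixed_byD[OF v c] by simp
qed

text \<open>Expanding \<open>b (z \<otimes> g) = b (g \<otimes> z)\<close> on both sides gives
  \<open>b g - \<rho> z (b g) = b z - \<rho> g (b z)\<close>. The left side is affine in the
  operator and the right side linear in the vector, so mixtures follow.\<close>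

lemma averages_coboundary:
  assumes b: "cocycle b" and Z: "Z \<subseteq> carrier G"
    and comm: "\<And>z g. z \<in> Z \<Longrightarrow> g \<in> carrier G \<Longrightarrow> b (z \<otimes> g) = b (g \<otimes> z)"
    and M: "M \<in> averages (\<rho> ` Z)"
  shows "\<exists>u. \<forall>g\<in>carrier G. b g - M (b g) = u - \<rho> g u"
  using M
proof (induction rule: averages.induct)
  case (base a)
  then obtain z where z: "z \<in> Z" "a = \<rho> z" by blast
  have "b g - a (b g) = b z - \<rho> g (b z)" if g: "g \<in> carrier G" for g
  proof -
    have "b z + \<rho> z (b g) = b g + \<rho> g (b z)"
      using comm[OF z(1) g] cocycleD[OF b, of z g] cocycleD[OF b, of g z] z(1) Z g by auto
    then show ?thesis unfolding z(2) by (simp add: algebra_simps)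
  qed
  then show ?case by blast
next
  case (mix M N t)
  then obtain u w where u: "\<And>g. g \<in> carrier G \<Longrightarrow> b g - M (b g) = u - \<rho> g u"
    and w: "\<And>g. g \<in> carrier G \<Longrightarrow> b g - N (b g) = w - \<rho> g w" by blast
  have "b g - ((1 - t) *\<^sub>R M (b g) + t *\<^sub>R N (b g)) =
      ((1 - t) *\<^sub>R u + t *\<^sub>R w) - \<rho> g ((1 - t) *\<^sub>R u + t *\<^sub>R w)" if g: "g \<in> carrier G" for g
  proof -
    have "b g - ((1 - t) *\<^sub>R M (b g) + t *\<^sub>R N (b g)) = (1 - t) *\<^sub>R (b g - M (b g)) + t *\<^sub>R (b g - N (b g))"
      by (simp add: algebra_simps)
    also have "\<dots> = (1 - t) *\<^sub>R (u - \<rho> g u) + t *\<^sub>R (w - \<rho> g w)" unfolding u[OF g] w[OF g] ..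
    also have "\<dots> = ((1 - t) *\<^sub>R u + t *\<^sub>R w) - ((1 - t) *\<^sub>R \<rho> g u + t *\<^sub>R \<rho> g w)"
      by (simp add: algebra_simps)
    also have "(1 - t) *\<^sub>R \<rho> g u + t *\<^sub>R \<rho> g w = \<rho> g ((1 - t) *\<^sub>R u + t *\<^sub>R w)"
      using rep_linear[OF g] by (simp only: linear_add linear_scale)
    finally show ?thesis .
  qed
  then show ?case by blast
qed

text \<open>Averaging \<open>b\<close> over \<open>Z\<close> changes it by coboundaries only, and in the limit yields a cocycle that
  is \<open>Z\<close>-fixed; on \<open>Z\<close> that cocycle takes \<open>G\<close>-fixed values, hence vanishes.\<close>

lemma almost_coboundary_step:
  assumes H: "H \<lhd> G" and Z: "Z \<lhd> G" and HZ: "H \<subseteq> Z"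
    and comm: "\<And>z g. z \<in> Z \<Longrightarrow> g \<in> carrier G \<Longrightarrow> \<exists>c\<in>H. z \<otimes> g = c \<otimes> (g \<otimes> z)"
    and no_fixed: "fixed_by (carrier G) \<subseteq> {0}"
    and b: "cocycle b" "\<And>h. h \<in> H \<Longrightarrow> b h = 0" "\<And>g. g \<in> carrier G \<Longrightarrow> b g \<in> fixed_by H"
    and K: "K \<subseteq> carrier G" "compact (b ` K)"
    and IH: "\<And>b'. cocycle b' \<Longrightarrow> (\<And>h. h \<in> Z \<Longrightarrow> b' h = 0) \<Longrightarrow>
      (\<And>g. g \<in> carrier G \<Longrightarrow> b' g \<in> fixed_by Z) \<Longrightarrow> compact (b' ` K) \<Longrightarrow> almost_coboundary K b'"
  shows "almost_coboundary K b"
proof -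
  interpret H: normal H G by (rule H)
  interpret Z: normal Z G by (rule Z)
  have ZG: "z \<in> carrier G" if "z \<in> Z" for z using that by (rule Z.mem_carrier)
  define W where "W = fixed_by H"
  have W_inv: "\<rho> g x \<in> W" if "g \<in> carrier G" "x \<in> W" for g x
    using fixed_by_invariant[OF H] that unfolding W_def by blast
  \<comment> \<open>The operators commute up to some \<open>\<rho> c\<close> with
    \<open>c \<in> H\<close>, which is trivial on \<open>W\<close>; normality of \<open>H\<close>
    keeps the vectors inside \<open>W\<close>.\<close>
  have W_comm: "\<rho> g (\<rho> z x) = \<rho> z (\<rho> g x)" if z: "z \<in> Z" and g: "g \<in> carrier G" and x: "x \<in> W" for z g x
  proof -
    obtain c where c: "c \<in> H" "z \<otimes> g = c \<otimes> (g \<otimes> z)" using comm[OF z g] by blast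
    have "\<rho> z (\<rho> g x) = \<rho> (c \<otimes> (g \<otimes> z)) x" using rep_mult[OF ZG[OF z] g, of x] c(2) by simp
    also have "\<dots> = \<rho> c (\<rho> g (\<rho> z x))"
      using rep_mult[of c "g \<otimes> z" x] rep_mult[of g z x] H.mem_carrier[OF c(1)] g ZG[OF z] by simp
    also have "\<dots> = \<rho> g (\<rho> z x)"
      using fixed_byD[OF _ c(1)] W_inv[OF g W_inv[OF ZG[OF z] x]] unfolding W_def by blast
    finally show ?thesis by simp
  qed
  have "commuting_operators (\<rho> ` Z) W C"
  proof (rule commuting_operators.intro)
    show "id \<in> \<rho> ` Z" using rep_one by (intro image_eqI[of _ _ \<one>]) auto
    show "x \<circ> y \<in> \<rho> ` Z" if xy: "x \<in> \<rho> ` Z" "y \<in> \<rho> ` Z" for x y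
    proof -
      obtain z z' where z: "z \<in> Z" "x = \<rho> z" "z' \<in> Z" "y = \<rho> z'" using xy by blast
      have "x \<circ> y = \<rho> (z \<otimes> z')" using rep_mult[OF ZG ZG] z by auto
      then show ?thesis using z by blast
    qed
    show "linear x" if "x \<in> \<rho> ` Z" for x using that rep_linear ZG by blast
    show "norm (a x) \<le> C * norm x" if "a \<in> \<rho> ` Z" for a x using that rep_bound ZG by blast
    show "0 \<le> C" by (rule C_nonneg)
    have "linear (\<rho> h)" if "h \<in> H" for h using rep_linear[OF H.mem_carrier[OF that]] .
    then show "subspace W"
      unfolding W_def fixed_by_def
      by (intro subspaceI) (auto simp: linear_0 linear_add linear_scale)
    show "a x \<in> W" if "a \<in> \<rho> ` Z" "x \<in> W" for a x using that W_inv ZG by blast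
    show "a (b x) = b (a x)" if "a \<in> \<rho> ` Z" "b \<in> \<rho> ` Z" "x \<in> W" for a b x
      using that W_comm ZG by blast
  qed
  then interpret commuting_operators "\<rho> ` Z" W C .
  have "\<exists>p. ergodic_limit x p" if x: "x \<in> W" for x
  proof (rule ergodic_limit_exists[OF x])
    have "(\<lambda>a. a x) ` \<rho> ` Z \<subseteq> (\<lambda>g. \<rho> g x) ` carrier G" using ZG by blast
    with orbit[of x] show "functionals_attain ((\<lambda>a. a x) ` \<rho> ` Z)" by (rule functionals_attain_subset)
  qed
  then obtain P where P: "\<And>x. x \<in> W \<Longrightarrow> ergodic_limit x (P x)" by metis
  have P_fixed: "P x \<in> fixed_by Z" if "x \<in> W" for x
    using ergodic_limit_fixed[OF P[OF that]] unfolding fixed_by_def by blast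
  then have PW: "P x \<in> W" if "x \<in> W" for x
    using HZ that unfolding W_def fixed_by_def by blast
  have bW: "b g \<in> W" if "g \<in> carrier G" for g using b(3) that unfolding W_def by blast
  define b' where "b' g = P (b g)" for g
  have b'_fixed: "b' g \<in> fixed_by Z" if "g \<in> carrier G" for g
    unfolding b'_def using P_fixed bW that by blast
  have b': "cocycle b'"
    unfolding cocycle_def
  proof (intro ballI)
    fix g h assume g: "g \<in> carrier G" and h: "h \<in> carrier G"
    \<comment> \<open>\<open>P\<close> is a bare choice of limits; the additivity and equivariance
      used for \<open>b'\<close> come from uniqueness of ergodic limits.\<close>
    have "ergodic_limit (\<rho> g (b h)) (\<rho> g (b' h))"
      unfolding b'_def
    proof (rule ergodic_limit_image[OF P[OF bW[OF h]] PW[OF bW[OF h]] rep_linear[OF g] rep_bound[OF g] W_inv[OF g]])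
      show "\<rho> g (a y) = a (\<rho> g y)" if "a \<in> \<rho> ` Z" "y \<in> W" for a y using that W_comm[OF _ g] by blast
    qed
    with P[OF bW[OF g]] have "ergodic_limit (b g + \<rho> g (b h)) (b' g + \<rho> g (b' h))"
      unfolding b'_def by (rule ergodic_limit_add)
    moreover have "ergodic_limit (b (g \<otimes> h)) (b' (g \<otimes> h))"
      unfolding b'_def using g h by (intro P bW) simp
    ultimately show "b' (g \<otimes> h) = b' g + \<rho> g (b' h)"
      unfolding cocycleD[OF b(1) g h] using ergodic_limit_unique by blast
  qed
  \<comment> \<open>\<open>b\<close> vanishes at \<open>c \<in> H\<close> and \<open>c\<close> fixes
    the value at \<open>g \<otimes> z\<close>, so the commutator drops out.\<close>
  have b_comm: "b (z \<otimes> g) = b (g \<otimes> z)" if z: "z \<in> Z" and g: "g \<in> carrier G" for z g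
  proof -
    obtain c where c: "c \<in> H" "z \<otimes> g = c \<otimes> (g \<otimes> z)" using comm[OF z g] by blast
    have "g \<otimes> z \<in> carrier G" using g ZG[OF z] by simp
    then show ?thesis
      using cocycleD[OF b(1) H.mem_carrier[OF c(1)], of "g \<otimes> z"] b(2)[OF c(1)]
        fixed_byD[OF b(3) c(1), of "g \<otimes> z"] c(2) by simp
  qed
  have b'_zero: "b' z = 0" if z: "z \<in> Z" for z
  proof -
    have "\<rho> g (b' z) = b' z" if g: "g \<in> carrier G" for g
    proof -
      \<comment> \<open>The symmetry in \<open>z\<close> and \<open>g\<close> is inherited from
        \<open>b\<close>. Since \<open>z\<close> fixes \<open>b' g\<close>, these terms cancel and
        \<open>b' z\<close> is \<open>G\<close>-fixed.\<close>
      have "b' z + \<rho> z (b' g) = b' g + \<rho> g (b' z)"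
        using cocycleD[OF b' ZG[OF z] g] cocycleD[OF b' g ZG[OF z]] b_comm[OF z g] unfolding b'_def by simp
      then show ?thesis using fixed_byD[OF b'_fixed[OF g] z] by simp
    qed
    then show ?thesis using no_fixed unfolding fixed_by_def by blast
  qed
  have bK: "b ` K \<subseteq> W" using bW K(1) by blast
  have "compact (P ` b ` K)" using ergodic_limit_compact_image[OF K(2), of P] P bK by blast
  then have "compact (b' ` K)" unfolding b'_def image_image .
  with b' b'_zero b'_fixed have approx: "almost_coboundary K b'" by (rule IH)
  show ?thesis
    unfolding almost_coboundary_def
  proof (intro allI impI)
    fix e :: real assume e: "e > 0"
    obtain M where M: "M \<in> averages (\<rho> ` Z)" "\<And>g. g \<in> K \<Longrightarrow> norm (M (b g) - b' g) \<le> e / 2"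
      using ergodic_limit_compact[OF K(2) _ half_gt_zero[OF e], of P] P bK unfolding b'_def by blast
    \<comment> \<open>\<open>b\<close> is the coboundary of \<open>u\<close> plus
      \<open>M b\<close>, the latter is close to \<open>b'\<close> on \<open>K\<close>, and
      \<open>b'\<close> is almost the coboundary of \<open>w\<close>; hence \<open>u + w\<close>
      serves \<open>b\<close>.\<close>
    obtain u where u: "\<And>g. g \<in> carrier G \<Longrightarrow> b g - M (b g) = u - \<rho> g u"
      using averages_coboundary[OF b(1) Z.subset b_comm M(1)] by blast
    obtain w where w: "\<And>g. g \<in> K \<Longrightarrow> norm (b' g - (w - \<rho> g w)) \<le> e / 2"
      using approx half_gt_zero[OF e] unfolding almost_coboundary_def by blast
    have "norm (b g - ((u + w) - \<rho> g (u + w))) \<le> e" if g: "g \<in> K" for g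
    proof -
      have gG: "g \<in> carrier G" using g K(1) by blast
      have "b g - ((u + w) - \<rho> g (u + w)) = (b g - (u - \<rho> g u)) - (w - \<rho> g w)"
        unfolding linear_add[OF rep_linear[OF gG]] by simp
      also have "\<dots> = (M (b g) - b' g) + (b' g - (w - \<rho> g w))"
        unfolding u[OF gG, symmetric] by simp
      finally have eq: "b g - ((u + w) - \<rho> g (u + w)) = (M (b g) - b' g) + (b' g - (w - \<rho> g w))" .
      show ?thesis
        unfolding eq using norm_triangle_ineq[of "M (b g) - b' g" "b' g - (w - \<rho> g w)"] M(2)[OF g] w[OF g]
        by linarith
    qed
    then show "\<exists>u. \<forall>g\<in>K. norm (b g - (u - \<rho> g u)) \<le> e" by blast
  qed
qed

text \<open>The step takes term \<open>Suc n\<close> as \<open>H\<close> and term \<open>n\<close>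
  as \<open>Z\<close>, so the index falls while the terms on which the cocycle vanishes grow. Term 0
  is all of \<open>G\<close>, where \<open>u = 0\<close> suffices.\<close>

lemma almost_coboundary_lower_central:
  assumes no_fixed: "fixed_by (carrier G) \<subseteq> {0}" and K: "K \<subseteq> carrier G"
  shows "cocycle b \<Longrightarrow> (\<And>h. h \<in> lower_central G n \<Longrightarrow> b h = 0) \<Longrightarrow>
    (\<And>g. g \<in> carrier G \<Longrightarrow> b g \<in> fixed_by (lower_central G n)) \<Longrightarrow> compact (b ` K) \<Longrightarrow>
    almost_coboundary K b"
proof (induction n arbitrary: b)
  case 0
  then have "norm (b g - (0 - \<rho> g 0)) = 0" if "g \<in> K" for g
    using that K linear_0[OF rep_linear] by auto
  then show ?case unfolding almost_coboundary_def by (metis less_imp_le)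
next
  case (Suc n)
  show ?case
    using lower_central_normal[of "Suc n"] lower_central_normal[of n] lower_central_Suc_subset
      lower_central_commute no_fixed Suc.prems(1-3) K Suc.prems(4) Suc.IH
    by (rule almost_coboundary_step)
qed

text \<open>At the last term \<open>{\<one>}\<close> both conditions of the induction are automatic:
  a cocycle vanishes at the identity, which fixes every vector.\<close>

theorem cocycle_almost_coboundary:
  assumes "nilpotent_group G" "fixed_vectors G \<rho> = {0}"
    and b: "cocycle b" and K: "K \<subseteq> carrier G" "compact (b ` K)"
  shows "almost_coboundary K b"
proof -
  obtain n where n: "lower_central G n = {\<one>}" using assms(1) unfolding nilpotent_group_def by blast
  have "b \<one> = 0" using cocycleD[OF b one_closed one_closed] rep_one by simp
  then show ?thesis
    using assms(2) b K
    by (intro almost_coboundary_lower_central[of K b n]) (auto simp: n fixed_by_def fixed_vectors_def rep_one)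
qed

end

section \<open>Weak topology\<close>

lemma openin_weak_topology:
  "bounded_functional sc F \<Longrightarrow> open U \<Longrightarrow> openin (weak_topology sc) (F -` U)"
  unfolding weak_topology_def by (rule topology_generated_by_Basis) blast

lemma bounded_functional_zero: "bounded_functional sc (\<lambda>_. 0)"
  unfolding bounded_functional_def by simp

lemma topspace_weak_topology:
  fixes sc :: "'k::real_or_complex_field \<Rightarrow> 'v::banach \<Rightarrow> 'v"
  shows "topspace (weak_topology sc) = UNIV"
proof -
  have "openin (weak_topology sc) ((\<lambda>_. 0 :: 'k) -` UNIV)"
    by (rule openin_weak_topology[OF bounded_functional_zero open_UNIV])
  then show ?thesis using openin_subset by fastforce
qed

text \<open>Over an abstract scalar field, being the real part of \<open>F\<close> is replaced by
  domination through the increments of \<open>F\<close>, which covers the real and the complex case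
  alike.\<close>

lemma continuous_map_weak_topology_if_dominated:
  fixes f :: "'v::banach \<Rightarrow> real"
  assumes F: "bounded_functional sc F" and c: "c > 0" "\<And>x y. \<bar>f x - f y\<bar> \<le> c * norm (F x - F y)"
  shows "continuous_map (weak_topology sc) euclidean f"
proof -
  have "openin (weak_topology sc) (f -` U)" if U: "open U" for U
    unfolding openin_subopen[of _ "f -` U"]
  proof
    fix v assume "v \<in> f -` U"
    then obtain e where e: "e > 0" "ball (f v) e \<subseteq> U" using U open_contains_ball by force
    have "F -` ball (F v) (e / c) \<subseteq> f -` U"
    proof
      fix x assume "x \<in> F -` ball (F v) (e / c)"
      then have "c * norm (F v - F x) < e" using c(1) by (simp add: dist_norm field_simps)
      then show "x \<in> f -` U" using c(2)[of v x] e(2) by (auto simp: dist_real_def)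
    qed
    moreover have "openin (weak_topology sc) (F -` ball (F v) (e / c))"
      using openin_weak_topology[OF F open_ball] .
    moreover have "v \<in> F -` ball (F v) (e / c)" using e(1) c(1) by simp
    ultimately show "\<exists>T. openin (weak_topology sc) T \<and> v \<in> T \<and> T \<subseteq> f -` U" by blast
  qed
  then show ?thesis
    unfolding continuous_map_def topspace_weak_topology by (simp add: vimage_def)
qed

text \<open>Multiplicativity of the norm gives \<open>norm (a + b i) * norm (a - b i) = a\<^sup>2 + b\<^sup>2\<close>.\<close>

lemma abs_le_norm_imaginary_unit:
  fixes i :: "'k::real_normed_field"
  assumes i: "i * i = - 1"
  shows "\<bar>a\<bar> \<le> 2 * norm (of_real a + of_real b * i)"
proof -
  have "norm i * norm i = 1" using arg_cong[OF i, of norm] by (simp add: norm_mult)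
  then have ni: "norm i = 1" using norm_ge_zero[of i] by (metis abs_of_nonneg real_sqrt_abs2 real_sqrt_one)
  define n where "n = norm (of_real a + of_real b * i)"
  have "(of_real a + of_real b * i) * (of_real a - of_real b * i) = of_real a * of_real a - of_real b * of_real b * (i * i)"
    by (simp add: algebra_simps)
  also have "\<dots> = of_real (a * a + b * b)" unfolding i by simp
  finally have "n * norm (of_real a - of_real b * i) = norm (of_real (a * a + b * b) :: 'k)"
    unfolding n_def norm_mult[symmetric] by (rule arg_cong)
  also have "\<dots> = a * a + b * b" unfolding norm_of_real by simp
  finally have eq: "n * norm (of_real a - of_real b * i) = a * a + b * b" .
  have "norm (of_real a - of_real b * i) \<le> \<bar>a\<bar> + \<bar>b\<bar>"
    using norm_triangle_ineq4[of "of_real a" "of_real b * i"] by (simp add: norm_mult ni)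
  then have "a * a + b * b \<le> n * (\<bar>a\<bar> + \<bar>b\<bar>)"
    unfolding eq[symmetric] by (intro mult_left_mono) (simp_all add: n_def)
  moreover have "(\<bar>a\<bar> + \<bar>b\<bar>) * (\<bar>a\<bar> + \<bar>b\<bar>) \<le> 2 * (a * a + b * b)"
  proof -
    have "0 \<le> (\<bar>a\<bar> - \<bar>b\<bar>) * (\<bar>a\<bar> - \<bar>b\<bar>)" by simp
    then show ?thesis by (simp add: algebra_simps)
  qed
  ultimately have le: "(\<bar>a\<bar> + \<bar>b\<bar>) * (\<bar>a\<bar> + \<bar>b\<bar>) \<le> (\<bar>a\<bar> + \<bar>b\<bar>) * (2 * n)" by (simp add: algebra_simps)
  show ?thesis
  proof (cases "\<bar>a\<bar> + \<bar>b\<bar> > 0")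
    case True
    then have "\<bar>a\<bar> + \<bar>b\<bar> \<le> 2 * n" using le by (simp only: mult_le_cancel_left_pos)
    then show ?thesis unfolding n_def by linarith
  next
    case False
    then have "a = 0" by linarith
    then show ?thesis by simp
  qed
qed

context banach_space_over
begin

lemma scale_scaleR: "sc i (r *\<^sub>R x) = r *\<^sub>R sc i x"
  unfolding scale_of_real[symmetric] by (rule scale_left_commute)

lemma scale_scaleR_one: "sc (r *\<^sub>R 1) x = r *\<^sub>R x"
  using scale_of_real[of r x] by (simp add: of_real_def)

text \<open>A real functional \<open>f\<close> is the real part of \<open>v \<mapsto> f v - f (i v) i\<close>.\<close>

lemma real_functional_weakly_continuous:
  fixes f :: "'v \<Rightarrow> real"
  assumes f: "bounded_linear f"
  shows "continuous_map (weak_topology sc) euclidean f"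
proof -
  interpret f: bounded_linear f by (rule f)
  consider "\<forall>z::'k. \<exists>a. z = a *\<^sub>R 1" | i :: 'k where "i * i = - 1" "\<forall>z. \<exists>a b. z = a *\<^sub>R 1 + b *\<^sub>R i"
    using real_or_complex by blast
  then show ?thesis
  proof cases
    case 1
    have "bounded_functional sc (\<lambda>v. of_real (f v) :: 'k)"
      unfolding bounded_functional_def
    proof (intro conjI allI)
      show "bounded_linear (\<lambda>v. of_real (f v) :: 'k)"
        using bounded_linear_compose[OF bounded_linear_of_real f] .
      fix a v
      obtain r where "a = r *\<^sub>R (1::'k)" using 1 by blast
      then show "(of_real (f (sc a v)) :: 'k) = a * of_real (f v)"
        by (simp add: scale_scaleR_one f.scaleR of_real_def)
    qed
    moreover have "\<bar>f x - f y\<bar> \<le> 1 * norm (of_real (f x) - of_real (f y) :: 'k)" for x y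
      unfolding of_real_diff[symmetric] norm_of_real by simp
    ultimately show ?thesis by (rule continuous_map_weak_topology_if_dominated[OF _ zero_less_one])
  next
    case 2
    have "norm i * norm i = 1" using arg_cong[OF 2(1), of norm] by (simp add: norm_mult)
    then have ni: "norm i = 1" using norm_ge_zero[of i] by (metis abs_of_nonneg real_sqrt_abs2 real_sqrt_one)
    define F where "F v = of_real (f v) - of_real (f (sc i v)) * i" for v
    have lin: "linear F"
      unfolding F_def
      by (rule linearI)
        (simp_all add: f.add f.scaleR scale_right_distrib scale_scaleR algebra_simps scaleR_conv_of_real)
    obtain c where c: "\<And>x. norm (f x) \<le> norm x * c" using f.bounded by blast
    have "norm (F x) \<le> norm x * (c + c)" for x
    proof -
      have "norm (F x) \<le> norm (f x) + norm (f (sc i x))"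
        unfolding F_def using norm_triangle_ineq4[of "of_real (f x)" "of_real (f (sc i x)) * i"]
        by (simp add: norm_mult ni)
      then show ?thesis using c[of x] c[of "sc i x"] by (simp add: norm_scale ni algebra_simps)
    qed
    then have "bounded_linear F" using lin by (intro bounded_linear_of_norm_bound)
    moreover have "F (sc a v) = a * F v" for a v
    proof -
      obtain p q where a: "a = p *\<^sub>R 1 + q *\<^sub>R i" using 2(2) by blast
      have av: "sc a v = p *\<^sub>R v + q *\<^sub>R sc i v" for v
        unfolding a scale_left_distrib scale_scaleR_one
        by (metis scale_scale scale_of_real scaleR_conv_of_real)
      have iav: "sc i (sc a v) = p *\<^sub>R sc i v - q *\<^sub>R v"
        unfolding av by (simp add: scale_right_distrib scale_scaleR 2(1))
      have Fs: "F (sc a v) = of_real (p * f v + q * f (sc i v)) - of_real (p * f (sc i v) - q * f v) * i"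
        unfolding F_def iav unfolding av by (simp only: f.add f.diff f.scaleR real_scaleR_def)
      have aF: "a * F v = of_real p * of_real (f v) - of_real p * of_real (f (sc i v)) * i
          + of_real q * of_real (f v) * i - of_real q * of_real (f (sc i v)) * (i * i)"
        unfolding F_def a by (simp add: scaleR_conv_of_real algebra_simps)
      have "F (sc a v) - a * F v = 0" unfolding Fs aF 2(1) by (simp add: algebra_simps)
      then show ?thesis by simp
    qed
    ultimately have "bounded_functional sc F" unfolding bounded_functional_def by blast
    moreover have "\<bar>f x - f y\<bar> \<le> 2 * norm (F x - F y)" for x y
    proof -
      have "F x - F y = of_real (f x - f y) + of_real (f (sc i y) - f (sc i x)) * i"
        unfolding F_def by (simp add: algebra_simps)
      then show ?thesis using abs_le_norm_imaginary_unit[OF 2(1)] by metis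
    qed
    ultimately show ?thesis by (rule continuous_map_weak_topology_if_dominated[OF _ zero_less_numeral])
  qed
qed

text \<open>The weak closure of \<open>S\<close> is a closed part of the compact weak closure of
  \<open>X\<close>, so real functionals attain their maxima on it. Upper bounds on \<open>S\<close>
  pass to it because sublevel sets are weakly closed.\<close>

lemma functionals_attain_if_relatively_weakly_compact:
  assumes X: "relatively_weakly_compact sc X"
  shows "functionals_attain X"
  unfolding functionals_attain_def
proof (intro allI impI)
  let ?T = "weak_topology sc"
  fix S assume S: "S \<subseteq> X" "S \<noteq> {}"
  define K where "K = (?T closure_of S)"
  have SK: "S \<subseteq> K" unfolding K_def by (rule closure_of_subset) (simp add: topspace_weak_topology)
  have main: "\<forall>f :: 'v \<Rightarrow> real. bounded_linear f \<longrightarrow>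
      (\<exists>y\<in>K. \<forall>x\<in>K. f x \<le> f y) \<and> (\<forall>c. (\<forall>x\<in>S. f x \<le> c) \<longrightarrow> (\<forall>x\<in>K. f x \<le> c))"
  proof (intro allI impI conjI)
    fix f :: "'v \<Rightarrow> real" assume f: "bounded_linear f"
    have cont: "continuous_map ?T euclidean f" using real_functional_weakly_continuous[OF f] .
    have "compactin ?T K"
      using X closure_of_mono[OF S(1)] closedin_closure_of
      unfolding relatively_weakly_compact_def K_def by (rule closed_compactin)
    then have "compact (f ` K)" using image_compactin[OF _ cont] by simp
    moreover have "f ` K \<noteq> {}" using S(2) SK by blast
    ultimately have "\<exists>m\<in>f ` K. \<forall>t\<in>f ` K. t \<le> m" by (rule compact_attains_sup)
    then show "\<exists>y\<in>K. \<forall>x\<in>K. f x \<le> f y" by simp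
    fix c assume c: "\<forall>x\<in>S. f x \<le> c"
    have closed: "closedin ?T {x \<in> topspace ?T. f x \<in> {..c}}"
      using cont by (rule closedin_continuous_map_preimage) simp
    have "S \<subseteq> {x \<in> topspace ?T. f x \<in> {..c}}" using c by (auto simp: topspace_weak_topology)
    from closure_of_minimal[OF this closed] show "\<forall>x\<in>K. f x \<le> c" unfolding K_def by auto
  qed
  show "\<exists>K. S \<subseteq> K \<and> (\<forall>f :: 'v \<Rightarrow> real. bounded_linear f \<longrightarrow>
      (\<exists>y\<in>K. \<forall>x\<in>K. f x \<le> f y) \<and> (\<forall>c. (\<forall>x\<in>S. f x \<le> c) \<longrightarrow> (\<forall>x\<in>K. f x \<le> c)))"
    by (rule exI[of _ K], rule conjI[OF SK main])
qed

end

text \<open>Each functional and its negative attain a maximum on some \<open>K\<close> containing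
  \<open>X\<close>, so \<open>X\<close> is weakly bounded, hence norm bounded.\<close>

lemma functionals_attain_bounded:
  assumes X: "functionals_attain X"
  shows "\<exists>c. \<forall>x\<in>X. norm x \<le> c"
proof (cases "X = {}")
  case False
  obtain K where K: "X \<subseteq> K" "\<forall>f :: 'a \<Rightarrow> real. bounded_linear f \<longrightarrow>
      (\<exists>y\<in>K. \<forall>x\<in>K. f x \<le> f y) \<and> (\<forall>c. (\<forall>x\<in>X. f x \<le> c) \<longrightarrow> (\<forall>x\<in>K. f x \<le> c))"
    using X[unfolded functionals_attain_def, THEN spec, THEN mp, THEN mp, OF subset_refl False]
    by (elim exE conjE) (rule that)
  have upper: "\<exists>c. \<forall>x\<in>X. f x \<le> c" if f: "bounded_linear f" for f :: "'a \<Rightarrow> real"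
    using K(2)[THEN spec, THEN mp, OF f] K(1) by blast
  show ?thesis
  proof (rule bounded_of_weakly_bounded)
    fix f :: "'a \<Rightarrow> real" assume f: "bounded_linear f"
    obtain c where c: "\<forall>x\<in>X. f x \<le> c" using upper[OF f] by blast
    obtain d where d: "\<forall>x\<in>X. - f x \<le> d" using upper[OF bounded_linear_minus[OF f]] by blast
    have "\<bar>f x\<bar> \<le> max c d" if "x \<in> X" for x using c d that by fastforce
    then show "\<exists>c. \<forall>x\<in>X. \<bar>f x\<bar> \<le> c" by blast
  qed
qed simp

lemma (in banach_module) bounded_representation_if_weakly_almost_periodic:
  assumes wap: "weakly_almost_periodic G sc \<rho>"
  shows "\<exists>C>0. bounded_representation G \<rho> C"
proof -
  have GL: "\<rho> g \<in> carrier (GL sc)" if "g \<in> carrier G" for g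
    using representation that by (rule hom_in_carrier)
  have bl: "bounded_linear (\<rho> g)" and bij: "bij (\<rho> g)" if "g \<in> carrier G" for g
    using GL[OF that] unfolding GL_def bounded_operator_def by auto
  have mult: "\<rho> (g \<otimes> h) v = \<rho> g (\<rho> h v)" if "g \<in> carrier G" "h \<in> carrier G" for g h v
    using hom_mult[OF representation that] unfolding GL_def by simp
  \<comment> \<open>\<open>\<rho> \<one>\<close> is idempotent and injective, hence the
    identity.\<close>
  have one: "\<rho> \<one> v = v" for v
  proof (rule injD[OF bij_is_inj[OF bij[OF one_closed]]])
    show "\<rho> \<one> (\<rho> \<one> v) = \<rho> \<one> v"
      using mult[OF one_closed one_closed, of v, symmetric] unfolding l_one[OF one_closed] .
  qed
  have attain: "functionals_attain ((\<lambda>g. \<rho> g v) ` carrier G)" for v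
    using wap functionals_attain_if_relatively_weakly_compact unfolding weakly_almost_periodic_def by blast
  have "\<exists>c. \<forall>g\<in>carrier G. norm (\<rho> g v) \<le> c" for v
    using functionals_attain_bounded[OF attain[of v]] by auto
  then obtain C where "C > 0" "\<forall>g\<in>carrier G. \<forall>v. norm (\<rho> g v) \<le> C * norm v"
    using uniform_boundedness[of "carrier G" \<rho>] bl by blast
  then have "bounded_representation G \<rho> C"
    using \<open>C > 0\<close> attain one mult bounded_linear.linear[OF bl]
    by (intro bounded_representation.intro bounded_representation_axioms.intro group_axioms) auto
  then show ?thesis using \<open>C > 0\<close> by blast
qed

section \<open>Cochains and the compact-open topology\<close>

text \<open>By induction over the generation of the topology. For a subbasic set, the compact image
  of \<open>c\<close> has a uniform neighbourhood inside \<open>U\<close>; intersections take the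
  union of the compact sets and the smaller radius.\<close>

lemma compact_open_neighbourhood:
  fixes c :: "'a \<Rightarrow> 'v::real_normed_vector"
  assumes c: "c \<in> continuous_maps X" and N: "openin (compact_open_topology X) N" "c \<in> N"
  shows "\<exists>L e. compactin X L \<and> e > 0 \<and>
    (\<forall>c'\<in>continuous_maps X. (\<forall>x\<in>L. norm (c' x - c x) < e) \<longrightarrow> c' \<in> N)"
proof -
  have "generate_topology_on {{c \<in> continuous_maps X. c ` K \<subseteq> U} | K U. compactin X K \<and> open U} N"
    using N(1) unfolding compact_open_topology_def openin_topology_generated_by_iff .
  then show ?thesis using N(2)
  proof (induction rule: generate_topology_on.induct)
    case (Int a b)
    then obtain L e L' e' where "compactin X L" "e > 0" "compactin X L'" "e' > 0"
      and "\<And>c'. c' \<in> continuous_maps X \<Longrightarrow> (\<forall>x\<in>L. norm (c' x - c x) < e) \<Longrightarrow> c' \<in> a"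
      and "\<And>c'. c' \<in> continuous_maps X \<Longrightarrow> (\<forall>x\<in>L'. norm (c' x - c x) < e') \<Longrightarrow> c' \<in> b"
      by auto
    then show ?case
      by (intro exI[of _ "L \<union> L'"] exI[of _ "min e e'"]) (simp add: compactin_Un)
  next
    case (UN K)
    then obtain k where k: "k \<in> K" "c \<in> k" by blast
    then show ?case using UN.IH[OF k] by blast
  next
    case (Basis s)
    then obtain K U where s: "s = {c \<in> continuous_maps X. c ` K \<subseteq> U}" and K: "compactin X K" and U: "open U"
      by blast
    have "compact (c ` K)"
      using image_compactin[OF K, of euclidean c] c unfolding continuous_maps_def by simp
    moreover have cKU: "c ` K \<subseteq> U" using Basis.prems unfolding s by blast
    ultimately obtain e where e: "e > 0" "(\<Union>y\<in>c ` K. ball y e) \<subseteq> U"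
      using compact_subset_open_imp_ball_epsilon_subset[OF _ U] by metis
    have "c' \<in> s" if c': "c' \<in> continuous_maps X" "\<forall>x\<in>K. norm (c' x - c x) < e" for c'
    proof -
      have "c' x \<in> U" if "x \<in> K" for x
      proof -
        have "c' x \<in> ball (c x) e" using c'(2) that by (simp add: dist_norm norm_minus_commute)
        then show ?thesis using e(2) that by blast
      qed
      then show ?thesis unfolding s using c'(1) by blast
    qed
    then show ?case using K e(1) by blast
  qed simp
qed

lemma openin_compact_open_point:
  assumes "p \<in> topspace X" "open U"
  shows "openin (compact_open_topology X) {c \<in> continuous_maps X. c p \<in> U}"
proof -
  have "{c \<in> continuous_maps X. c p \<in> U} = {c \<in> continuous_maps X. c ` {p} \<subseteq> U}" by auto
  then show ?thesis
    unfolding compact_open_topology_def using assms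
    by (intro topology_generated_by_Basis CollectI exI[of _ "{p}"] exI[of _ U]) simp
qed

lemma topspace_compact_open: "topspace (compact_open_topology X) = continuous_maps X"
  unfolding compact_open_topology_def topology_generated_by_topspace
proof (intro equalityI subsetI)
  fix c :: "'a \<Rightarrow> 'b" assume "c \<in> continuous_maps X"
  then have "c \<in> {c \<in> continuous_maps X. c ` {} \<subseteq> UNIV}" by simp
  then show "c \<in> \<Union>{{c \<in> continuous_maps X. c ` K \<subseteq> U} | K U. compactin X K \<and> open U}"
    using compactin_empty open_UNIV by blast
qed blast

section \<open>Tuples of length one and two and the differential on them\<close>

definition pair_tuple :: "'g \<Rightarrow> 'g \<Rightarrow> nat \<Rightarrow> 'g" where
  "pair_tuple x y = (\<lambda>i\<in>{..<2}. if i = 0 then x else y)"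

lemma pair_tuple_simps [simp]: "pair_tuple x y 0 = x" "pair_tuple x y (Suc 0) = y" "pair_tuple x y 1 = y"
  unfolding pair_tuple_def by auto

lemma pair_tuple_eta:
  assumes "x \<in> extensional {..<2::nat}"
  shows "pair_tuple (x 0) (x 1) = x"
proof (rule extensionalityI[OF _ assms])
  show "pair_tuple (x 0) (x 1) \<in> extensional {..<2}" unfolding pair_tuple_def by simp
  fix i :: nat assume "i \<in> {..<2}"
  then have "i = 0 \<or> i = 1" by auto
  then show "pair_tuple (x 0) (x 1) i = x i" by auto
qed

lemma pair_tuple_cong:
  assumes "y 0 = a" "y 1 = b"
  shows "(\<lambda>i\<in>{..<2}. y i) = pair_tuple a b"
  unfolding pair_tuple_def using assms by (intro restrict_ext) (auto simp: less_2_cases_iff)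

lemma pair_tuple_topspace:
  "pair_tuple x y \<in> topspace (power_topology T 2) \<longleftrightarrow> x \<in> topspace T \<and> y \<in> topspace T"
proof -
  have "{..<2::nat} = {0, 1}" by auto
  then show ?thesis
    unfolding topspace_product_topology_alt by (auto simp: pair_tuple_def)
qed

lemma omit_two:
  "omit 2 0 x = pair_tuple (x 1) (x 2)" "omit 2 1 x = pair_tuple (x 0) (x 2)" "omit 2 2 x = pair_tuple (x 0) (x 1)"
  unfolding omit_def by (rule pair_tuple_cong; simp add: numeral_2_eq_2)+

lemma differential_two:
  assumes "x \<in> topspace (power_topology T 3)"
  shows "differential T 2 c x = c (pair_tuple (x 1) (x 2)) - c (pair_tuple (x 0) (x 2)) + c (pair_tuple (x 0) (x 1))"
proof -
  have "{..2::nat} = {0, 1, 2}" by auto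
  moreover have "x \<in> topspace (power_topology T (Suc 2))" using assms by (simp add: numeral_3_eq_3 numeral_2_eq_2)
  ultimately show ?thesis unfolding differential_def by (simp add: omit_two[simplified] omit_two)
qed

definition single_tuple :: "'g \<Rightarrow> nat \<Rightarrow> 'g" where
  "single_tuple x = (\<lambda>i\<in>{..<1}. x)"

lemma single_tuple_zero [simp]: "single_tuple x 0 = x"
  unfolding single_tuple_def by simp

lemma differential_one:
  assumes "x \<in> topspace (power_topology T 2)"
  shows "differential T 1 c x = c (single_tuple (x 1)) - c (single_tuple (x 0))"
proof -
  have "{..1::nat} = {0, 1}" by auto
  moreover have "omit 1 0 x = single_tuple (x 1)" "omit 1 1 x = single_tuple (x 0)"
    unfolding omit_def single_tuple_def by (auto intro!: restrict_ext)
  moreover have "x \<in> topspace (power_topology T (Suc 1))" using assms by (simp add: numeral_2_eq_2)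
  ultimately show ?thesis unfolding differential_def by simp
qed

lemma cochains_continuous: "c \<in> cochains G T \<rho> n \<Longrightarrow> c \<in> continuous_maps (power_topology T n)"
  unfolding cochains_def by blast

section \<open>Degree-one cocycles and coboundaries of a Banach module\<close>

context continuous_banach_module
begin

lemma pair_tuple_in: "x \<in> carrier G \<Longrightarrow> y \<in> carrier G \<Longrightarrow> pair_tuple x y \<in> topspace (power_topology T 2)"
  unfolding pair_tuple_topspace topspace_eq by blast

lemma rho_linear: "g \<in> carrier G \<Longrightarrow> linear (\<rho> g)"
  using hom_in_carrier[OF representation, of g] bounded_linear.linear
  unfolding GL_def bounded_operator_def by auto

lemma cochains_pair:
  assumes "c \<in> cochains G T \<rho> 2" "g \<in> carrier G" "x \<in> carrier G" "y \<in> carrier G"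
  shows "c (pair_tuple (g \<otimes> x) (g \<otimes> y)) = \<rho> g (c (pair_tuple x y))"
proof -
  have "pair_tuple x y \<in> topspace (power_topology T 2)"
    using assms(3,4) by (rule pair_tuple_in)
  then have "c (\<lambda>i\<in>{..<2}. g \<otimes> pair_tuple x y i) = \<rho> g (c (pair_tuple x y))"
    using assms unfolding cochains_def by blast
  moreover have "(\<lambda>i\<in>{..<2}. g \<otimes> pair_tuple x y i) = pair_tuple (g \<otimes> x) (g \<otimes> y)"
    by (rule pair_tuple_cong) auto
  ultimately show ?thesis by simp
qed

text \<open>Cochains are indexed by the number of variables, cocycles by degree: a cocycle of degree
  1 has two variables, and its differential is evaluated on triples.\<close>

lemma cocycles_one_iff:
  "c \<in> cocycles G T \<rho> 1 \<longleftrightarrow> c \<in> cochains G T \<rho> 2 \<and>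
    (\<forall>x\<in>carrier G. \<forall>y\<in>carrier G. \<forall>z\<in>carrier G.
      c (pair_tuple y z) - c (pair_tuple x z) + c (pair_tuple x y) = 0)"
proof -
  define D where "D x y z = c (pair_tuple y z) - c (pair_tuple x z) + c (pair_tuple x y)" for x y z
  have three: "{..<3::nat} = {0, 1, 2}" by auto
  have eq: "differential T 2 c x = D (x 0) (x 1) (x 2)" if "x \<in> topspace (power_topology T 3)" for x
    unfolding D_def using differential_two[OF that] .
  have "differential T 2 c = (\<lambda>_. 0) \<longleftrightarrow> (\<forall>x\<in>carrier G. \<forall>y\<in>carrier G. \<forall>z\<in>carrier G. D x y z = 0)"
  proof (intro iffI ballI ext)
    fix x y z assume d: "differential T 2 c = (\<lambda>_. 0)" and xyz: "x \<in> carrier G" "y \<in> carrier G" "z \<in> carrier G"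
    define t where "t = (\<lambda>i\<in>{..<3::nat}. if i = 0 then x else if i = 1 then y else z)"
    have t: "t 0 = x" "t 1 = y" "t 2 = z" unfolding t_def by auto
    have "t \<in> topspace (power_topology T 3)"
      unfolding topspace_product_topology_alt three using xyz by (auto simp: t_def topspace_eq)
    from eq[OF this] show "D x y z = 0" unfolding t d by simp
  next
    fix x assume d: "\<forall>x\<in>carrier G. \<forall>y\<in>carrier G. \<forall>z\<in>carrier G. D x y z = 0"
    show "differential T 2 c x = 0"
    proof (cases "x \<in> topspace (power_topology T 3)")
      case True
      then have "x 0 \<in> carrier G" "x 1 \<in> carrier G" "x 2 \<in> carrier G"
        unfolding topspace_product_topology_alt three topspace_eq by auto
      then show ?thesis unfolding eq[OF True] using d by blast
    next
      case False
      then show ?thesis unfolding differential_def by (simp add: numeral_3_eq_3 numeral_2_eq_2)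
    qed
  qed
  then show ?thesis unfolding cocycles_def D_def by (simp add: numeral_2_eq_2)
qed

lemma coboundaries_cocycle_identity:
  assumes "c \<in> coboundaries G T \<rho> 1" "x \<in> carrier G" "y \<in> carrier G" "z \<in> carrier G"
  shows "c (pair_tuple y z) - c (pair_tuple x z) + c (pair_tuple x y) = 0"
proof -
  obtain a where a: "c = differential T 1 a" using assms(1) unfolding coboundaries_def by auto
  have "c (pair_tuple p q) = a (single_tuple q) - a (single_tuple p)" if "p \<in> carrier G" "q \<in> carrier G" for p q
    unfolding a using differential_one[OF pair_tuple_in[OF that], of a] by simp
  then show ?thesis using assms(2-4) by simp
qed

text \<open>The primitive is the orbit map of \<open>w\<close>, which is equivariant, and continuous
  because the module is. These coboundaries are the ones that will approximate cocycles.\<close>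

lemma differential_orbit_map:
  "\<exists>d\<in>coboundaries G T \<rho> 1. d \<in> cochains G T \<rho> 2 \<and>
    (\<forall>x\<in>carrier G. \<forall>y\<in>carrier G. d (pair_tuple x y) = \<rho> y w - \<rho> x w)"
proof -
  have proj: "continuous_map (power_topology T n) T (\<lambda>x. x i)" if "i < n" for n i :: nat
    using continuous_map_product_projection[of i "{..<n}" "\<lambda>_. T"] that by simp
  have orb: "continuous_map (power_topology T n) euclidean (\<lambda>x. \<rho> (x i) w)" if "i < n" for n i :: nat
    using continuous_map_compose[OF proj[OF that] continuous_orbit_map] by (simp add: o_def)
  have mult: "\<rho> (g \<otimes> h) w = \<rho> g (\<rho> h w)" if "g \<in> carrier G" "h \<in> carrier G" for g h
    using hom_mult[OF representation that] unfolding GL_def by simp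
  have inG: "x i \<in> carrier G" if "x \<in> topspace (power_topology T n)" "i < n" for x n and i :: nat
    using that unfolding topspace_product_topology_alt topspace_eq by auto
  have closed: "(\<lambda>i\<in>{..<n}. g \<otimes> x i) \<in> topspace (power_topology T n)"
    if "x \<in> topspace (power_topology T n)" "g \<in> carrier G" for n x g
    using inG[OF that(1)] that(2) unfolding topspace_product_topology_alt topspace_eq by simp
  define a where "a x = (if x \<in> topspace (power_topology T 1) then \<rho> (x 0) w else 0)" for x
  have "a \<in> cochains G T \<rho> 1"
    unfolding cochains_def continuous_maps_def
  proof (intro CollectI conjI allI impI ballI)
    show "continuous_map (power_topology T 1) euclidean a"
    proof (rule continuous_map_eq)
      show "continuous_map (power_topology T 1) euclidean (\<lambda>x. \<rho> (x 0) w)" by (rule orb) simp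
    qed (simp only: a_def if_True)
    show "a x = 0" if "x \<notin> topspace (power_topology T 1)" for x using that unfolding a_def by simp
    fix g x assume g: "g \<in> carrier G" and x: "x \<in> topspace (power_topology T 1)"
    show "a (\<lambda>i\<in>{..<1}. g \<otimes> x i) = \<rho> g (a x)"
      using closed[OF x g] x mult[OF g inG[OF x, of 0]] unfolding a_def by simp
  qed
  then have cob: "differential T 1 a \<in> coboundaries G T \<rho> 1" unfolding coboundaries_def by auto
  have d: "differential T 1 a x = \<rho> (x 1) w - \<rho> (x 0) w" if x: "x \<in> topspace (power_topology T 2)" for x
  proof -
    have "single_tuple (x i) \<in> topspace (power_topology T 1)" if "i < 2" for i
      unfolding topspace_product_topology_alt topspace_eq using inG[OF x that] by (auto simp: single_tuple_def)
    then show ?thesis unfolding differential_one[OF x] a_def by simp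
  qed
  have "differential T 1 a \<in> cochains G T \<rho> 2"
    unfolding cochains_def continuous_maps_def
  proof (intro CollectI conjI allI impI ballI)
    show "continuous_map (power_topology T 2) euclidean (differential T 1 a)"
    proof (rule continuous_map_eq)
      show "continuous_map (power_topology T 2) euclidean (\<lambda>x. \<rho> (x 1) w - \<rho> (x 0) w)"
        by (rule continuous_map_diff[OF orb orb]) simp_all
    qed (rule d[symmetric])
    show "differential T 1 a x = 0" if "x \<notin> topspace (power_topology T 2)" for x
      using that unfolding differential_def by (simp add: numeral_2_eq_2)
    fix g x assume g: "g \<in> carrier G" and x: "x \<in> topspace (power_topology T 2)"
    show "differential T 1 a (\<lambda>i\<in>{..<2}. g \<otimes> x i) = \<rho> g (differential T 1 a x)"
      unfolding d[OF closed[OF x g]] d[OF x]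
      using mult[OF g inG[OF x, of 0]] mult[OF g inG[OF x, of 1]] linear_diff[OF rho_linear[OF g]] by simp
  qed
  moreover have "differential T 1 a (pair_tuple x y) = \<rho> y w - \<rho> x w"
    if "x \<in> carrier G" "y \<in> carrier G" for x y
    using d[OF pair_tuple_in[OF that]] by simp
  ultimately show ?thesis using cob by blast
qed

text \<open>Point evaluations are continuous in the compact-open topology and the cocycle identity
  involves three of them. A coboundary within \<open>e / 3\<close> at those points bounds the defect
  by \<open>e\<close>.\<close>

lemma closed_coboundaries_subset_cocycles: "closed_coboundaries G T \<rho> 1 \<subseteq> cocycles G T \<rho> 1"
proof
  fix c assume c: "c \<in> closed_coboundaries G T \<rho> 1"
  let ?X = "power_topology T 2"
  let ?S = "subtopology (compact_open_topology ?X) (cochains G T \<rho> 2)"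
  have c': "c \<in> ?S closure_of coboundaries G T \<rho> 1"
    using c unfolding closed_coboundaries_def by (simp add: numeral_2_eq_2)
  from subsetD[OF closure_of_subset_subtopology this] have cc: "c \<in> cochains G T \<rho> 2" .
  have "c (pair_tuple y z) - c (pair_tuple x z) + c (pair_tuple x y) = 0"
    if xyz: "x \<in> carrier G" "y \<in> carrier G" "z \<in> carrier G" for x y z
  proof -
    define near where "near e p = {c' \<in> continuous_maps ?X. c' p \<in> ball (c p) e}" for e p
    have "norm (c (pair_tuple y z) - c (pair_tuple x z) + c (pair_tuple x y)) \<le> e" if e: "e > 0" for e
    proof -
      have op: "openin (compact_open_topology ?X) (near (e / 3) (pair_tuple p q))"
        if "p \<in> carrier G" "q \<in> carrier G" for p q
        unfolding near_def using pair_tuple_in[OF that] open_ball by (rule openin_compact_open_point)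
      define Q where "Q = near (e / 3) (pair_tuple y z) \<inter> near (e / 3) (pair_tuple x z) \<inter> near (e / 3) (pair_tuple x y)"
      have "openin (compact_open_topology ?X) Q" unfolding Q_def using op xyz by (intro openin_Int)
      then have "openin ?S (Q \<inter> cochains G T \<rho> 2)" by (rule openin_subtopology_Int)
      moreover have "c \<in> Q \<inter> cochains G T \<rho> 2"
        using cc cochains_continuous[OF cc] e unfolding Q_def near_def by simp
      ultimately have "\<exists>d. d \<in> coboundaries G T \<rho> 1 \<and> d \<in> Q \<inter> cochains G T \<rho> 2"
        using c'[unfolded in_closure_of] by iprover
      then obtain d where d: "d \<in> coboundaries G T \<rho> 1" "d \<in> Q" by (elim exE conjE IntE)
      let ?p = "pair_tuple y z" and ?q = "pair_tuple x z" and ?r = "pair_tuple x y"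
      have n: "norm (c ?p - d ?p) < e / 3" "norm (c ?q - d ?q) < e / 3" "norm (c ?r - d ?r) < e / 3"
        using d(2) unfolding Q_def near_def by (auto simp: dist_norm)
      have tri: "norm (r - s + t) \<le> norm r + norm s + norm t" for r s t :: 'v
        using norm_triangle_ineq[of "r - s" t] norm_triangle_ineq4[of r s] by linarith
      have "c ?p - c ?q + c ?r = (c ?p - d ?p) - (c ?q - d ?q) + (c ?r - d ?r) + (d ?p - d ?q + d ?r)"
        by simp
      also have "d ?p - d ?q + d ?r = 0" using coboundaries_cocycle_identity[OF d(1) xyz] .
      finally have eq: "c ?p - c ?q + c ?r = (c ?p - d ?p) - (c ?q - d ?q) + (c ?r - d ?r)"
        by (simp only: add_0_right)
      show ?thesis
        unfolding eq using tri[of "c ?p - d ?p" "c ?q - d ?q" "c ?r - d ?r"] n by linarith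
    qed
    note small = this
    have "norm (c (pair_tuple y z) - c (pair_tuple x z) + c (pair_tuple x y)) \<le> 0"
    proof (rule field_le_epsilon)
      fix e :: real assume "0 < e"
      from small[OF this] show "norm (c (pair_tuple y z) - c (pair_tuple x z) + c (pair_tuple x y)) \<le> 0 + e"
        by (simp only: add_0_left)
    qed
    then show ?thesis by (simp only: norm_le_zero_iff)
  qed
  then show "c \<in> cocycles G T \<rho> 1" unfolding cocycles_one_iff using cc by blast
qed

lemma cocycles_subset_closed_coboundaries:
  assumes C: "bounded_representation G \<rho> C" "C > 0"
    and nil: "nilpotent_group G" and no_fixed: "fixed_vectors G \<rho> = {0}"
  shows "cocycles G T \<rho> 1 \<subseteq> closed_coboundaries G T \<rho> 1"
proof
  interpret R: bounded_representation G \<rho> C by (rule C(1))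
  let ?X = "power_topology T 2"
  fix c assume c: "c \<in> cocycles G T \<rho> 1"
  have cc: "c \<in> cochains G T \<rho> 2" using c unfolding cocycles_one_iff by blast
  have c_cont: "continuous_map ?X euclidean c"
    using cochains_continuous[OF cc] unfolding continuous_maps_def by blast
  \<comment> \<open>The inhomogeneous form of \<open>c\<close>; equivariance recovers
    \<open>c\<close> from it.\<close>
  define b where "b g = c (pair_tuple \<one> g)" for g
  have c_b: "c (pair_tuple x y) = \<rho> x (b (inv x \<otimes> y))" if "x \<in> carrier G" "y \<in> carrier G" for x y
    using cochains_pair[OF cc that(1) one_closed, of "inv x \<otimes> y"] that
    unfolding b_def by (simp add: m_assoc[symmetric])
  have b: "R.cocycle b"
    unfolding R.cocycle_def
  proof (intro ballI)
    fix g h assume gh: "g \<in> carrier G" "h \<in> carrier G"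
    have "c (pair_tuple g (g \<otimes> h)) - c (pair_tuple \<one> (g \<otimes> h)) + c (pair_tuple \<one> g) = 0"
      using c gh unfolding cocycles_one_iff by simp
    moreover have "c (pair_tuple g (g \<otimes> h)) = \<rho> g (b h)"
      using c_b[OF gh(1), of "g \<otimes> h"] gh by (simp add: m_assoc[symmetric])
    ultimately show "b (g \<otimes> h) = b g + \<rho> g (b h)" unfolding b_def by (simp add: algebra_simps)
  qed
  have "continuous_map T ?X (pair_tuple \<one>)"
    unfolding continuous_map_componentwise
  proof (intro conjI ballI)
    show "pair_tuple \<one> ` topspace T \<subseteq> extensional {..<2}" unfolding pair_tuple_def by auto
    fix k :: nat assume "k \<in> {..<2}"
    then have "k = 0 \<or> k = 1" by auto
    then show "continuous_map T T (\<lambda>x. pair_tuple \<one> x k)"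
      by (auto simp: continuous_map_const topspace_eq)
  qed
  from continuous_map_compose[OF this c_cont] have b_cont: "continuous_map T euclidean b"
    unfolding b_def by (simp add: o_def)
  have proj: "continuous_map ?X T (\<lambda>x. x i)" if "i < 2" for i :: nat
    using continuous_map_product_projection[of i "{..<2}" "\<lambda>_. T"] that by simp
  \<comment> \<open>Compact sets of pairs are pushed by \<open>m\<close> to compact sets of
    \<open>G\<close>, on which approximating \<open>b\<close> controls \<open>c\<close>.\<close>
  define m where "m x = inv (x 0) \<otimes> x 1" for x :: "nat \<Rightarrow> 'g"
  have "continuous_map ?X T (\<lambda>x. inv (x 0))"
    using continuous_map_compose[OF proj[of 0] continuous_inv] by (simp add: o_def)
  then have "continuous_map ?X (prod_topology T T) (\<lambda>x. (inv (x 0), x 1))"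
    using proj[of 1] by (intro continuous_map_pairedI) auto
  from continuous_map_compose[OF this continuous_mult] have m_cont: "continuous_map ?X T m"
    unfolding m_def by (simp add: o_def)
  have "\<exists>d. d \<in> coboundaries G T \<rho> 1 \<and> d \<in> N \<inter> cochains G T \<rho> 2"
    if N: "openin (compact_open_topology ?X) N" "c \<in> N" for N
  proof -
    obtain L e where L: "compactin ?X L" and e: "e > 0"
      and LN: "\<And>c'. c' \<in> continuous_maps ?X \<Longrightarrow> (\<forall>x\<in>L. norm (c' x - c x) < e) \<Longrightarrow> c' \<in> N"
      using compact_open_neighbourhood[OF cochains_continuous[OF cc] N] by blast
    have K: "compactin T (m ` L)" using image_compactin[OF L m_cont] .
    then have KG: "m ` L \<subseteq> carrier G" using compactin_subset_topspace topspace_eq by metis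
    have "compact (b ` m ` L)" using image_compactin[OF K b_cont] by simp
    with nil no_fixed b KG have "R.almost_coboundary (m ` L) b" by (rule R.cocycle_almost_coboundary)
    \<comment> \<open>The factor \<open>C\<close> allows for the application of
      \<open>\<rho> (x 0)\<close>; the factor 2 makes the final inequality strict.\<close>
    moreover have "e / (2 * C) > 0" using e C(2) by simp
    ultimately obtain u where u: "\<And>g. g \<in> m ` L \<Longrightarrow> norm (b g - (u - \<rho> g u)) \<le> e / (2 * C)"
      unfolding R.almost_coboundary_def by blast
    \<comment> \<open>The sign in \<open>- u\<close> reconciles
      \<open>\<rho> y w - \<rho> x w\<close> with the convention
      \<open>u - \<rho> g u\<close>.\<close>
    obtain d where d: "d \<in> coboundaries G T \<rho> 1" "d \<in> cochains G T \<rho> 2"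
      "\<And>x y. x \<in> carrier G \<Longrightarrow> y \<in> carrier G \<Longrightarrow> d (pair_tuple x y) = \<rho> y (- u) - \<rho> x (- u)"
      using differential_orbit_map by blast
    have "norm (d x - c x) < e" if x: "x \<in> L" for x
    proof -
      have xX: "x \<in> topspace ?X" using x compactin_subset_topspace[OF L] by blast
      then have x01: "x 0 \<in> carrier G" "x 1 \<in> carrier G" and ext: "x \<in> extensional {..<2}"
        unfolding topspace_product_topology_alt topspace_eq by auto
      have mx: "m x \<in> carrier G" and x1: "x 1 = x 0 \<otimes> m x"
        unfolding m_def using x01 by (simp_all add: m_assoc[symmetric])
      have lin: "linear (\<rho> (x 0))" using R.rep_linear[OF x01(1)] .
      have "d x = \<rho> (x 1) (- u) - \<rho> (x 0) (- u)" using d(3)[OF x01] unfolding pair_tuple_eta[OF ext] .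
      also have "\<dots> = \<rho> (x 0) (u - \<rho> (m x) u)"
        unfolding x1 R.rep_mult[OF x01(1) mx]
        by (simp add: linear_neg[OF R.rep_linear[OF mx]] linear_neg[OF lin] linear_diff[OF lin])
      finally have dx: "d x = \<rho> (x 0) (u - \<rho> (m x) u)" .
      have cx: "c x = \<rho> (x 0) (b (m x))" using c_b[OF x01] unfolding pair_tuple_eta[OF ext] m_def .
      have "norm (c x - d x) \<le> C * norm (b (m x) - (u - \<rho> (m x) u))"
        unfolding cx dx linear_diff[OF lin, symmetric] by (rule R.rep_bound[OF x01(1)])
      also have "\<dots> \<le> C * (e / (2 * C))" using u x C(2) by (intro mult_left_mono) auto
      also have "\<dots> < e" using C(2) e by simp
      finally show ?thesis by (simp add: norm_minus_commute)
    qed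
    then have "d \<in> N" using cochains_continuous[OF d(2)] by (intro LN) auto
    then show ?thesis using d by blast
  qed
  note approximable = this
  have "c \<in> subtopology (compact_open_topology ?X) (cochains G T \<rho> 2) closure_of coboundaries G T \<rho> 1"
    unfolding in_closure_of
  proof (intro conjI allI impI)
    show "c \<in> topspace (subtopology (compact_open_topology ?X) (cochains G T \<rho> 2))"
      unfolding topspace_subtopology topspace_compact_open using cc cochains_continuous[OF cc] by (rule IntI[rotated])
    fix M assume M: "c \<in> M \<and> openin (subtopology (compact_open_topology ?X) (cochains G T \<rho> 2)) M"
    then obtain N where N: "openin (compact_open_topology ?X) N" and MN: "M = N \<inter> cochains G T \<rho> 2"
      unfolding openin_subtopology by (elim exE conjE)
    have "c \<in> N" using M unfolding MN by simp
    from approximable[OF N this] show "\<exists>d. d \<in> coboundaries G T \<rho> 1 \<and> d \<in> M" unfolding MN .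
  qed
  then show "c \<in> closed_coboundaries G T \<rho> 1"
    unfolding closed_coboundaries_def by (simp add: numeral_2_eq_2)
qed

text \<open>The cohomology is a quotient of this group. Closure under real linear combinations gives
  sums through the coefficients 1 and 1, inverses through -1 and 0.\<close>

lemma comm_group_cocycle_group: "comm_group (cocycle_group G T \<rho> 1)"
proof -
  have cochain_comb: "(\<lambda>x. r *\<^sub>R c x + s *\<^sub>R d x) \<in> cochains G T \<rho> n"
    if c: "c \<in> cochains G T \<rho> n" and d: "d \<in> cochains G T \<rho> n" for r s n and c d :: "(nat \<Rightarrow> 'g) \<Rightarrow> 'v"
    unfolding cochains_def continuous_maps_def
  proof (intro CollectI conjI allI impI ballI)
    have scaleR: "continuous_map X euclidean (\<lambda>x. r *\<^sub>R f x)" if "continuous_map X euclidean f"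
      for X :: "(nat \<Rightarrow> 'g) topology" and r and f :: "(nat \<Rightarrow> 'g) \<Rightarrow> 'v"
    proof -
      have "continuous_map euclidean euclidean (\<lambda>v::'v. r *\<^sub>R v)"
        unfolding continuous_map_iff_continuous2 by (intro continuous_intros)
      from continuous_map_compose[OF that this] show ?thesis unfolding o_def .
    qed
    show "continuous_map (power_topology T n) euclidean (\<lambda>x. r *\<^sub>R c x + s *\<^sub>R d x)"
      using c d unfolding cochains_def continuous_maps_def by (intro continuous_map_add scaleR) blast+
    show "r *\<^sub>R c x + s *\<^sub>R d x = 0" if "x \<notin> topspace (power_topology T n)" for x
      using c d that unfolding cochains_def continuous_maps_def by simp
    fix g x assume g: "g \<in> carrier G" and x: "x \<in> topspace (power_topology T n)"
    have "c (\<lambda>i\<in>{..<n}. g \<otimes> x i) = \<rho> g (c x)" "d (\<lambda>i\<in>{..<n}. g \<otimes> x i) = \<rho> g (d x)"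
      using c d g x unfolding cochains_def by blast+
    then show "r *\<^sub>R c (\<lambda>i\<in>{..<n}. g \<otimes> x i) + s *\<^sub>R d (\<lambda>i\<in>{..<n}. g \<otimes> x i) = \<rho> g (r *\<^sub>R c x + s *\<^sub>R d x)"
      using rho_linear[OF g] by (simp only: linear_add linear_scale)
  qed
  have comb: "(\<lambda>x. r *\<^sub>R c x + s *\<^sub>R d x) \<in> cocycles G T \<rho> 1"
    if "c \<in> cocycles G T \<rho> 1" "d \<in> cocycles G T \<rho> 1" for r s and c d :: "(nat \<Rightarrow> 'g) \<Rightarrow> 'v"
    unfolding cocycles_one_iff
  proof (intro conjI ballI)
    show "(\<lambda>x. r *\<^sub>R c x + s *\<^sub>R d x) \<in> cochains G T \<rho> 2"
      using that unfolding cocycles_one_iff by (intro cochain_comb) auto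
    fix x y z assume xyz: "x \<in> carrier G" "y \<in> carrier G" "z \<in> carrier G"
    let ?p = "pair_tuple y z" and ?q = "pair_tuple x z" and ?r = "pair_tuple x y"
    have "c ?p - c ?q + c ?r = 0" "d ?p - d ?q + d ?r = 0"
      using that xyz unfolding cocycles_one_iff by blast+
    moreover have "r *\<^sub>R c ?p + s *\<^sub>R d ?p - (r *\<^sub>R c ?q + s *\<^sub>R d ?q) + (r *\<^sub>R c ?r + s *\<^sub>R d ?r)
        = r *\<^sub>R (c ?p - c ?q + c ?r) + s *\<^sub>R (d ?p - d ?q + d ?r)"
      by (simp add: algebra_simps)
    ultimately show "r *\<^sub>R c ?p + s *\<^sub>R d ?p - (r *\<^sub>R c ?q + s *\<^sub>R d ?q) + (r *\<^sub>R c ?r + s *\<^sub>R d ?r) = 0"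
      by simp
  qed
  have zero: "(\<lambda>_. 0 :: 'v) \<in> cocycles G T \<rho> 1"
    unfolding cocycles_one_iff cochains_def continuous_maps_def
    by (auto simp: linear_0[OF rho_linear])
  show ?thesis
  proof (rule comm_groupI)
    show "x \<otimes>\<^bsub>cocycle_group G T \<rho> 1\<^esub> y \<in> carrier (cocycle_group G T \<rho> 1)"
      if "x \<in> carrier (cocycle_group G T \<rho> 1)" "y \<in> carrier (cocycle_group G T \<rho> 1)" for x y
      using comb[of x y 1 1] that by (simp add: cocycle_group_def)
    show "\<exists>y\<in>carrier (cocycle_group G T \<rho> 1). y \<otimes>\<^bsub>cocycle_group G T \<rho> 1\<^esub> x = \<one>\<^bsub>cocycle_group G T \<rho> 1\<^esub>"
      if "x \<in> carrier (cocycle_group G T \<rho> 1)" for x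
      using comb[of x x "- 1" 0] that by (intro bexI[of _ "\<lambda>t. - x t"]) (auto simp: cocycle_group_def)
  qed (use zero in \<open>auto simp: cocycle_group_def algebra_simps\<close>)
qed

end

lemma (in group) trivial_group_Mod_carrier: "trivial_group (G Mod carrier G)"
proof -
  have "carrier G \<lhd> G" by (simp add: normal_inv_iff subgroup_self)
  then have "group (G Mod carrier G)" by (rule normal.factorgroup_is_group)
  moreover have "carrier (G Mod carrier G) = {carrier G}"
    unfolding carrier_FactGroup using coset_join2[OF _ subgroup_self] by force
  ultimately show ?thesis unfolding trivial_group_def by simp
qed

theorem theorem8:
  fixes G :: "('g, 'm) monoid_scheme"
    and T :: "'g topology"
    and sc :: "'k::real_or_complex_field \<Rightarrow> 'v::banach \<Rightarrow> 'v"
    and \<rho> :: "'g \<Rightarrow> 'v \<Rightarrow> 'v"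
  assumes "topological_group G T"
    and "nilpotent_group G"
    and "continuous_banach_module G T sc \<rho>"
    and "weakly_almost_periodic G sc \<rho>"
    and "fixed_vectors G \<rho> = {0}"
  shows "trivial_group (reduced_cohomology G T \<rho> 1)"
proof -
  interpret continuous_banach_module G T sc \<rho> by (rule assms(3))
  obtain C where C: "C > 0" "bounded_representation G \<rho> C"
    using bounded_representation_if_weakly_almost_periodic[OF assms(4)] by blast
  have eq: "closed_coboundaries G T \<rho> 1 = carrier (cocycle_group G T \<rho> 1)"
    using closed_coboundaries_subset_cocycles
      cocycles_subset_closed_coboundaries[OF C(2,1) assms(2,5)]
    by (simp add: cocycle_group_def)
  interpret Z: comm_group "cocycle_group G T \<rho> 1" by (rule comm_group_cocycle_group)
  show ?thesis unfolding reduced_cohomology_def eq by (rule Z.trivial_group_Mod_carrier)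
qed

end
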